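(* Let $\phi\in L^2(-1,0)$, let $D(z)=-iz+e^{-iz}+\int_{-1}^0e^{i\tau z}\phi(\tau)\,d\tau$ and let $\Lambda$ be its zero set. For $\lambda\in\Lambda$ let $\vec e_\lambda=(1,e^{i\lambda\tau})\in\mathcal M$ and let $\{\vec x_\lambda\}_{\lambda\in\Lambda}$ be the biorthogonal system. Let $l_n,R_n>0$ ($n\in\mathbb N$) satisfy $l_n\to\infty$, $R_n\to\infty$, $l_n^2/n\to0$, $n/R_n\to0$ and $e^{-\pi l_n/2}R_n\to0$ as $n\to\infty$. Let $W_n(z)=\exp\!\big(-l_n\pi-il_n\log\frac{z-n}{z+n}\big)$, $z\in\mathbb C_+$, define $w_n(\lambda)=W_n(\lambda)$ if $|\lambda|<R_n$ and $w_n(\lambda)=0$ otherwise, and let $$S_n\vec x=\sum_{\lambda\in\Lambda}w_n(\lambda)\langle\vec x,\vec x_\lambda\rangle\vec e_\lambda,\qquad\vec x\in\mathcal M.$$ Then $S_n\vec x\to\vec x$ in $\mathcal M$ as $n\to\infty$, for every $\vec x\in\mathcal M$.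
   Context: $\mathcal M=\mathbb C\times L^2(-1,0)$ with inner product $\langle(\xi,x),(\eta,y)\rangle=\xi\bar\eta+\int_{-1}^0x(t)\overline{y(t)}\,dt$. Standing assumptions: all zeros of $D$ lie in $\mathbb C_+=\{\operatorname{Im}z>0\}$ and are simple. The system $\{\vec e_\lambda\}_{\lambda\in\Lambda}$ is complete and minimal in $\mathcal M$, and $\{\vec x_\lambda=(\xi_\lambda,x_\lambda)\}_{\lambda\in\Lambda}$ is the unique system in $\mathcal M$ with $\langle\vec e_\mu,\vec x_\lambda\rangle=\delta_{\lambda,\mu}$. The logarithm is the branch with imaginary part in $(0,\pi)$ (for $z\in\mathbb C_+$, $\frac{z-n}{z+n}\in\mathbb C_+$). The sum defining $S_n$ is finite since $\Lambda$ has finitely many points in each disc. *)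

theory Defs
  imports "HOL-Analysis.Analysis"
begin

text \<open>Elements of M = C x L2(-1,0) are represented as pairs (xi, x) with
  x :: real => complex square integrable on [-1,0].\<close>

type_synonym Mvec = "complex \<times> (real \<Rightarrow> complex)"

definition L2 :: "(real \<Rightarrow> complex) \<Rightarrow> bool" where
  "L2 f \<longleftrightarrow> set_borel_measurable lborel {-1..0} f \<and>
            set_integrable lborel {-1..0} (\<lambda>t. (cmod (f t))^2)"

definition inM :: "Mvec \<Rightarrow> bool" where
  "inM u \<longleftrightarrow> L2 (snd u)"

definition Minner :: "Mvec \<Rightarrow> Mvec \<Rightarrow> complex" where
  "Minner u v = fst u * cnj (fst v) + (LINT t:{-1..0}|lborel. snd u t * cnj (snd v t))"

definition Mdist :: "Mvec \<Rightarrow> Mvec \<Rightarrow> real" where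
  "Mdist u v = sqrt ((cmod (fst u - fst v))^2 +
      (LINT t:{-1..0}|lborel. (cmod (snd u t - snd v t))^2))"

definition Mcomb :: "'a set \<Rightarrow> ('a \<Rightarrow> complex) \<Rightarrow> ('a \<Rightarrow> Mvec) \<Rightarrow> Mvec" where
  "Mcomb F c E = ((\<Sum>l\<in>F. c l * fst (E l)), (\<lambda>t. \<Sum>l\<in>F. c l * snd (E l) t))"

definition Mcomplete :: "('a \<Rightarrow> Mvec) \<Rightarrow> 'a set \<Rightarrow> bool" where
  "Mcomplete E A \<longleftrightarrow> (\<forall>u. inM u \<longrightarrow> (\<forall>\<epsilon>>0. \<exists>F c. finite F \<and> F \<subseteq> A \<and>
       Mdist u (Mcomb F c E) < \<epsilon>))"

definition Mminimal :: "('a \<Rightarrow> Mvec) \<Rightarrow> 'a set \<Rightarrow> bool" where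
  "Mminimal E A \<longleftrightarrow> (\<forall>m\<in>A. \<not> (\<forall>\<epsilon>>0. \<exists>F c. finite F \<and> F \<subseteq> A - {m} \<and>
       Mdist (E m) (Mcomb F c E) < \<epsilon>))"

definition Dfun :: "(real \<Rightarrow> complex) \<Rightarrow> complex \<Rightarrow> complex" where
  "Dfun \<phi> z = - \<i> * z + exp (- \<i> * z) +
      (LINT \<tau>:{-1..0}|lborel. exp (\<i> * complex_of_real \<tau> * z) * \<phi> \<tau>)"

definition evec :: "complex \<Rightarrow> Mvec" where
  "evec lam = (1, (\<lambda>\<tau>. exp (\<i> * lam * complex_of_real \<tau>)))"

text \<open>W_n(z) = exp(-l_n pi - i l_n log((z-n)/(z+n))); on the upper half-plane the
  principal logarithm Ln has imaginary part in (0, pi).\<close>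
definition Wn :: "real \<Rightarrow> nat \<Rightarrow> complex \<Rightarrow> complex" where
  "Wn l n z = exp (- complex_of_real (l * pi)
                   - \<i> * complex_of_real l * Ln ((z - of_nat n) / (z + of_nat n)))"

definition wn :: "real \<Rightarrow> real \<Rightarrow> nat \<Rightarrow> complex \<Rightarrow> complex" where
  "wn l R n lam = (if cmod lam < R then Wn l n lam else 0)"

text \<open>S_n x = sum over Lambda of w_n(lam) <x, x_lam> e_lam. Only the finitely many
  lam with |lam| < R_n contribute (w_n vanishes elsewhere).\<close>
definition Sop :: "complex set \<Rightarrow> (complex \<Rightarrow> Mvec) \<Rightarrow> real \<Rightarrow> real \<Rightarrow> nat \<Rightarrow> Mvec \<Rightarrow> Mvec" where
  "Sop Lam xs l R n u =
     Mcomb {lam\<in>Lam. cmod lam < R} (\<lambda>lam. wn l R n lam * Minner u (xs lam)) evec"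

end

theory Submission
  imports Defs "HOL-Complex_Analysis.Complex_Analysis"
begin

text \<open>
  By completeness of the exponentials it suffices to bound the operators on finite combinations
  \<open>\<Sum>\<^sub>\<mu> c\<^sub>\<mu> e\<^sub>\<mu>\<close>, uniformly in \<open>n\<close>; on such a combination the operator multiplies \<open>c\<^sub>\<mu>\<close> by
  \<open>w\<^sub>n(\<mu>)\<close>, and \<open>w\<^sub>n(\<mu>) \<rightarrow> 1\<close>. For a test vector \<open>v\<close> and \<open>V(z) = \<langle>e\<^sub>z, v\<rangle>\<close>, Cauchy's formula turns
  \<open>\<Sum>\<^sub>\<mu> c\<^sub>\<mu> W\<^sub>n(\<mu>) V(\<mu>)\<close> over the zeros in a rectangle into the integral of
  \<open>W\<^sub>n V \<Sum>\<^sub>\<mu> c\<^sub>\<mu>/(z - \<mu>)\<close> along its boundary. After subtracting functions that are holomorphic in the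
  upper half-plane, the integrand is controlled by \<open>(\<xi> + i z X - K)/D\<close>, where \<open>X\<close> is the exponential
  transform of the second component and \<open>K\<close> is bounded. On a horizontal line just above the real
  axis, \<open>\<bar>D(z)\<bar>\<close> is at least a multiple of \<open>1 + \<bar>z\<bar>\<close>, and Bessel's inequality bounds the integral by the
  norms. The vertical sides lie where \<open>-iz\<close> and \<open>exp(-iz)\<close> have nearly the same argument, so that
  \<open>\<bar>D(z)\<bar>\<close> is comparable to \<open>\<bar>z\<bar> + \<bar>exp(-iz)\<bar>\<close>; there and on the top side the smallness of \<open>W\<^sub>n\<close> compensates
  a loss of \<open>R\<^sub>n\<^sup>3\<^sup>/\<^sup>2\<close>. Between two consecutive admissible vertical sides there is at most one zero far
  from the origin, so the rectangle can be chosen to contain exactly the zeros with \<open>\<bar>\<lambda>\<bar> < R\<^sub>n\<close>.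
\<close>

section \<open>Square-integrable functions and their exponential transforms\<close>

text \<open>Each single operator is continuous, but with a constant depending on n; uniformity has
  to come from the contour. It rests on the identity D (P - X) = xi + i z X - K, where P is the sum
  of the i c/(z - mu). The exponentially growing terms cancel because each mu is a zero of D, and
  what remains is estimated by the norm of the combination alone: no bound on the individual
  coefficients enters. Two terms would still spoil the contour integral. Writing P as X plus a
  quotient by D leaves a product of X with the transform of the test function, which may grow almost
  like exp(Im z); and the constant part of V leaves a term that decays only like 1/|z| along the
  lower side. The two holomorphic corrections remove exactly these. The modulus of W_n is exp(-l (pi
  - a)), where a is the angle under which [-n,n] is seen from z. At distance 16 n this angle is
  below pi/4, so W_n is at most exp(-3 pi l/4). Since exp(-3 pi l/4) R^(3/2) is the power 3/2 of
  exp(-pi l/2) R, the growth condition on R pays exactly for the loss on the far sides.\<close>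

definition L2sq :: "(real \<Rightarrow> complex) \<Rightarrow> real" where
  "L2sq f = (LINT t:{-1..0}|lborel. (cmod (f t))^2)"

definition etrans :: "(real \<Rightarrow> complex) \<Rightarrow> complex \<Rightarrow> complex" where
  "etrans f z = (LINT t:{-1..0}|lborel. exp (\<i> * complex_of_real t * z) * f t)"

section \<open>Measurability and closure properties of square-integrable functions on [-1,0]\<close>

lemma L2_D: "L2 f \<Longrightarrow> (\<lambda>x. indicat_real {-1..0} x *\<^sub>R f x) \<in> borel_measurable borel"
  "L2 f \<Longrightarrow> set_integrable lborel {-1..0} (\<lambda>t. (cmod (f t))^2)"
  by (auto simp: L2_def set_borel_measurable_def)

lemma set_meas_mult:
  assumes "set_borel_measurable lborel A f" "set_borel_measurable lborel A g"
  shows "set_borel_measurable lborel A (\<lambda>t. f t * g t :: complex)"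
proof -
  have "(\<lambda>x. indicat_real A x *\<^sub>R (f x * g x)) =
      (\<lambda>x. (indicat_real A x *\<^sub>R f x) * (indicat_real A x *\<^sub>R g x))"
    by (auto simp: indicator_def)
  with borel_measurable_times[OF assms[unfolded set_borel_measurable_def]] show ?thesis
    unfolding set_borel_measurable_def by (simp only:)
qed

lemma set_meas_add:
  assumes "set_borel_measurable lborel A f" "set_borel_measurable lborel A g"
  shows "set_borel_measurable lborel A (\<lambda>t. f t + g t :: complex)"
proof -
  have "(\<lambda>x. indicat_real A x *\<^sub>R (f x + g x)) =
      (\<lambda>x. (indicat_real A x *\<^sub>R f x) + (indicat_real A x *\<^sub>R g x))"
    by (auto simp: indicator_def)
  with borel_measurable_add[OF assms[unfolded set_borel_measurable_def]] show ?thesis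
    unfolding set_borel_measurable_def by (simp only:)
qed

lemma set_meas_cmod2:
  assumes "set_borel_measurable lborel A (f :: real \<Rightarrow> complex)"
  shows "set_borel_measurable lborel A (\<lambda>t. (cmod (f t))^2)"
proof -
  have "(\<lambda>x. indicat_real A x *\<^sub>R (cmod (f x))^2) =
      (\<lambda>x. (cmod (indicat_real A x *\<^sub>R f x))^2)"
    by (auto simp: indicator_def)
  with borel_measurable_power[where n=2, OF measurable_compose[OF assms[unfolded set_borel_measurable_def] borel_measurable_norm]]
  show ?thesis unfolding set_borel_measurable_def by (simp only:)
qed

lemma set_meas_continuous:
  fixes h :: "real \<Rightarrow> complex"
  assumes "continuous_on {-1..0} h"
  shows "set_borel_measurable lborel {-1..0} h"
  unfolding set_borel_measurable_def
  using borel_measurable_continuous_on_indicator[OF _ assms] by simp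

lemma L2_mult_integrable:
  assumes "L2 f" "L2 g"
  shows "set_integrable lborel {-1..0} (\<lambda>t. f t * g t)"
proof (rule set_integrable_bound)
  show "set_integrable lborel {-1..0} (\<lambda>t. (cmod (f t))^2 + (cmod (g t))^2)"
    by (intro set_integral_add L2_D assms)
  show "set_borel_measurable lborel {-1..0} (\<lambda>t. f t * g t)"
    using assms by (intro set_meas_mult) (auto simp: L2_def)
  have *: "a * b \<le> a^2 + b^2" for a b :: real
    using sum_squares_bound[of a b] zero_le_power2[of a] zero_le_power2[of b] by linarith
  show "AE x in lborel. x \<in> {-1..0} \<longrightarrow> norm (f x * g x) \<le> norm ((cmod (f x))^2 + (cmod (g x))^2)"
    using * by (auto simp: norm_mult)
qed

lemma cmod_add_squared_le: "(cmod (a + b))^2 \<le> 2 * (cmod a)^2 + 2 * (cmod b)^2"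
proof -
  have "(cmod (a + b))^2 \<le> (cmod a + cmod b)^2"
    by (intro power_mono norm_triangle_ineq) auto
  also have "\<dots> \<le> 2 * (cmod a)^2 + 2 * (cmod b)^2"
    using sum_squares_bound[of "cmod a" "cmod b"] by (simp add: power2_sum)
  finally show ?thesis .
qed

lemma L2_add:
  assumes "L2 f" "L2 g"
  shows "L2 (\<lambda>t. f t + g t)"
  unfolding L2_def
proof
  show m: "set_borel_measurable lborel {-1..0} (\<lambda>t. f t + g t)"
    using assms by (intro set_meas_add) (auto simp: L2_def)
  show "set_integrable lborel {-1..0} (\<lambda>t. (cmod (f t + g t))\<^sup>2)"
  proof (rule set_integrable_bound)
    show "set_integrable lborel {-1..0} (\<lambda>t. 2 * (cmod (f t))^2 + 2 * (cmod (g t))^2)"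
      by (intro set_integral_add set_integrable_mult_right L2_D assms)
    show "AE x in lborel. x \<in> {-1..0} \<longrightarrow>
        norm ((cmod (f x + g x))\<^sup>2) \<le> norm (2 * (cmod (f x))^2 + 2 * (cmod (g x))^2)"
      using cmod_add_squared_le by (auto intro!: AE_I2)
  qed (rule set_meas_cmod2[OF m])
qed

lemma L2_mult_bounded:
  assumes "L2 f" and h: "set_borel_measurable lborel {-1..0} h"
    and B: "\<And>t. t \<in> {-1..0} \<Longrightarrow> cmod (h t) \<le> B"
  shows "L2 (\<lambda>t. h t * f t)"
  unfolding L2_def
proof
  show m: "set_borel_measurable lborel {-1..0} (\<lambda>t. h t * f t)"
    using assms by (intro set_meas_mult) (auto simp: L2_def)
  show "set_integrable lborel {-1..0} (\<lambda>t. (cmod (h t * f t))\<^sup>2)"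
  proof (rule set_integrable_bound)
    show "set_integrable lborel {-1..0} (\<lambda>t. B^2 * (cmod (f t))^2)"
      by (intro set_integrable_mult_right L2_D assms)
    show "AE x in lborel. x \<in> {-1..0} \<longrightarrow> norm ((cmod (h x * f x))\<^sup>2) \<le> norm (B^2 * (cmod (f x))^2)"
      using B by (auto simp: norm_mult power_mult_distrib intro!: AE_I2 mult_right_mono power_mono)
  qed (rule set_meas_cmod2[OF m])
qed

lemma L2_one: "L2 (\<lambda>t. 1)"
  unfolding L2_def
  by (auto intro!: set_meas_continuous borel_integrable_atLeastAtMost' continuous_intros)

lemma L2_mult_continuous:
  assumes "L2 f" and h: "continuous_on {-1..0} h"
  shows "L2 (\<lambda>t. h t * f t)"
proof -
  have "bounded (h ` {-1..0})"
    by (intro compact_imp_bounded compact_continuous_image h) auto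
  then obtain B where "\<And>t. t \<in> {-1..0} \<Longrightarrow> cmod (h t) \<le> B"
    unfolding bounded_iff by (metis imageI)
  then show ?thesis
    using L2_mult_bounded[OF assms(1) set_meas_continuous[OF h]] by blast
qed

lemma L2_continuous: "continuous_on {-1..0} h \<Longrightarrow> L2 h"
  using L2_mult_continuous[OF L2_one] by simp

lemma L2_cmult: "L2 f \<Longrightarrow> L2 (\<lambda>t. c * f t)"
  by (rule L2_mult_continuous) auto

lemma L2_diff: "L2 f \<Longrightarrow> L2 g \<Longrightarrow> L2 (\<lambda>t. f t - g t)"
  using L2_add[of f "\<lambda>t. -1 * g t"] L2_cmult[of g "-1"] by simp

lemma L2_cnj: 
  assumes "L2 f" shows "L2 (\<lambda>t. cnj (f t))"
proof -
  have "(\<lambda>x. indicat_real {-1..0} x *\<^sub>R cnj (f x)) = (\<lambda>x. cnj (indicat_real {-1..0} x *\<^sub>R f x))"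
    by (auto simp: indicator_def)
  moreover have "(\<lambda>x. cnj (indicat_real {-1..0} x *\<^sub>R f x)) \<in> borel_measurable borel"
    by (rule borel_measurable_continuous_on[OF _ L2_D(1)[OF assms], of cnj])
       (intro continuous_intros)
  ultimately show ?thesis
    using assms by (simp add: L2_def set_borel_measurable_def)
qed

lemma L2_integrable: "L2 f \<Longrightarrow> set_integrable lborel {-1..0} f"
  using L2_mult_integrable[of f "\<lambda>t. 1"] L2_one by simp

lemma L2sq_nonneg: "0 \<le> L2sq f"
  unfolding L2sq_def set_lebesgue_integral_def by (rule integral_nonneg_AE) auto

section \<open>The Cauchy-Schwarz inequality from a discriminant\<close>

lemma quadratic_nonneg_discriminant:
  fixes a b c :: real
  assumes "\<And>t. 0 \<le> a * t^2 + 2 * b * t + c" "0 \<le> a"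
  shows "b^2 \<le> a * c"
proof (cases "a = 0")
  case True
  have "b = 0"
  proof (rule ccontr)
    assume "b \<noteq> 0"
    \<comment> \<open>For a = 0 the form is linear, and at this point its value is -1.\<close>
    then show False using assms(1)[of "- (c + 1) / (2 * b)"] True by simp
  qed
  then show ?thesis using True by simp
next
  case False
  then have "a > 0" using assms by simp
  have "0 \<le> a * (- b / a)^2 + 2 * b * (- b / a) + c" by (rule assms)
  also have "\<dots> = c - b^2 / a" using False by (simp add: power2_eq_square field_simps)
  finally show ?thesis using \<open>a > 0\<close> by (simp add: field_simps)
qed

text \<open>The integral of (|f| t + |g|)^2 is a nonnegative quadratic in t. With the moduli inside
  the integral, the case g = 1 also bounds the L1 norm by the L2 norm.\<close>

lemma L2_Cauchy_Schwarz_abs: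
  assumes "L2 f" "L2 g"
  shows "(LINT t:{-1..0}|lborel. cmod (f t) * cmod (g t))^2 \<le> L2sq f * L2sq g"
proof (rule quadratic_nonneg_discriminant)
  have fg: "set_integrable lborel {-1..0} (\<lambda>t. cmod (f t) * cmod (g t))"
    using set_integrable_norm[OF L2_mult_integrable[OF assms]] by (simp add: norm_mult)
  fix t :: real
  have "0 \<le> (LINT x:{-1..0}|lborel. (cmod (f x) * t + cmod (g x))^2)"
    unfolding set_lebesgue_integral_def by (rule integral_nonneg_AE) auto
  also have "\<dots> = (LINT x:{-1..0}|lborel. t^2 * (cmod (f x))^2 + 2 * t * (cmod (f x) * cmod (g x)) + (cmod (g x))^2)"
    by (rule arg_cong[where f = "set_lebesgue_integral lborel {-1..0}"])
       (auto simp: power2_eq_square algebra_simps)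
  also have "\<dots> = L2sq f * t^2 + 2 * (LINT t:{-1..0}|lborel. cmod (f t) * cmod (g t)) * t + L2sq g"
    unfolding L2sq_def using assms fg L2_D
    by (subst set_integral_add, (intro set_integral_add set_integrable_mult_right; simp)+)+ auto
  finally show "0 \<le> L2sq f * t^2 + 2 * (LINT t:{-1..0}|lborel. cmod (f t) * cmod (g t)) * t + L2sq g" .
qed (rule L2sq_nonneg)

lemma L2_Cauchy_Schwarz:
  assumes "L2 f" "L2 g"
  shows "(cmod (LINT t:{-1..0}|lborel. f t * g t))^2 \<le> L2sq f * L2sq g"
proof -
  have "cmod (LINT t:{-1..0}|lborel. f t * g t) \<le> (LINT t:{-1..0}|lborel. cmod (f t) * cmod (g t))"
    using set_integral_norm_bound[OF L2_mult_integrable[OF assms]] by (simp add: norm_mult)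
  then show ?thesis
    using L2_Cauchy_Schwarz_abs[OF assms] by (meson norm_ge_zero order_trans power_mono)
qed

lemma L2sq_mono_mult:
  assumes "L2 f" "continuous_on {-1..0} h" "\<And>t. t \<in> {-1..0} \<Longrightarrow> cmod (h t) \<le> B"
  shows "L2sq (\<lambda>t. h t * f t) \<le> B^2 * L2sq f"
proof -
  have "L2sq (\<lambda>t. h t * f t) \<le> (LINT t:{-1..0}|lborel. B^2 * (cmod (f t))^2)"
    unfolding L2sq_def
    by (rule set_integral_mono)
       (use assms L2_D[OF assms(1)] L2_D(2)[OF L2_mult_continuous[OF assms(1,2)]] in
        \<open>auto simp: norm_mult power_mult_distrib intro!: mult_right_mono power_mono\<close>)
  then show ?thesis by (simp add: L2sq_def)
qed

lemma L2sq_add_le: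
  assumes "L2 f" "L2 g"
  shows "L2sq (\<lambda>t. f t + g t) \<le> 2 * L2sq f + 2 * L2sq g"
proof -
  have "L2sq (\<lambda>t. f t + g t) \<le> (LINT t:{-1..0}|lborel. 2 * (cmod (f t))^2 + 2 * (cmod (g t))^2)"
    unfolding L2sq_def
    by (rule set_integral_mono)
       (use cmod_add_squared_le assms L2_D L2_add[OF assms] in \<open>auto intro!: set_integral_add set_integrable_mult_right\<close>)
  also have "\<dots> = 2 * L2sq f + 2 * L2sq g"
    unfolding L2sq_def by (subst set_integral_add) (use assms L2_D in auto)
  finally show ?thesis .
qed

lemma abs_mult_le_of_unit_interval: "t \<in> {-1..0} \<Longrightarrow> 0 \<le> a \<Longrightarrow> \<bar>t\<bar> * a \<le> (a::real)"
  using mult_right_mono[of "-t" 1 a] by auto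

lemma set_integral_norm_le_integral:
  fixes f :: "real \<Rightarrow> complex"
  assumes "set_integrable lborel A f" "set_integrable lborel A g"
    and "\<And>t. t \<in> A \<Longrightarrow> cmod (f t) \<le> g t"
  shows "cmod (LINT t:A|lborel. f t) \<le> (LINT t:A|lborel. g t)"
proof -
  have "cmod (LINT t:A|lborel. f t) \<le> (LINT t:A|lborel. cmod (f t))"
    by (rule set_integral_norm_bound[OF assms(1)])
  also have "\<dots> \<le> (LINT t:A|lborel. g t)"
    using set_integrable_norm[OF assms(1)] assms by (intro set_integral_mono) auto
  finally show ?thesis .
qed

section \<open>The exponential transform is entire\<close>

lemma etrans_integrable:
  assumes "set_integrable lborel {-1..0} f"
  shows "set_integrable lborel {-1..0} (\<lambda>t. exp (\<i> * complex_of_real t * z) * f t)"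
proof (rule set_integrable_bound)
  show "set_integrable lborel {-1..0} (\<lambda>t. exp \<bar>Im z\<bar> * cmod (f t))"
    using set_integrable_norm[OF assms] by simp
  show "set_borel_measurable lborel {-1..0} (\<lambda>t. exp (\<i> * complex_of_real t * z) * f t)"
    using assms
    by (intro set_meas_mult[OF set_meas_continuous] continuous_intros)
       (simp add: set_integrable_def set_borel_measurable_def)
  have "\<bar>t * Im z\<bar> \<le> \<bar>Im z\<bar>" if "t \<in> {-1..0}" for t
    using abs_mult_le_of_unit_interval[OF that, of "\<bar>Im z\<bar>"] by (simp add: abs_mult)
  then have "- (t * Im z) \<le> \<bar>Im z\<bar>" if "t \<in> {-1..0}" for t
    using that by (meson abs_le_D2)
  then show "AE x in lborel. x \<in> {-1..0} \<longrightarrow> norm (exp (\<i> * complex_of_real x * z) * f x)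
      \<le> norm (exp \<bar>Im z\<bar> * cmod (f x))"
    by (auto simp: norm_mult intro!: AE_I2 mult_right_mono)
qed

text \<open>Differentiation under the integral sign: the second-order Taylor remainder of the
  exponential is bounded uniformly for t in [-1,0], so the difference quotient misses the candidate
  derivative by O(|h|).\<close>

lemma etrans_has_field_derivative:
  assumes f: "set_integrable lborel {-1..0} f"
  shows "(etrans f has_field_derivative
           (LINT t:{-1..0}|lborel. exp (\<i> * complex_of_real t * z) * (\<i> * t * f t))) (at z)"
proof -
  define d where "d = (LINT t:{-1..0}|lborel. exp (\<i> * complex_of_real t * z) * (\<i> * t * f t))"
  define C where "C = (LINT t:{-1..0}|lborel. exp \<bar>Im z\<bar> * cmod (f t))"
  have fn: "set_integrable lborel {-1..0} (\<lambda>t. cmod (f t))"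
    using set_integrable_norm[OF f] by simp
  have tf: "set_integrable lborel {-1..0} (\<lambda>t. \<i> * complex_of_real t * f t)"
  proof (rule set_integrable_bound[OF f])
    show "set_borel_measurable lborel {-1..0} (\<lambda>t. \<i> * complex_of_real t * f t)"
      using f by (intro set_meas_mult[OF set_meas_continuous] continuous_intros)
         (simp add: set_integrable_def set_borel_measurable_def)
  qed (auto simp: norm_mult simp del: abs_of_nonpos intro!: AE_I2 abs_mult_le_of_unit_interval)
  have bd: "cmod ((etrans f (z + h) - etrans f z) / h - d) \<le> cmod h * exp (cmod h) * C" if "h \<noteq> 0" for h
  proof -
    have "etrans f (z + h) - etrans f z - h * d = (LINT t:{-1..0}|lborel.
        exp (\<i> * t * z) * (exp (\<i> * t * h) - 1 - \<i> * t * h) * f t)"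
    proof -
      have "etrans f (z + h) - etrans f z - h * d =
         (LINT t:{-1..0}|lborel. exp (\<i> * t * (z + h)) * f t - exp (\<i> * t * z) * f t
             - h * (exp (\<i> * complex_of_real t * z) * (\<i> * t * f t)))"
        unfolding etrans_def d_def
        using etrans_integrable[OF f] etrans_integrable[OF tf]
        by (subst set_integral_diff, (intro set_integral_diff set_integrable_mult_right; simp)+)+ auto
      also have "\<dots> = (LINT t:{-1..0}|lborel.
        exp (\<i> * t * z) * (exp (\<i> * t * h) - 1 - \<i> * t * h) * f t)"
        by (rule arg_cong[where f = "set_lebesgue_integral lborel {-1..0}"])
           (auto simp: algebra_simps exp_add)
      finally show ?thesis .
    qed
    also have "cmod \<dots> \<le> (LINT t:{-1..0}|lborel. (exp (cmod h) * (cmod h)^2) * (exp \<bar>Im z\<bar> * cmod (f t)))"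
    proof (rule set_integral_norm_le_integral)
      have "set_integrable lborel {-1..0} (\<lambda>t. exp (\<i> * t * (z + h)) * f t - exp (\<i> * t * z) * f t
             - h * (exp (\<i> * complex_of_real t * z) * (\<i> * t * f t)))"
        using etrans_integrable[OF f] etrans_integrable[OF tf]
        by (intro set_integral_diff set_integrable_mult_right; simp)
      then show "set_integrable lborel {-1..0} (\<lambda>t.
          exp (\<i> * complex_of_real t * z) * (exp (\<i> * complex_of_real t * h) - 1 - \<i> * complex_of_real t * h) * f t)"
        by (simp add: algebra_simps exp_add)
      show "set_integrable lborel {-1..0} (\<lambda>t. (exp (cmod h) * (cmod h)^2) * (exp \<bar>Im z\<bar> * cmod (f t)))"
        using fn by simp
      fix t :: real
      assume True: "t \<in> {-1..0}"
      show "cmod (exp (\<i> * complex_of_real t * z) * (exp (\<i> * complex_of_real t * h) - 1 - \<i> * complex_of_real t * h) * f t)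
          \<le> (exp (cmod h) * (cmod h)^2) * (exp \<bar>Im z\<bar> * cmod (f t))"
      proof -
        have t1: "\<bar>t\<bar> \<le> 1" using True by auto
        have "\<bar>t * Im z\<bar> \<le> \<bar>Im z\<bar>"
          using abs_mult_le_of_unit_interval[OF True, of "\<bar>Im z\<bar>"] by (simp add: abs_mult)
        then have 1: "cmod (exp (\<i> * complex_of_real t * z)) \<le> exp \<bar>Im z\<bar>"
          by simp
        let ?w = "\<i> * complex_of_real t * h"
        have w: "cmod ?w \<le> cmod h"
          using t1 by (simp add: norm_mult mult_left_le_one_le)
        have "cmod (exp ?w - (\<Sum>i\<le>1. ?w ^ i / fact i)) \<le> exp \<bar>Re ?w\<bar> * (cmod ?w) ^ Suc 1 / fact 1"
          by (rule Taylor_exp)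
        then have "cmod (exp ?w - 1 - ?w) \<le> exp \<bar>Re ?w\<bar> * (cmod ?w)^2"
          by (simp add: numeral_2_eq_2 diff_diff_eq)
        also have "\<dots> \<le> exp (cmod h) * (cmod h)^2"
          using w abs_Re_le_cmod[of ?w] by (intro mult_mono power_mono) auto
        finally have 2: "cmod (exp ?w - 1 - ?w) \<le> exp (cmod h) * (cmod h)^2" .
        have "cmod (exp (\<i> * t * z) * (exp ?w - 1 - ?w) * f t)
           \<le> exp \<bar>Im z\<bar> * (exp (cmod h) * (cmod h)^2) * cmod (f t)"
          unfolding norm_mult[of _ "f t"] norm_mult[of "exp (\<i> * t * z)"]
          using 1 2 by (intro mult_right_mono mult_mono) auto
        then show ?thesis by (simp add: mult_ac)
      qed
    qed
    also have "\<dots> = (exp (cmod h) * (cmod h)^2) * C"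
      unfolding C_def by (rule set_integral_mult_right)
    finally have *: "cmod (etrans f (z + h) - etrans f z - h * d) \<le> exp (cmod h) * (cmod h)^2 * C" .
    have "cmod ((etrans f (z + h) - etrans f z) / h - d) = cmod (etrans f (z + h) - etrans f z - h * d) / cmod h"
      using that by (simp add: norm_divide[symmetric] diff_divide_distrib)
    also have "\<dots> \<le> exp (cmod h) * (cmod h)^2 * C / cmod h"
      by (intro divide_right_mono *) auto
    finally show ?thesis using that by (simp add: power2_eq_square mult_ac)
  qed
  have "((\<lambda>h. (etrans f (z + h) - etrans f z) / h - d) \<longlongrightarrow> 0) (at 0)"
  proof (rule Lim_null_comparison)
    show "\<forall>\<^sub>F h in at 0. cmod ((etrans f (z + h) - etrans f z) / h - d) \<le> cmod h * exp (cmod h) * C"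
      using bd by (auto simp: eventually_at_filter)
    have "((\<lambda>h::complex. cmod h * exp (cmod h) * C) \<longlongrightarrow> cmod 0 * exp (cmod 0) * C) (at 0)"
      by (intro tendsto_intros)
    then show "((\<lambda>h::complex. cmod h * exp (cmod h) * C) \<longlongrightarrow> 0) (at 0)" by simp
  qed
  then show ?thesis
    unfolding DERIV_def d_def[symmetric] using Lim_null by blast
qed

lemma etrans_holomorphic: "set_integrable lborel {-1..0} f \<Longrightarrow> etrans f holomorphic_on A"
  using etrans_has_field_derivative holomorphic_onI field_differentiable_at_within field_differentiable_def
  by (metis (no_types, lifting))

section \<open>Bessel's inequality\<close>

lemma LINT_exp:
  fixes c :: complex
  assumes "c \<noteq> 0"
  shows "(LINT t:{-1..0}|lborel. exp (c * complex_of_real t)) = (1 - exp (- c)) / c"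
proof -
  have "(LINT t:{-1..0}|lborel. exp (c * complex_of_real t))
      = exp (c * complex_of_real 0) / c - exp (c * complex_of_real (-1)) / c"
    unfolding set_lebesgue_integral_def
    by (rule integral_FTC_atLeastAtMost)
       (auto intro!: derivative_eq_intros continuous_intros has_vector_derivative_real_field simp: assms)
  then show ?thesis by (simp add: diff_divide_distrib)
qed

lemma LINT_exp_real:
  fixes c :: real
  assumes "c \<noteq> 0"
  shows "(LINT t:{-1..0}|lborel. exp (c * t)) = (1 - exp (- c)) / c"
proof -
  have "(LINT t:{-1..0}|lborel. exp (c * t)) = exp (c * 0) / c - exp (c * (-1)) / c"
    unfolding set_lebesgue_integral_def
    by (rule integral_FTC_atLeastAtMost)
       (auto intro!: derivative_eq_intros continuous_intros
         simp: assms has_real_derivative_iff_has_vector_derivative[symmetric])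
  then show ?thesis by (simp add: diff_divide_distrib)
qed

text \<open>Pythagoras: the integral of e f is the inner product of f with \<open>cnj e\<close>, a
  unit vector because the interval has length 1.\<close>

lemma L2sq_sub_projection:
  assumes f: "L2 f" and e: "continuous_on {-1..0} e" and e1: "\<And>t. cmod (e t) = 1"
  shows "L2sq (\<lambda>t. f t - (LINT s:{-1..0}|lborel. e s * f s) * cnj (e t))
       = L2sq f - (cmod (LINT s:{-1..0}|lborel. e s * f s))^2"
proof -
  define a where "a = (LINT s:{-1..0}|lborel. e s * f s)"
  have ef: "set_integrable lborel {-1..0} (\<lambda>t. e t * f t)"
    by (intro L2_integrable L2_mult_continuous f e)
  have pt: "(cmod (f t - a * cnj (e t)))^2 = (cmod (f t))^2 - 2 * Re (cnj a * (e t * f t)) + (cmod a)^2" for t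
  proof -
    have "e t * cnj (e t) = 1" using e1[of t] by (simp add: complex_norm_square[symmetric])
    moreover have "complex_of_real ((cmod (f t - a * cnj (e t)))^2) =
        f t * cnj (f t) - (cnj a * (e t * f t) + cnj (cnj a * (e t * f t))) + a * cnj a * (e t * cnj (e t))"
      unfolding complex_norm_square by (simp add: algebra_simps)
    ultimately have "complex_of_real ((cmod (f t - a * cnj (e t)))^2) =
       complex_of_real ((cmod (f t))^2 - 2 * Re (cnj a * (e t * f t)) + (cmod a)^2)"
      by (simp only: complex_norm_square of_real_add of_real_diff mult_1_right complex_add_cnj)
    then show ?thesis by (simp only: of_real_eq_iff)
  qed
  have aef: "set_integrable lborel {-1..0} (\<lambda>t. cnj a * (e t * f t))"
    using ef by simp
  have re_i: "set_integrable lborel {-1..0} (\<lambda>t. Re (cnj a * (e t * f t)))"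
    using integrable_Re[OF aef[unfolded set_integrable_def]] by (simp add: set_integrable_def)
  have "(LINT t:{-1..0}|lborel. Re (cnj a * (e t * f t))) = Re (LINT t:{-1..0}|lborel. cnj a * (e t * f t))"
    using integral_Re[OF aef[unfolded set_integrable_def]]
    by (simp only: set_lebesgue_integral_def scaleR_complex.sel real_scaleR_def)
  also have "(LINT t:{-1..0}|lborel. cnj a * (e t * f t)) = cnj a * a"
    by (simp add: a_def)
  also have "Re (cnj a * a) = (cmod a)^2"
    by (metis Re_complex_of_real complex_norm_square mult.commute)
  finally have re: "(LINT t:{-1..0}|lborel. Re (cnj a * (e t * f t))) = (cmod a)^2" .
  define r where "r = (\<lambda>t. Re (cnj a * (e t * f t)))"
  have r1: "set_integrable lborel {-1..0} (\<lambda>t. 2 * r t)"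
    and r2: "(LINT t:{-1..0}|lborel. r t) = (cmod a)^2"
    using re_i re by (auto simp: r_def simp del: times_complex.sel)
  have c1: "set_integrable lborel {-1..0} (\<lambda>t::real. (cmod a)^2)"
    by (simp add: set_integrable_def)
  have "L2sq (\<lambda>t. f t - a * cnj (e t)) = (LINT t:{-1..0}|lborel. (cmod (f t))^2 - 2 * r t + (cmod a)^2)"
    unfolding L2sq_def pt r_def ..
  also have "\<dots> = L2sq f - 2 * (cmod a)^2 + (cmod a)^2"
    unfolding set_integral_add(2)[OF set_integral_diff(1)[OF L2_D(2)[OF f] r1] c1]
      set_integral_diff(2)[OF L2_D(2)[OF f] r1] set_integral_mult_right r2
    by (simp add: L2sq_def set_lebesgue_integral_def)
  finally show ?thesis unfolding a_def by simp
qed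

text \<open>The exponentials are orthonormal for every shift \<theta>. Subtracting one component
  leaves the other coefficients unchanged and lowers the norm by the square removed. The free shift
  is what later permits integration over a period.\<close>

lemma Bessel:
  assumes "finite (A :: nat set)" "L2 f"
  shows "(\<Sum>k\<in>A. (cmod (etrans f (complex_of_real (\<theta> + 2 * pi * real k))))^2) \<le> L2sq f"
  using assms
proof (induction A arbitrary: f rule: finite_induct)
  case empty
  then show ?case by (simp add: L2sq_nonneg)
next
  case (insert m A)
  define w where "w k = complex_of_real (\<theta> + 2 * pi * real k)" for k :: nat
  define e where "e k t = exp (\<i> * complex_of_real t * w k)" for k t
  define g where "g = (\<lambda>t. f t - etrans f (w m) * cnj (e m t))"
  have e1: "cmod (e k t) = 1" for k t
    by (simp add: e_def w_def)
  have ce: "continuous_on {-1..0} (e k)" for k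
    unfolding e_def by (intro continuous_intros)
  have ceL: "L2 (\<lambda>t. etrans f (w m) * cnj (e m t))"
    by (intro L2_continuous continuous_intros ce)
  have gL: "L2 g"
    unfolding g_def by (intro L2_diff insert.prems ceL)
  have orth: "(LINT t:{-1..0}|lborel. e k t * cnj (e m t)) = 0" if "k \<noteq> m" for k
  proof -
    define c where "c = 2 * \<i> * complex_of_real pi * of_int (int k - int m)"
    have "c \<noteq> 0" using that by (auto simp: c_def)
    have "(\<lambda>t. e k t * cnj (e m t)) = (\<lambda>t. exp (c * complex_of_real t))"
      by (rule ext) (simp add: e_def w_def c_def exp_cnj flip: exp_add, simp add: algebra_simps)
    moreover have "exp (- c) = 1"
      unfolding c_def exp_eq_1 by (auto intro!: exI[of _ "int m - int k"] simp: algebra_simps)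
    ultimately show ?thesis using LINT_exp[OF \<open>c \<noteq> 0\<close>] by simp
  qed
  have same: "etrans g (w k) = etrans f (w k)" if "k \<in> A" for k
  proof -
    have km: "k \<noteq> m" using that insert.hyps by auto
    have "etrans g (w k) = (LINT t:{-1..0}|lborel. e k t * f t - etrans f (w m) * (e k t * cnj (e m t)))"
      unfolding etrans_def g_def e_def[symmetric]
      by (rule arg_cong[where f = "set_lebesgue_integral lborel {-1..0}"]) (auto simp: algebra_simps)
    also have "\<dots> = (LINT t:{-1..0}|lborel. e k t * f t) - etrans f (w m) * (LINT t:{-1..0}|lborel. e k t * cnj (e m t))"
    proof (subst set_integral_diff(2))
      show "set_integrable lborel {-1..0} (\<lambda>t. e k t * f t)"
        by (intro L2_integrable L2_mult_continuous insert.prems ce)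
      show "set_integrable lborel {-1..0} (\<lambda>t. etrans f (w m) * (e k t * cnj (e m t)))"
        by (intro L2_integrable L2_continuous continuous_intros ce)
    qed simp
    finally show ?thesis using orth[OF km] by (simp add: etrans_def e_def)
  qed
  have "(\<Sum>k\<in>insert m A. (cmod (etrans f (w k)))^2) = (cmod (etrans f (w m)))^2 + (\<Sum>k\<in>A. (cmod (etrans g (w k)))^2)"
    using insert.hyps same by simp
  also have "\<dots> \<le> (cmod (etrans f (w m)))^2 + L2sq g"
    using insert.IH[OF gL] by (simp add: w_def)
  also have "L2sq g = L2sq f - (cmod (etrans f (w m)))^2"
    using L2sq_sub_projection[OF insert.prems ce[of m] e1] by (simp add: g_def etrans_def e_def)
  finally show ?case by (simp add: w_def)
qed

lemma integral_split_translates: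
  fixes g :: "real \<Rightarrow> real"
  assumes g: "continuous_on UNIV g" and p: "0 \<le> p"
  shows "integral {a..a + p * real n} g = (\<Sum>k<n. integral {a..a+p} (\<lambda>t. g (t + p * real k)))"
proof (induction n)
  case (Suc n)
  have int: "g integrable_on {c..d}" for c d
    by (intro integrable_continuous_real continuous_on_subset[OF g]) auto
  have e1: "a + p * real n - p * real n = a" and e2: "a + p * real (Suc n) - p * real n = a + p"
    by (auto simp: algebra_simps)
  have "integral {a..a + p * real (Suc n)} g =
      integral {a..a + p * real n} g + integral {a + p * real n..a + p * real (Suc n)} g"
    using p by (intro Henstock_Kurzweil_Integration.integral_combine[symmetric] int) (auto simp: algebra_simps)
  also have "integral {a + p * real n..a + p * real (Suc n)} g = integral {a..a+p} (\<lambda>t. g (t + p * real n))"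
    using integral_shift_real_ivl[symmetric, of "a + p * real n" "a + p * real (Suc n)" g "p * real n"]
    by (simp only: e1 e2)
  finally show ?case using Suc by simp
qed simp

text \<open>One half of Plancherel: cover [a,b] by 2 N periods of length 2 pi, fold them onto one
  period, and apply Bessel at each point of it. N only provides the cover, so the bound is the same
  for all intervals.\<close>

lemma integral_etrans_squared_le:
  assumes f: "L2 f" and "\<bar>a\<bar> \<le> 2 * pi * real N" "\<bar>b\<bar> \<le> 2 * pi * real N"
  shows "integral {a..b} (\<lambda>t. (cmod (etrans f (complex_of_real t)))^2) \<le> 2 * pi * L2sq f"
proof -
  define g where "g = (\<lambda>t. (cmod (etrans f (complex_of_real t)))^2)"
  have ch: "continuous_on UNIV (etrans f)"
    by (intro holomorphic_on_imp_continuous_on etrans_holomorphic L2_integrable f)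
  have "continuous_on S (\<lambda>t. etrans f (complex_of_real t))" for S
    by (rule continuous_on_compose2[OF ch]) (auto intro!: continuous_intros)
  then have g: "continuous_on S g" for S
    unfolding g_def by (intro continuous_on_power continuous_on_norm)
  have gs: "continuous_on S (\<lambda>t. g (t + c))" for S c
    by (rule continuous_on_compose2[OF g[of UNIV]]) (auto intro!: continuous_intros)
  let ?c = "- (2 * pi * real N)"
  have "integral {a..b} g \<le> integral {?c..?c + 2 * pi * real (2 * N)} g"
    using assms by (intro integral_subset_le integrable_continuous_real g) (auto simp: g_def)
  also have "\<dots> = (\<Sum>k<2*N. integral {?c..?c+2*pi} (\<lambda>t. g (t + 2 * pi * real k)))"
    using g by (intro integral_split_translates) auto
  also have "\<dots> = integral {?c..?c+2*pi} (\<lambda>t. \<Sum>k<2*N. g (t + 2 * pi * real k))"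
    by (intro Henstock_Kurzweil_Integration.integral_sum[symmetric] integrable_continuous_real gs) auto
  also have "\<dots> \<le> integral {?c..?c+2*pi} (\<lambda>t. L2sq f)"
  proof (rule integral_le)
    show "(\<lambda>t. \<Sum>k<2*N. g (t + 2 * pi * real k)) integrable_on {?c..?c+2*pi}"
      by (intro integrable_continuous_real continuous_on_sum gs)
    show "(\<Sum>k<2*N. g (t + 2 * pi * real k)) \<le> L2sq f" for t
      using Bessel[OF finite_lessThan f] by (simp add: g_def)
  qed auto
  also have "\<dots> = 2 * pi * L2sq f" by simp
  finally show ?thesis by (simp add: g_def)
qed

section \<open>Size of the transforms at a point and along horizontal lines\<close>

lemma one_minus_exp_le: "0 < y \<Longrightarrow> (1 - exp (- (2 * y))) / (2 * y) \<le> 2 / (1 + y)" for y :: real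
proof (cases "y \<le> 1")
  case True
  assume y: "0 < y"
  have "1 + (- (2 * y)) \<le> exp (- (2 * y))" by (rule exp_ge_add_one_self)
  then have "(1 - exp (- (2 * y))) / (2 * y) \<le> 1" using y by (simp add: field_simps)
  also have "1 \<le> 2 / (1 + y)" using True y by (simp add: field_simps)
  finally show ?thesis .
next
  case False
  assume y: "0 < y"
  have "(1 - exp (- (2 * y))) / (2 * y) \<le> 1 / (2 * y)"
    using y by (intro divide_right_mono) auto
  also have "\<dots> \<le> 2 / (1 + y)" using y False by (simp add: field_simps)
  finally show ?thesis .
qed

lemma LINT_exp_real_le:
  assumes "0 < (y::real)"
  shows "(LINT t:{-1..0}|lborel. exp (2 * y * t)) \<le> 2 / (1 + y)"
  using one_minus_exp_le[OF assms] LINT_exp_real[of "2 * y"] assms by simp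

lemma LINT_exp_real_le':
  assumes "0 < (y::real)"
  shows "(LINT t:{-1..0}|lborel. exp (- (2 * y * t))) \<le> exp (2 * y) * (2 / (1 + y))"
proof -
  have "(LINT t:{-1..0}|lborel. exp (- (2 * y * t))) = exp (2 * y) * ((1 - exp (- (2 * y))) / (2 * y))"
  proof -
    have "exp (2 * y) * exp (- (2 * y)) = 1" by (simp flip: exp_add)
    then have "exp (2 * y) * (1 - exp (- (2 * y))) = exp (2 * y) - 1"
      by (simp only: right_diff_distrib mult_1_right)
    then show ?thesis
      using LINT_exp_real[of "- (2 * y)"] assms
      by (simp only: times_divide_eq_right) (simp add: minus_divide_left)
  qed
  also have "\<dots> \<le> exp (2 * y) * (2 / (1 + y))"
    by (intro mult_left_mono one_minus_exp_le assms) auto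
  finally show ?thesis .
qed

text \<open>Cauchy-Schwarz against the exponential, whose modulus on [-1,0] reaches exp(Im z) only
  at one end; its L2 norm therefore gains the factor 1/(1 + Im z) in the square. Both this gain and
  the next one are used on the vertical sides.\<close>

lemma cmod_etrans_squared_le:
  assumes f: "L2 f" and "0 < Im z"
  shows "(cmod (etrans f z))^2 \<le> exp (2 * Im z) * (2 / (1 + Im z)) * L2sq f"
proof -
  have "(cmod (etrans f z))^2 \<le> L2sq (\<lambda>t. exp (\<i> * complex_of_real t * z)) * L2sq f"
    unfolding etrans_def by (intro L2_Cauchy_Schwarz f L2_continuous continuous_intros)
  also have "L2sq (\<lambda>t. exp (\<i> * complex_of_real t * z)) = (LINT t:{-1..0}|lborel. exp (- (2 * Im z * t)))"
    unfolding L2sq_def by (simp flip: exp_double add: mult_ac)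
  also have "\<dots> * L2sq f \<le> exp (2 * Im z) * (2 / (1 + Im z)) * L2sq f"
    by (intro mult_right_mono LINT_exp_real_le' assms L2sq_nonneg)
  finally show ?thesis .
qed

text \<open>With the opposite sign the exponential has modulus exp(t Im z), at most 1 on [-1,0]:
  there is no growth, and the gain is the same.\<close>

lemma cmod_etrans_minus_squared_le:
  assumes f: "L2 f" and "0 < Im z"
  shows "(cmod (etrans f (- z)))^2 \<le> 2 / (1 + Im z) * L2sq f"
proof -
  have "(cmod (etrans f (- z)))^2 \<le> L2sq (\<lambda>t. exp (\<i> * complex_of_real t * (- z))) * L2sq f"
    unfolding etrans_def by (intro L2_Cauchy_Schwarz f L2_continuous continuous_intros)
  also have "L2sq (\<lambda>t. exp (\<i> * complex_of_real t * (- z))) = (LINT t:{-1..0}|lborel. exp (2 * Im z * t))"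
    unfolding L2sq_def by (simp flip: exp_double add: mult_ac)
  also have "\<dots> * L2sq f \<le> 2 / (1 + Im z) * L2sq f"
    by (intro mult_right_mono LINT_exp_real_le assms L2sq_nonneg)
  finally show ?thesis .
qed

text \<open>Moving to height y is a weight on f, so estimates on horizontal lines reduce to the real
  axis.\<close>

lemma etrans_shift: "etrans f (x + \<i> * complex_of_real y) = etrans (\<lambda>t. exp (- (complex_of_real t * y)) * f t) x"
proof -
  have "exp (\<i> * complex_of_real t * (x + \<i> * complex_of_real y)) =
      exp (\<i> * complex_of_real t * x) * exp (- (complex_of_real t * y))" for t
    by (simp add: algebra_simps flip: exp_add)
  then show ?thesis by (simp add: etrans_def mult.assoc)
qed

lemma integral_etrans_line_le:
  assumes f: "L2 f" and "\<bar>a\<bar> \<le> 2 * pi * real N" "\<bar>b\<bar> \<le> 2 * pi * real N" "0 \<le> y"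
  shows "integral {a..b} (\<lambda>t. (cmod (etrans f (Complex t y)))^2) \<le> 2 * pi * (exp (2 * y) * L2sq f)"
proof -
  let ?h = "\<lambda>t. exp (- (complex_of_real t * y))"
  have c: "continuous_on {-1..0} ?h" by (intro continuous_intros)
  have b: "cmod (?h t) \<le> exp y" if "t \<in> {-1..0}" for t
    using abs_mult_le_of_unit_interval[OF that, of y] that assms by auto
  have "integral {a..b} (\<lambda>t. (cmod (etrans f (Complex t y)))^2) =
     integral {a..b} (\<lambda>t. (cmod (etrans (\<lambda>t. ?h t * f t) (complex_of_real t)))^2)"
    by (simp add: Complex_eq etrans_shift)
  also have "\<dots> \<le> 2 * pi * L2sq (\<lambda>t. ?h t * f t)"
    by (intro integral_etrans_squared_le[OF _ assms(2,3)] L2_mult_continuous f c)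
  also have "\<dots> \<le> 2 * pi * ((exp y)^2 * L2sq f)"
    by (intro mult_left_mono L2sq_mono_mult f c b) auto
  finally show ?thesis by (simp add: exp_double)
qed

lemma integral_etrans_minus_line_le:
  assumes f: "L2 f" and "\<bar>a\<bar> \<le> 2 * pi * real N" "\<bar>b\<bar> \<le> 2 * pi * real N" "0 \<le> y"
  shows "integral {a..b} (\<lambda>t. (cmod (etrans f (- Complex t y)))^2) \<le> 2 * pi * L2sq f"
proof -
  let ?h = "\<lambda>t. exp (complex_of_real t * y)"
  have c: "continuous_on {-1..0} ?h" by (intro continuous_intros)
  have b: "cmod (?h t) \<le> 1" if "t \<in> {-1..0}" for t
    using that assms by (auto simp: mult_nonpos_nonneg)
  have "(cmod (etrans f (- Complex t y)))^2 = (cmod (etrans (\<lambda>t. ?h t * f t) (complex_of_real (- t))))^2" for t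
    using etrans_shift[of f "- complex_of_real t" "- y"] by (simp add: Complex_eq)
  then have "integral {a..b} (\<lambda>t. (cmod (etrans f (- Complex t y)))^2) =
     integral {a..b} (\<lambda>t. (cmod (etrans (\<lambda>t. ?h t * f t) (complex_of_real (- t))))^2)"
    by simp
  also have "\<dots> = integral {- b..- a} (\<lambda>t. (cmod (etrans (\<lambda>t. ?h t * f t) (complex_of_real t)))^2)"
    using Henstock_Kurzweil_Integration.integral_reflect_real[of "-a" "-b" "\<lambda>t. (cmod (etrans (\<lambda>t. ?h t * f t) (complex_of_real t)))^2"] by simp
  also have "\<dots> \<le> 2 * pi * L2sq (\<lambda>t. ?h t * f t)"
    using assms by (intro integral_etrans_squared_le[where N=N] L2_mult_continuous f c) auto
  also have "\<dots> \<le> 2 * pi * (1^2 * L2sq f)"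
    by (intro mult_left_mono L2sq_mono_mult f c b) auto
  finally show ?thesis by simp
qed

section \<open>Zeros and lower bounds of the characteristic function\<close>

lemma Dfun_etrans: "Dfun \<phi> z = - \<i> * z + exp (- \<i> * z) + etrans \<phi> z"
  by (simp add: Dfun_def etrans_def)

lemma ii_mult_eq: "\<i> * z = exp (- \<i> * z) + etrans \<phi> z - Dfun \<phi> z"
  unfolding Dfun_etrans by (simp only: mult_minus_left) simp

lemma Dfun_zeroD: "Dfun \<phi> z = 0 \<Longrightarrow> \<i> * z = exp (- \<i> * z) + etrans \<phi> z"
  using ii_mult_eq[of z \<phi>] by (simp only: diff_0_right)

lemma Dfun_holomorphic: "L2 \<phi> \<Longrightarrow> Dfun \<phi> holomorphic_on A"
  unfolding Dfun_etrans[abs_def] by (intro holomorphic_intros etrans_holomorphic L2_integrable)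

lemma Dfun_continuous: "L2 \<phi> \<Longrightarrow> continuous_on A (Dfun \<phi>)"
  by (intro holomorphic_on_imp_continuous_on Dfun_holomorphic)

lemma cmod_exp_neg_ii: "cmod (exp (- \<i> * z)) = exp (Im z)"
  by simp

lemma cmod_etrans_le:
  assumes "L2 f" "0 < Im z"
  shows "cmod (etrans f z) \<le> exp (Im z) * sqrt (2 * L2sq f)"
proof (rule power2_le_imp_le)
  have "(cmod (etrans f z))^2 \<le> exp (2 * Im z) * (2 / (1 + Im z)) * L2sq f"
    by (rule cmod_etrans_squared_le[OF assms])
  also have "\<dots> \<le> exp (2 * Im z) * 2 * L2sq f"
    using assms by (intro mult_right_mono mult_left_mono L2sq_nonneg) (auto simp: field_simps)
  also have "\<dots> = (exp (Im z) * sqrt (2 * L2sq f))\<^sup>2"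
    by (simp add: power_mult_distrib L2sq_nonneg exp_double)
  finally show "(cmod (etrans f z))\<^sup>2 \<le> (exp (Im z) * sqrt (2 * L2sq f))\<^sup>2" .
qed (auto simp: L2sq_nonneg)

text \<open>The constants ensure that above this height the transform of \<open>f\<close>, divided by \<open>exp (- \<i> z)\<close>, is
  bounded and Lipschitz with constant \<open>1/112\<close>.\<close>
definition height :: "(real \<Rightarrow> complex) \<Rightarrow> real" where
  "height f = 200 + 30000 * L2sq f"

lemma height_ge: "200 \<le> height f"
  by (simp add: height_def L2sq_nonneg)

text \<open>It suffices that 1 + y is at least 2 * 112^2 = 25088 times \<open>L2sq f\<close>; the
  30000 in \<open>height\<close> leaves room.\<close>

lemma L2sq_div_height:
  assumes "height f \<le> y"
  shows "2 / (1 + y) * L2sq f \<le> (1/112)^2"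
proof -
  have "y \<ge> 200 + 30000 * L2sq f" "L2sq f \<ge> 0"
    using assms by (auto simp: height_def L2sq_nonneg)
  then show ?thesis by (simp add: field_simps)
qed

lemma cmod_etrans_le_small:
  assumes "L2 f" "height f \<le> Im z"
  shows "cmod (etrans f z) \<le> exp (Im z) / 112"
proof (rule power2_le_imp_le)
  have "0 < Im z" using assms height_ge[of f] by linarith
  then have "(cmod (etrans f z))^2 \<le> exp (2 * Im z) * (2 / (1 + Im z)) * L2sq f"
    by (intro cmod_etrans_squared_le assms)
  also have "\<dots> = exp (2 * Im z) * (2 / (1 + Im z) * L2sq f)"
    by (simp only: mult.assoc)
  also have "\<dots> \<le> exp (2 * Im z) * (1/112)^2"
    by (intro mult_left_mono L2sq_div_height assms) auto
  also have "\<dots> = (exp (Im z) / 112)^2"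
    by (simp add: power_divide exp_double)
  finally show "(cmod (etrans f z))^2 \<le> (exp (Im z) / 112)^2" .
qed auto

text \<open>Squaring exp(y/2) >= (y/2)^2/2 gives exp y >= y^4/64. The quadratic bound is what keeps
  Im z below the square root of |Re z| at a zero.\<close>

lemma exp_ge_quadratic: "200 \<le> y \<Longrightarrow> 15 * y \<le> exp y \<and> 4 * y^2 \<le> exp (y::real)"
proof
  assume y: "200 \<le> y"
  have "(y/2)^2/2 \<le> exp (y/2)"
    using exp_lower_Taylor_quadratic[of "y/2"] y by linarith
  then have "((y/2)^2/2)^2 \<le> (exp (y/2))^2"
    by (intro power_mono) auto
  also have "(exp (y/2))^2 = exp y"
    by (simp flip: exp_double)
  finally have e: "y^2 * y^2 / 64 \<le> exp y" by (simp add: power2_eq_square)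
  have "200 * 200 \<le> y^2" unfolding power2_eq_square using y by (intro mult_mono) auto
  then have "40000 * y^2 \<le> y^2 * y^2" by (intro mult_right_mono) auto
  with e zero_le_power2[of y] show 2: "4 * y^2 \<le> exp y" by linarith
  have "200 * y \<le> y^2" unfolding power2_eq_square using y by (intro mult_right_mono) auto
  with 2 y show "15 * y \<le> exp y" by simp
qed

text \<open>Below height h the exponential and the transform are bounded, so at a zero the linear
  term is bounded as well: zeros of large modulus lie high.\<close>

lemma Dfun_zero_low:
  assumes "L2 \<phi>" "Dfun \<phi> z = 0" "0 < Im z" "Im z \<le> h"
  shows "cmod z \<le> exp h * (1 + sqrt (2 * L2sq \<phi>))"
proof -
  have "\<i> * z = exp (- \<i> * z) + etrans \<phi> z"
    by (rule Dfun_zeroD[OF assms(2)])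
  then have "cmod (\<i> * z) = cmod (exp (- \<i> * z) + etrans \<phi> z)"
    by (rule arg_cong)
  then have "cmod z = cmod (exp (- \<i> * z) + etrans \<phi> z)"
    by (simp only: norm_mult norm_ii mult_1)
  also have "\<dots> \<le> exp (Im z) + exp (Im z) * sqrt (2 * L2sq \<phi>)"
    using norm_triangle_ineq[of "exp (- \<i> * z)" "etrans \<phi> z"] cmod_etrans_le[OF assms(1,3)] by simp
  also have "\<dots> = exp (Im z) * (1 + sqrt (2 * L2sq \<phi>))"
    by (simp add: algebra_simps)
  also have "\<dots> \<le> exp h * (1 + sqrt (2 * L2sq \<phi>))"
    using assms L2sq_nonneg[of \<phi>] by (intro mult_right_mono) (auto intro: add_nonneg_nonneg)
  finally show ?thesis .
qed

text \<open>The transform is negligible here, so a high zero nearly solves i z = exp(-i z).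
  Comparing moduli puts it on a logarithmic curve, and comparing arguments confines |Re z| to the
  half-periods where the sine is negative.\<close>

lemma Dfun_zero_high:
  assumes "L2 \<phi>" "Dfun \<phi> z = 0" "height \<phi> \<le> Im z"
  shows "exp (Im z) \<le> 2 * cmod z" "Im z \<le> \<bar>Re z\<bar>" "(Im z)^2 \<le> \<bar>Re z\<bar>" "sin \<bar>Re z\<bar> < 0"
proof -
  have y: "200 \<le> Im z" using assms height_ge[of \<phi>] by linarith
  have eq: "\<i> * z = exp (- \<i> * z) + etrans \<phi> z"
    by (rule Dfun_zeroD[OF assms(2)])
  have h: "cmod (etrans \<phi> z) \<le> exp (Im z) / 112" by (rule cmod_etrans_le_small[OF assms(1,3)])
  have "cmod (exp (- \<i> * z)) \<le> cmod (\<i> * z) + cmod (etrans \<phi> z)"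
    using norm_triangle_ineq4[of "\<i> * z" "etrans \<phi> z"] unfolding eq add_diff_cancel_right' .
  then have 1: "exp (Im z) \<le> cmod z + cmod (etrans \<phi> z)"
    by (simp only: norm_mult cmod_exp_neg_ii norm_ii mult_1)
  then show e: "exp (Im z) \<le> 2 * cmod z" using h exp_ge_zero[of "Im z"] by linarith
  have cz: "cmod z \<le> \<bar>Re z\<bar> + Im z" using cmod_le[of z] y by simp
  show 2: "Im z \<le> \<bar>Re z\<bar>"
    using e cz exp_ge_quadratic[OF y] y by linarith
  have "4 * (Im z)^2 \<le> exp (Im z)" using exp_ge_quadratic[OF y] by simp
  then show "(Im z)^2 \<le> \<bar>Re z\<bar>" using e cz 2 by linarith
  \<comment> \<open>Multiplying the zero equation by -i turns i z into z. The transform is smaller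
    than |x|, so the real parts determine the sign of sin x.\<close>
  define x where "x = Re z"
  have Reeq: "Re (- \<i> * exp (- \<i> * z)) = - exp (Im z) * sin x"
    by (simp add: exp_eq_polar Re_exp Im_exp x_def)
  have "- \<i> * exp (- \<i> * z) = - \<i> * (\<i> * z - etrans \<phi> z)"
    unfolding eq add_diff_cancel_right' ..
  then have "- \<i> * exp (- \<i> * z) = z + \<i> * etrans \<phi> z"
    by (simp only: right_diff_distrib mult.assoc[symmetric]) simp
  then have Re2: "- exp (Im z) * sin x = x + Re (\<i> * etrans \<phi> z)"
    using Reeq by (simp add: x_def)
  have hb: "\<bar>Re (\<i> * etrans \<phi> z)\<bar> \<le> cmod (etrans \<phi> z)"
    using abs_Re_le_cmod[of "\<i> * etrans \<phi> z"] by (simp add: norm_mult)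
  have "cmod (etrans \<phi> z) < \<bar>x\<bar>"
    using h e cz 2 y by (simp add: x_def)
  then have b: "\<bar>Re (\<i> * etrans \<phi> z)\<bar> < \<bar>x\<bar>" using hb by linarith
  show "sin \<bar>Re z\<bar> < 0"
  proof (cases "0 \<le> x")
    case True
    then have "0 < - exp (Im z) * sin x" using b Re2 by linarith
    then show ?thesis using True by (simp add: x_def zero_less_mult_iff mult_less_0_iff)
  next
    case False
    then have "- exp (Im z) * sin x < 0" using b Re2 by linarith
    then have "0 < sin x" by (simp add: zero_less_mult_iff)
    then show ?thesis using False by (simp add: x_def)
  qed
qed

section \<open>High zeros with nearby real parts coincide\<close>

lemma cmod_exp_diff_le:
  fixes u v :: complex
  assumes "Re u \<le> m" "Re v \<le> m"
  shows "cmod (exp u - exp v) \<le> exp m * cmod (u - v)"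
proof (rule field_differentiable_bound[where S = "{w. Re w \<le> m}" and f' = exp])
  show "convex {w. Re w \<le> m}" by (rule convex_halfspace_Re_le)
  show "(exp has_field_derivative exp z) (at z within {w. Re w \<le> m})" for z
    by (rule DERIV_subset[OF DERIV_exp]) simp
qed (use assms in simp_all)

text \<open>The factor exp(i z) changes the exponent t to 1 + t, which lies in [0,1]. The new
  exponentials decay in the upper half-plane, with Lipschitz constant at most exp(-(1 + t) m) above
  height m, and the L2 norm of this in t is small for large m.\<close>

lemma exp_etrans_lipschitz:
  assumes f: "L2 f" and m: "height f \<le> Im z" "height f \<le> Im w"
  shows "cmod (exp (\<i> * z) * etrans f z - exp (\<i> * w) * etrans f w) \<le> cmod (z - w) / 112"
proof (rule power2_le_imp_le)
  define m where "m = height f"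
  have mp: "0 < m" using height_ge[of f] by (simp add: m_def)
  define k where "k = (\<lambda>t. exp (\<i> * complex_of_real (1 + t) * z) - exp (\<i> * complex_of_real (1 + t) * w))"
  have kc: "continuous_on {-1..0} k" unfolding k_def by (intro continuous_intros)
  have i: "set_integrable lborel {-1..0} (\<lambda>t. exp (\<i> * z) * (exp (\<i> * complex_of_real t * z) * f t))" for z
    by (intro set_integrable_mult_right etrans_integrable L2_integrable f)
  have "exp (\<i> * z) * etrans f z - exp (\<i> * w) * etrans f w =
     (LINT t:{-1..0}|lborel. exp (\<i> * z) * (exp (\<i> * complex_of_real t * z) * f t)
         - exp (\<i> * w) * (exp (\<i> * complex_of_real t * w) * f t))"
    unfolding etrans_def set_integral_diff(2)[OF i i] by simp
  also have "\<dots> = (LINT t:{-1..0}|lborel. k t * f t)"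
    by (rule arg_cong[where f = "set_lebesgue_integral lborel {-1..0}"])
       (auto simp: k_def algebra_simps exp_add)
  finally have "(cmod (exp (\<i> * z) * etrans f z - exp (\<i> * w) * etrans f w))^2 \<le> L2sq k * L2sq f"
    using L2_Cauchy_Schwarz[OF L2_continuous[OF kc] f] by simp
  also have "L2sq k \<le> 2 / (1 + m) * (cmod (z - w))^2"
  proof -
    have kb: "(cmod (k t))^2 \<le> (cmod (z - w))^2 * (exp (- (2 * m)) * exp (- (2 * m * t)))" if t: "t \<in> {-1..0}" for t
    proof -
      have "(1 + t) * m \<le> (1 + t) * Im z" "(1 + t) * m \<le> (1 + t) * Im w"
        using t assms by (auto intro!: mult_left_mono simp: m_def)
      then have "cmod (k t) \<le> exp (- ((1 + t) * m)) * cmod (\<i> * complex_of_real (1 + t) * z - \<i> * complex_of_real (1 + t) * w)"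
        unfolding k_def by (intro cmod_exp_diff_le) auto
      also have "\<i> * complex_of_real (1 + t) * z - \<i> * complex_of_real (1 + t) * w = \<i> * complex_of_real (1 + t) * (z - w)"
        by (simp add: algebra_simps)
      also have "cmod \<dots> = (1 + t) * cmod (z - w)"
        using t unfolding norm_mult norm_of_real norm_ii by simp
      also have "\<dots> \<le> cmod (z - w)"
        using t by (intro mult_left_le_one_le) auto
      finally have "cmod (k t) \<le> exp (- ((1 + t) * m)) * cmod (z - w)" by simp
      then have "(cmod (k t))^2 \<le> (exp (- ((1 + t) * m)) * cmod (z - w))^2"
        by (intro power_mono) auto
      also have "\<dots> = (cmod (z - w))^2 * (exp (- (2 * m)) * exp (- (2 * m * t)))"
      proof -
        have "(exp (- ((1 + t) * m)))^2 = exp (- (2 * m)) * exp (- (2 * m * t))"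
          by (simp add: algebra_simps flip: exp_add exp_double)
        then show ?thesis by (simp add: power_mult_distrib mult.commute)
      qed
      finally show ?thesis .
    qed
    have "L2sq k \<le> (LINT t:{-1..0}|lborel. (cmod (z - w))^2 * (exp (- (2 * m)) * exp (- (2 * m * t))))"
      unfolding L2sq_def
      by (intro set_integral_mono kb L2_D(2)[OF L2_continuous[OF kc]] borel_integrable_atLeastAtMost' continuous_intros)
    also have "\<dots> = (cmod (z - w))^2 * (exp (- (2 * m)) * (LINT t:{-1..0}|lborel. exp (- (2 * m * t))))"
      by simp
    also have "\<dots> \<le> (cmod (z - w))^2 * (exp (- (2 * m)) * (exp (2 * m) * (2 / (1 + m))))"
      by (intro mult_left_mono LINT_exp_real_le' mp) auto
    also have "\<dots> = 2 / (1 + m) * (cmod (z - w))^2"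
    proof -
      have "exp (- (2 * m)) * exp (2 * m) = 1" by (simp flip: exp_add)
      then show ?thesis by (simp add: mult.assoc[symmetric])
    qed
    finally show ?thesis .
  qed
  also have "2 / (1 + m) * (cmod (z - w))^2 * L2sq f = (2 / (1 + m) * L2sq f) * (cmod (z - w))^2"
    by (simp add: mult_ac)
  also have "\<dots> \<le> (1 / 112)^2 * (cmod (z - w))^2"
    by (intro mult_right_mono L2sq_div_height) (auto simp: m_def)
  finally show "(cmod (exp (\<i> * z) * etrans f z - exp (\<i> * w) * etrans f w))^2 \<le> (cmod (z - w) / 112)^2"
    using L2sq_nonneg[of f] by (simp add: mult_right_mono power_divide)
qed auto

text \<open>Two zeros in the same cell have quotient of \<open>exp (- \<i> z)\<close> close to 1, to first order in their
  distance; since the logarithm is Lipschitz near 1 they coincide.\<close>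
lemma Dfun_zero_unique:
  assumes f: "L2 \<phi>" and z: "Dfun \<phi> z = 0" "height \<phi> \<le> Im z"
    and w: "Dfun \<phi> w = 0" "height \<phi> \<le> Im w" and d: "\<bar>Re z - Re w\<bar> < pi"
  shows "z = w"
proof -
  have main: "z = w" if z: "Dfun \<phi> z = 0" "height \<phi> \<le> Im z"
    and w: "Dfun \<phi> w = 0" "height \<phi> \<le> Im w" and d: "\<bar>Re z - Re w\<bar> < pi" and le: "Im w \<le> Im z" for z w
  proof -
    define \<psi> where "\<psi> = (\<lambda>z. exp (\<i> * z) * etrans \<phi> z)"
    have ez: "exp (- \<i> * z) * (1 + \<psi> z) = \<i> * z" if "Dfun \<phi> z = 0" for z
    proof -
      have "exp (- \<i> * z) * exp (\<i> * z) = 1" by (simp flip: exp_add)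
      then have "exp (- \<i> * z) * (1 + \<psi> z) = exp (- \<i> * z) + etrans \<phi> z"
        by (simp add: \<psi>_def distrib_left mult.assoc[symmetric])
      then show ?thesis by (simp only: Dfun_zeroD[OF that])
    qed
    have small: "cmod (\<psi> z) \<le> 1/2" if "height \<phi> \<le> Im z" for z
    proof -
      have "cmod (\<psi> z) \<le> exp (- Im z) * (exp (Im z) / 112)"
        unfolding \<psi>_def norm_mult using cmod_etrans_le_small[OF f that] by (simp add: mult_left_mono)
      also have "\<dots> = 1 / 112" by (simp flip: exp_add)
      finally show ?thesis by simp
    qed
    have inv: "1/2 \<le> cmod (1 + \<psi> z)" if "height \<phi> \<le> Im z" for z
      using small[OF that] norm_triangle_ineq2[of 1 "- \<psi> z"] by simp
    \<comment> \<open>The deviation from 1 of exp(-i z)/exp(-i w). The zero equations make this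
      quotient equal to z (1 + psi w)/(w (1 + psi z)), in which numerator and denominator differ to
      first order in z - w.\<close>
    define q where "q = exp (- \<i> * (z - w)) - 1"
    have w200: "200 \<le> cmod w" using w height_ge[of \<phi>] abs_Im_le_cmod[of w] by linarith
    have "exp (- \<i> * (z - w)) * (w * (1 + \<psi> z)) = z * (1 + \<psi> w)"
    proof -
      have "exp (- \<i> * (z - w)) * exp (- \<i> * w) = exp (- \<i> * z)"
        by (simp add: algebra_simps flip: exp_add)
      then have "exp (- \<i> * (z - w)) * (exp (- \<i> * w) * (1 + \<psi> w)) * (1 + \<psi> z) = exp (- \<i> * z) * (1 + \<psi> z) * (1 + \<psi> w)"
        by (simp add: mult_ac)
      then show ?thesis unfolding ez[OF z(1)] ez[OF w(1)] by simp
    qed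
    then have "q * (w * (1 + \<psi> z)) = (z - w) * (1 + \<psi> w) + w * (\<psi> w - \<psi> z)"
      unfolding q_def by (simp add: left_diff_distrib) (simp add: algebra_simps)
    then have "cmod q * (cmod w * cmod (1 + \<psi> z)) = cmod ((z - w) * (1 + \<psi> w) + w * (\<psi> w - \<psi> z))"
      by (metis norm_mult)
    also have "\<dots> \<le> cmod (z - w) * (3/2) + cmod w * (cmod (z - w) / 112)"
    proof (rule norm_triangle_le, rule add_mono)
      have "cmod (1 + \<psi> w) \<le> 3/2" using small[OF w(2)] norm_triangle_ineq[of 1 "\<psi> w"] by simp
      then show "cmod ((z - w) * (1 + \<psi> w)) \<le> cmod (z - w) * (3/2)"
        unfolding norm_mult by (intro mult_left_mono) auto
      show "cmod (w * (\<psi> w - \<psi> z)) \<le> cmod w * (cmod (z - w) / 112)"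
        unfolding norm_mult \<psi>_def
        using exp_etrans_lipschitz[OF f w(2) z(2)] by (intro mult_left_mono) (auto simp: norm_minus_commute)
    qed
    also have "\<dots> \<le> cmod w * (cmod (z - w) * (3/400 + 1/112))"
      using mult_right_mono[OF w200, of "cmod (z - w) * (3/400)"] by (simp add: algebra_simps)
    finally have "cmod q * (cmod w * cmod (1 + \<psi> z)) \<le> cmod w * (cmod (z - w) * (3/400 + 1/112))" .
    moreover have "cmod w * (cmod q * (1/2)) \<le> cmod q * (cmod w * cmod (1 + \<psi> z))"
      using mult_left_mono[OF inv[OF z(2)], of "cmod w * cmod q"] by (simp add: mult_ac)
    ultimately have "cmod w * (cmod q * (1/2)) \<le> cmod w * (cmod (z - w) * (3/400 + 1/112))" by linarith
    then have "cmod q * (1/2) \<le> cmod (z - w) * (3/400 + 1/112)"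
      using w200 by (subst (asm) mult_le_cancel_left_pos) auto
    \<comment> \<open>Indeed 2 (3/400 + 1/112) = 23/700, and 1/28 = 25/700.\<close>
    then have "700 * cmod q \<le> cmod (z - w) * 23" by simp
    then have q: "cmod q \<le> cmod (z - w) / 28" using norm_ge_zero[of "z - w"] by linarith
    \<comment> \<open>Only the real parts are assumed close. The difference of the imaginary parts
      is controlled by exp t = |1 + q|, which forces t to be small too.\<close>
    define t where "t = Im z - Im w"
    have "0 \<le> t" using le by (simp add: t_def)
    have zw: "cmod (z - w) \<le> pi + t"
      using cmod_le[of "z - w"] d \<open>0 \<le> t\<close> by (simp add: t_def)
    have "1 + t \<le> exp t" by (rule exp_ge_add_one_self)
    also have "exp t = cmod (1 + q)" by (simp add: q_def t_def)
    also have "\<dots> \<le> 1 + cmod q" by (metis norm_one norm_triangle_ineq)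
    finally have "t \<le> (pi + t) / 28" using q zw by simp
    then have "cmod (z - w) < 8" using zw pi_less_4 by simp
    \<comment> \<open>This makes the logarithm estimate at 1 + q available; the bound pi on the real
      parts makes -i (z - w) the principal logarithm of 1 + q.\<close>
    then have q2: "cmod q < 1/2" using q by simp
    have "- \<i> * (z - w) = Ln (exp (- \<i> * (z - w)))"
      using d by (intro Ln_exp[symmetric]) auto
    also have "\<dots> = Ln (1 + q)" by (simp add: q_def)
    finally have "cmod (- \<i> * (z - w)) \<le> 2 * cmod q"
      using norm_Ln_le[OF q2] by simp
    then have "cmod (z - w) \<le> 2 * cmod q" by (simp add: norm_mult)
    then have "cmod (z - w) \<le> 0" using q by linarith
    then show ?thesis by simp
  qed
  show ?thesis
    using main[OF z w d] main[OF w z] d by (cases "Im w \<le> Im z") (auto simp: abs_minus_commute)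
qed

text \<open>For \<open>Re z = \<plusminus> cell k\<close> the number \<open>exp (- \<i> z)\<close> is a positive multiple of \<open>\<mp> \<i>\<close>, so it does not
  cancel against \<open>- \<i> z\<close>.\<close>
definition cell :: "nat \<Rightarrow> real" where
  "cell k = pi / 2 + 2 * real k * pi"

lemma sin_cell_add: "sin (cell k + s) = cos s"
  by (simp add: cell_def sin_add cos_add)

lemma sin_cos_cell: "sin (cell k) = 1" "cos (cell k) = 0"
  by (simp_all add: cell_def sin_add cos_add)

text \<open>After multiplication by i or -i both main terms have positive real part, so their moduli
  add up instead of cancelling. The transform costs at most half: above the height by smallness,
  below it because \<open>cell k\<close> is large.\<close>

lemma cmod_Dfun_ge_side:
  assumes f: "L2 \<phi>" and X: "2 * sqrt (2 * L2sq \<phi>) * exp (height \<phi>) \<le> cell k"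
    and z: "\<bar>Re z\<bar> = cell k" "0 < Im z"
  shows "cmod z + exp (Im z) \<le> 4 * cmod (Dfun \<phi> z)"
proof -
  define X where "X = cell k"
  have Xp: "0 < X" using pi_gt_zero by (simp add: X_def cell_def add_pos_nonneg)
  define y where "y = Im z"
  have "X + exp y - cmod (etrans \<phi> z) \<le> cmod (Dfun \<phi> z)"
  proof (cases "0 \<le> Re z")
    case True
    then have z': "z = Complex X y" using z by (simp add: complex_eq_iff X_def y_def)
    have "exp (- \<i> * z) = - \<i> * exp y"
      by (simp add: z' X_def exp_eq_polar Re_exp Im_exp complex_eq_iff sin_cos_cell)
    then have "X + exp y = Re (\<i> * Dfun \<phi> z) - Re (\<i> * etrans \<phi> z)"
      unfolding Dfun_etrans by (simp add: z')
    then show ?thesis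
      using complex_Re_le_cmod[of "\<i> * Dfun \<phi> z"] abs_Re_le_cmod[of "\<i> * etrans \<phi> z"]
      unfolding norm_mult norm_ii by linarith
  next
    case False
    then have z': "z = Complex (- X) y" using z by (simp add: complex_eq_iff X_def y_def)
    have "exp (- \<i> * z) = \<i> * exp y"
      by (simp add: z' X_def exp_eq_polar Re_exp Im_exp complex_eq_iff sin_cos_cell)
    then have "X + exp y = Re (- \<i> * Dfun \<phi> z) + Re (\<i> * etrans \<phi> z)"
      unfolding Dfun_etrans by (simp add: z')
    then show ?thesis
      using complex_Re_le_cmod[of "- \<i> * Dfun \<phi> z"] abs_Re_le_cmod[of "\<i> * etrans \<phi> z"]
      unfolding norm_mult norm_ii norm_minus_cancel by linarith
  qed
  moreover have "cmod (etrans \<phi> z) \<le> exp y / 2 + X / 2"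
  proof (cases "height \<phi> \<le> y")
    case True
    then show ?thesis using cmod_etrans_le_small[OF f, of z] Xp exp_ge_zero[of y] unfolding y_def by linarith
  next
    case False
    have "cmod (etrans \<phi> z) \<le> exp y * sqrt (2 * L2sq \<phi>)"
      using cmod_etrans_le[OF f z(2)] by (simp add: y_def)
    also have "\<dots> \<le> exp (height \<phi>) * sqrt (2 * L2sq \<phi>)"
      using False L2sq_nonneg[of \<phi>] by (intro mult_right_mono) auto
    also have "\<dots> \<le> X / 2" using assms(2) by (simp add: X_def mult_ac)
    also have "\<dots> \<le> exp y / 2 + X / 2" by simp
    finally show ?thesis .
  qed
  moreover have "cmod z \<le> X + y" using cmod_le[of z] z by (simp add: X_def y_def)
  moreover have "1 + y \<le> exp y" by (rule exp_ge_add_one_self)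
  ultimately show ?thesis using Xp unfolding y_def[symmetric] by linarith
qed

text \<open>On the top side |z| is at most 3 Im z, which the exponential dominates by
  \<open>exp_ge_quadratic\<close>.\<close>

lemma cmod_Dfun_ge_top:
  assumes f: "L2 \<phi>" and z: "height \<phi> \<le> Im z" "cmod z \<le> 3 * Im z"
  shows "cmod z + exp (Im z) \<le> 4 * cmod (Dfun \<phi> z)"
proof -
  have y: "200 \<le> Im z" using z height_ge[of \<phi>] by linarith
  have "exp (- \<i> * z) = Dfun \<phi> z + \<i> * z - etrans \<phi> z" unfolding Dfun_etrans by simp
  then have "cmod (exp (- \<i> * z)) = cmod (Dfun \<phi> z + \<i> * z - etrans \<phi> z)"
    by (rule arg_cong)
  then have "exp (Im z) = cmod (Dfun \<phi> z + \<i> * z - etrans \<phi> z)"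
    by (simp only: cmod_exp_neg_ii)
  also have "\<dots> \<le> cmod (Dfun \<phi> z) + cmod z + cmod (etrans \<phi> z)"
    using norm_triangle_ineq4[of "Dfun \<phi> z + \<i> * z" "etrans \<phi> z"] norm_triangle_ineq[of "Dfun \<phi> z" "\<i> * z"]
    by (simp add: norm_mult)
  finally show ?thesis
    using cmod_etrans_le_small[OF f z(1)] conjunct1[OF exp_ge_quadratic[OF y]] z(2) exp_ge_zero[of "Im z"]
    by linarith
qed

text \<open>Where 0 < Im z <= 1 the linear term confines the zeros to a bounded region, so they form
  a compact set and Im has a positive minimum on it. Half of that minimum is a line free of
  zeros.\<close>

lemma cmod_Dfun_ge_bottom:
  assumes f: "L2 \<phi>" and zeros: "\<And>z. Dfun \<phi> z = 0 \<Longrightarrow> 0 < Im z"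
  obtains \<epsilon> c where "0 < \<epsilon>" "\<epsilon> \<le> 1" "0 < c" "\<And>z. Dfun \<phi> z = 0 \<Longrightarrow> \<epsilon> < Im z"
    "\<And>z. Im z = \<epsilon> \<Longrightarrow> c * (1 + cmod z) \<le> cmod (Dfun \<phi> z)"
proof -
  define M where "M = exp 1 * (1 + sqrt (2 * L2sq \<phi>))"
  have M0: "0 \<le> M" using L2sq_nonneg[of \<phi>] by (simp add: M_def)
  define K where "K = cbox (Complex (- (2 * M + 1)) 0) (Complex (2 * M + 1) 1)"
  have K: "z \<in> K \<longleftrightarrow> \<bar>Re z\<bar> \<le> 2 * M + 1 \<and> 0 \<le> Im z \<and> Im z \<le> 1" for z
    by (auto simp: K_def in_cbox_complex_iff)
  have far: "cmod z - M \<le> cmod (Dfun \<phi> z)" if "0 < Im z" "Im z \<le> 1" for z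
  proof -
    have "cmod (\<i> * z) = cmod (exp (- \<i> * z) + etrans \<phi> z - Dfun \<phi> z)"
      by (rule arg_cong[OF ii_mult_eq])
    then have "cmod z = cmod (exp (- \<i> * z) + etrans \<phi> z - Dfun \<phi> z)"
      by (simp only: norm_mult norm_ii mult_1)
    also have "\<dots> \<le> exp (Im z) + cmod (etrans \<phi> z) + cmod (Dfun \<phi> z)"
      using norm_triangle_ineq4[of "exp (- \<i> * z) + etrans \<phi> z" "Dfun \<phi> z"]
        norm_triangle_ineq[of "exp (- \<i> * z)" "etrans \<phi> z"] by simp
    also have "exp (Im z) + cmod (etrans \<phi> z) \<le> exp (Im z) * (1 + sqrt (2 * L2sq \<phi>))"
      using cmod_etrans_le[OF f that(1)] by (simp add: algebra_simps)
    also have "\<dots> \<le> M"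
      unfolding M_def using that L2sq_nonneg[of \<phi>] by (intro mult_right_mono) (auto intro: add_nonneg_nonneg)
    finally show ?thesis by simp
  qed
  define Z where "Z = {z \<in> K. Dfun \<phi> z \<in> {0}}"
  have "compact Z"
  proof -
    have "closed (K \<inter> Dfun \<phi> -` {0})"
      by (rule continuous_closed_preimage[OF Dfun_continuous[OF f]]) (auto simp: K_def)
    then have "compact (K \<inter> (K \<inter> Dfun \<phi> -` {0}))"
      by (intro compact_Int_closed) (auto simp: K_def)
    moreover have "K \<inter> (K \<inter> Dfun \<phi> -` {0}) = Z" by (auto simp: Z_def)
    ultimately show ?thesis by simp
  qed
  have "\<exists>\<epsilon>. 0 < \<epsilon> \<and> \<epsilon> \<le> 1 \<and> (\<forall>z\<in>Z. \<epsilon> < Im z)"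
  proof (cases "Z = {}")
    case False
    have "continuous_on Z Im" by (intro continuous_intros)
    then obtain z0 where z0: "z0 \<in> Z" "\<And>z. z \<in> Z \<Longrightarrow> Im z0 \<le> Im z"
      using continuous_attains_inf[OF \<open>compact Z\<close> False, of Im] by blast
    then have "0 < Im z0" "Im z0 \<le> 1" using zeros K by (auto simp: Z_def)
    then show ?thesis using z0 by (intro exI[of _ "Im z0 / 2"]) force
  qed (auto intro: exI[of _ 1])
  then obtain \<epsilon> where e: "0 < \<epsilon>" "\<epsilon> \<le> 1" "\<And>z. z \<in> Z \<Longrightarrow> \<epsilon> < Im z" by blast
  have 1: "\<epsilon> < Im z" if "Dfun \<phi> z = 0" for z
  proof (rule ccontr)
    assume "\<not> \<epsilon> < Im z"
    then have "Im z \<le> \<epsilon>" "0 < Im z" using zeros[OF that] by auto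
    moreover have "cmod z \<le> M" using far[of z] that e calculation by simp
    then have "z \<in> K" using calculation e abs_Re_le_cmod[of z] M0 K by simp
    then have "z \<in> Z" using that by (simp add: Z_def)
    ultimately show False using e(3)[of z] by simp
  qed
  define S where "S = cbox (Complex (- (2 * M + 1)) \<epsilon>) (Complex (2 * M + 1) \<epsilon>)"
  have S: "z \<in> S \<longleftrightarrow> \<bar>Re z\<bar> \<le> 2 * M + 1 \<and> Im z = \<epsilon>" for z
    by (auto simp: S_def in_cbox_complex_iff)
  have "Complex 0 \<epsilon> \<in> S" using M0 S by simp
  then have "S \<noteq> {}" "compact S" "continuous_on S (\<lambda>z. cmod (Dfun \<phi> z))"
    by (auto simp: S_def intro!: continuous_on_norm Dfun_continuous f)
  then obtain z0 where z0: "z0 \<in> S" "\<And>z. z \<in> S \<Longrightarrow> cmod (Dfun \<phi> z0) \<le> cmod (Dfun \<phi> z)"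
    using continuous_attains_inf[of S "\<lambda>z. cmod (Dfun \<phi> z)"] by blast
  define d where "d = cmod (Dfun \<phi> z0)"
  have d0: "0 < d" using z0(1) 1[of z0] S by (auto simp: d_def)
  \<comment> \<open>On the compact segment 1 + |z| is at most 2 M + 3; off it |z| >= 2 M + 1, so |z|
    - M is at least half of 1 + |z|.\<close>
  define c where "c = min (1/4) (d / (2 * M + 4))"
  have c0: "0 < c" using d0 M0 by (simp add: c_def)
  have "c * (1 + cmod z) \<le> cmod (Dfun \<phi> z)" if z: "Im z = \<epsilon>" for z
  proof (cases "\<bar>Re z\<bar> \<le> 2 * M + 1")
    case True
    then have "cmod z \<le> 2 * M + 2" using cmod_le[of z] z e by simp
    then have "c * (1 + cmod z) \<le> d / (2 * M + 4) * (2 * M + 4)"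
      using M0 d0 by (intro mult_mono) (auto simp: c_def)
    also have "\<dots> = d" using M0 by simp
    also have "\<dots> \<le> cmod (Dfun \<phi> z)" unfolding d_def using True z S by (intro z0(2)) auto
    finally show ?thesis .
  next
    case False
    then have far1: "2 * M + 1 \<le> cmod z" using abs_Re_le_cmod[of z] by linarith
    have c4: "c \<le> 1/4" unfolding c_def by (rule min.cobounded1)
    have c5: "c * (1 + cmod z) \<le> 1/4 * (1 + cmod z)"
      by (rule mult_right_mono[OF c4]) simp
    have "cmod z - M \<le> cmod (Dfun \<phi> z)" using far[of z] z e by simp
    then have "1/4 * (1 + cmod z) \<le> cmod (Dfun \<phi> z)" using M0 far1 by simp
    then show ?thesis by (rule order_trans[OF c5])
  qed
  then show ?thesis using that e 1 c0 by blast
qed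

section \<open>Rectangles separating the zeros by modulus\<close>

lemma cos_neg_imp:
  assumes "0 \<le> s" "s < 2 * pi" "cos s < 0"
  shows "pi / 2 < s" "s < 3 * pi / 2"
proof -
  show "pi / 2 < s"
  proof (rule ccontr)
    assume "\<not> pi / 2 < s"
    then have "0 \<le> cos s" using assms by (intro cos_ge_zero) auto
    then show False using assms by simp
  qed
  show "s < 3 * pi / 2"
  proof (rule ccontr)
    assume "\<not> s < 3 * pi / 2"
    then have "0 \<le> cos (2 * pi - s)" using assms by (intro cos_ge_zero) auto
    then show False using assms by (simp add: cos_diff)
  qed
qed

lemma cell_strict_pos: "0 < cell k"
  using pi_gt_zero by (simp add: cell_def add_pos_nonneg)

lemma cell_Suc: "cell (Suc k) = cell k + 2 * pi"
  by (simp add: cell_def algebra_simps)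

lemma cell_le: "cell k \<le> 2 * pi * real (Suc k)"
  using pi_gt_zero by (simp add: cell_def algebra_simps)

lemma cell_bracket:
  assumes "pi / 2 \<le> R"
  obtains k where "cell k \<le> R" "R < cell (Suc k)"
proof -
  define k where "k = nat \<lfloor>(R - pi / 2) / (2 * pi)\<rfloor>"
  have "0 \<le> (R - pi / 2) / (2 * pi)" using assms by simp
  then have k: "real k \<le> (R - pi / 2) / (2 * pi)" "(R - pi / 2) / (2 * pi) < real k + 1"
    unfolding k_def by linarith+
  have "cell k \<le> R" "R < cell (Suc k)"
    using k pi_gt_zero unfolding cell_def by (simp_all add: field_simps)
  then show ?thesis by (rule that)
qed

text \<open>A cell has length 2 pi, but the sign of the sine leaves only its open middle half to the
  zeros. Real parts there differ by less than pi, as \<open>Dfun_zero_unique\<close> requires. The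
  sign s treats both sides of the axis at once.\<close>

lemma high_zeros_in_cell_eq:
  assumes f: "L2 \<phi>" and z: "Dfun \<phi> z = 0" "height \<phi> \<le> Im z"
    and w: "Dfun \<phi> w = 0" "height \<phi> \<le> Im w"
    and zk: "cell k \<le> s * Re z" "s * Re z < cell (Suc k)" and wk: "cell k \<le> s * Re w" "s * Re w < cell (Suc k)"
    and s: "\<bar>s\<bar> = 1"
  shows "z = w"
proof -
  have *: "pi / 2 < s * Re z - cell k \<and> s * Re z - cell k < 3 * pi / 2"
    if z: "Dfun \<phi> z = 0" "height \<phi> \<le> Im z" and zk: "cell k \<le> s * Re z" "s * Re z < cell (Suc k)" for z
  proof -
    have "0 \<le> s * Re z" using zk cell_strict_pos[of k] by linarith
    then have "s * Re z = \<bar>s * Re z\<bar>" by simp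
    also have "\<dots> = \<bar>Re z\<bar>" using s by (simp add: abs_mult)
    finally have "\<bar>Re z\<bar> = s * Re z" by simp
    then have "cos (s * Re z - cell k) < 0"
      using Dfun_zero_high(4)[OF f z] sin_cell_add[of k "s * Re z - cell k"] by simp
    then show ?thesis using cos_neg_imp[of "s * Re z - cell k"] zk by (simp add: cell_Suc)
  qed
  have "\<bar>s * Re z - s * Re w\<bar> < pi"
    using *[OF z zk] *[OF w wk] by linarith
  then have "\<bar>s\<bar> * \<bar>Re z - Re w\<bar> < pi"
    by (simp only: right_diff_distrib[symmetric] abs_mult)
  then show ?thesis using s by (intro Dfun_zero_unique[OF f z w]) simp
qed

definition low_zero_bound :: "(real \<Rightarrow> complex) \<Rightarrow> real" where
  "low_zero_bound \<phi> = exp (height \<phi>) * (1 + sqrt (2 * L2sq \<phi>))"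

lemma low_zero_bound_pos: "0 < low_zero_bound \<phi>"
  unfolding low_zero_bound_def using L2sq_nonneg[of \<phi>] by (intro mult_pos_pos add_pos_nonneg) auto

text \<open>The sine is nonnegative within pi/2 of \<open>cell k\<close>, so a high zero keeps that
  distance in |Re z|. Since (Im z)^2 <= |Re z|, its height adds less to the squared modulus than
  this gap of pi/2 removes.\<close>

lemma zero_inside:
  assumes f: "L2 \<phi>" and z: "Dfun \<phi> z = 0" "0 < Im z" and k: "low_zero_bound \<phi> < cell k" "4 \<le> cell k"
    and x: "\<bar>Re z\<bar> < cell k"
  shows "cmod z < cell k"
proof (cases "height \<phi> \<le> Im z")
  case False
  then show ?thesis using Dfun_zero_low[OF f z, of "height \<phi>"] k by (simp add: low_zero_bound_def)
next
  case True
  define X where "X = cell k"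
  have x1: "\<bar>Re z\<bar> \<le> X - pi / 2"
  proof (rule ccontr)
    assume "\<not> \<bar>Re z\<bar> \<le> X - pi / 2"
    then have "0 \<le> cos (\<bar>Re z\<bar> - X)" using x by (intro cos_ge_zero) (auto simp: X_def)
    then show False
      using Dfun_zero_high(4)[OF f z(1) True] sin_cell_add[of k "\<bar>Re z\<bar> - X"] by (simp add: X_def)
  qed
  have "(cmod z)^2 = \<bar>Re z\<bar>^2 + (Im z)^2" by (simp add: cmod_power2)
  also have "\<dots> \<le> (X - pi / 2)^2 + X"
  proof (rule add_mono)
    show "\<bar>Re z\<bar>^2 \<le> (X - pi / 2)^2" by (rule power_mono[OF x1]) simp
    show "(Im z)^2 \<le> X" using x Dfun_zero_high(3)[OF f z(1) True] by (simp add: X_def)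
  qed
  also have "\<dots> < X^2"
  proof -
    have "pi * 1 \<le> 4" "3 < pi" using pi_less_4 pi_gt3 by auto
    then have "pi^2 / 4 \<le> pi" by (simp add: power2_eq_square)
    moreover have "X * 3 < X * pi" using pi_gt3 k by (intro mult_strict_left_mono) (auto simp: X_def)
    moreover have "(X - pi / 2)^2 = X^2 - X * pi + pi^2 / 4" by (simp add: power2_diff power_divide)
    moreover have "4 \<le> X" using k by (simp add: X_def)
    ultimately show ?thesis using pi_less_4 by linarith
  qed
  finally show ?thesis using k power2_less_imp_less[of "cmod z" X] by (simp add: X_def)
qed

text \<open>The width of the rectangle is chosen so that it contains exactly the zeros of modulus below R:
  the only cells in doubt hold at most one zero on each side.\<close>
lemma one_sided_width:
  assumes f: "L2 \<phi>" and zeros: "\<And>z. Dfun \<phi> z = 0 \<Longrightarrow> 0 < Im z"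
    and k: "low_zero_bound \<phi> < cell k" "4 \<le> cell k" "cell k \<le> R" "R < cell (Suc k)" and s: "\<bar>s\<bar> = 1"
  obtains j where "j = k \<or> j = Suc k"
    "\<And>z. Dfun \<phi> z = 0 \<Longrightarrow> cell k \<le> s * Re z \<Longrightarrow> s * Re z < cell j \<Longrightarrow> cmod z < R"
    "\<And>z. Dfun \<phi> z = 0 \<Longrightarrow> cmod z < R \<Longrightarrow> s * Re z < cell j"
proof -
  have sr: "s * Re z \<le> cmod z" for z
  proof -
    have "s * Re z \<le> \<bar>s * Re z\<bar>" by simp
    also have "\<dots> = \<bar>Re z\<bar>" using s by (simp add: abs_mult)
    finally show ?thesis using abs_Re_le_cmod[of z] by linarith
  qed
  have high: "height \<phi> \<le> Im z" if "Dfun \<phi> z = 0" "cell k \<le> s * Re z" for z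
  proof (rule ccontr)
    assume "\<not> height \<phi> \<le> Im z"
    then have "cmod z \<le> low_zero_bound \<phi>"
      unfolding low_zero_bound_def using zeros[OF that(1)] by (intro Dfun_zero_low f that) auto
    then show False using sr[of z] that k by linarith
  qed
  \<comment> \<open>If the doubtful cell contains a zero of modulus below R, that is its only zero
    and the whole cell is taken; otherwise the rectangle stops in front of it.\<close>
  show ?thesis
  proof (cases "\<exists>w. Dfun \<phi> w = 0 \<and> cmod w < R \<and> cell k \<le> s * Re w")
    case True
    then obtain w where w: "Dfun \<phi> w = 0" "cmod w < R" "cell k \<le> s * Re w" by blast
    show ?thesis
    proof (rule that[of "Suc k"])
      fix z assume z: "Dfun \<phi> z = 0" "cell k \<le> s * Re z" "s * Re z < cell (Suc k)"
      have "z = w"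
        by (rule high_zeros_in_cell_eq[OF f z(1) high[OF z(1,2)] w(1) high[OF w(1,3)] z(2,3) w(3) _ s])
           (use sr[of w] w k in linarith)
      then show "cmod z < R" using w by simp
    next
      fix z assume "cmod z < R"
      then show "s * Re z < cell (Suc k)" using sr[of z] k by linarith
    qed simp
  next
    case False
    then show ?thesis by (intro that[of k]) (auto simp: not_le)
  qed
qed

lemma rectangle_of_zeros:
  assumes f: "L2 \<phi>" and zeros: "\<And>z. Dfun \<phi> z = 0 \<Longrightarrow> 0 < Im z"
    and R: "pi / 2 \<le> R" "low_zero_bound \<phi> + 11 \<le> R"
  obtains i j where "R / 3 \<le> cell i" "cell i \<le> 2 * R" "R / 3 \<le> cell j" "cell j \<le> 2 * R"
    "\<And>z. Dfun \<phi> z = 0 \<Longrightarrow> cmod z < R \<longleftrightarrow> - cell i < Re z \<and> Re z < cell j \<and> Im z < R"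
proof -
  obtain k where k: "cell k \<le> R" "R < cell (Suc k)" by (rule cell_bracket[OF R(1)])
  \<comment> \<open>Cells are at most 7 long, so \<open>cell k\<close> is at least R - 7. The 11 in
    the hypothesis then leaves 4 above \<open>low_zero_bound \<phi>\<close> and makes R - 7 >=
    R/3.\<close>
  have pi7: "2 * pi \<le> 7" using pi_approx by simp
  have k2: "R - 7 \<le> cell k" using k pi7 unfolding cell_Suc by linarith
  have k3: "low_zero_bound \<phi> < cell k" "4 \<le> cell k" "11 \<le> R" using k2 R low_zero_bound_pos[of \<phi>] by linarith+
  obtain j where j: "j = k \<or> j = Suc k"
    "\<And>z. Dfun \<phi> z = 0 \<Longrightarrow> cell k \<le> 1 * Re z \<Longrightarrow> 1 * Re z < cell j \<Longrightarrow> cmod z < R"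
    "\<And>z. Dfun \<phi> z = 0 \<Longrightarrow> cmod z < R \<Longrightarrow> 1 * Re z < cell j"
    using one_sided_width[OF f zeros k3(1,2) k, of 1] by auto
  obtain i where i: "i = k \<or> i = Suc k"
    "\<And>z. Dfun \<phi> z = 0 \<Longrightarrow> cell k \<le> (-1) * Re z \<Longrightarrow> (-1) * Re z < cell i \<Longrightarrow> cmod z < R"
    "\<And>z. Dfun \<phi> z = 0 \<Longrightarrow> cmod z < R \<Longrightarrow> (-1) * Re z < cell i"
    using one_sided_width[OF f zeros k3(1,2) k, of "-1"] by auto
  have bd: "R / 3 \<le> cell m \<and> cell m \<le> 2 * R" if "m = k \<or> m = Suc k" for m
    using that
  proof
    assume "m = k" then show ?thesis using k k2 k3 by simp
  next
    assume "m = Suc k"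
    then show ?thesis using k k2 k3 pi7 pi_gt_zero by (simp add: cell_Suc)
  qed
  have iff: "cmod z < R \<longleftrightarrow> - cell i < Re z \<and> Re z < cell j \<and> Im z < R" if z: "Dfun \<phi> z = 0" for z
  proof
    assume "cmod z < R"
    then show "- cell i < Re z \<and> Re z < cell j \<and> Im z < R"
      using i(3)[OF z] j(3)[OF z] abs_Im_le_cmod[of z] by simp
  next
    assume r: "- cell i < Re z \<and> Re z < cell j \<and> Im z < R"
    consider "cell k \<le> Re z" | "cell k \<le> - Re z" | "\<bar>Re z\<bar> < cell k" by linarith
    then show "cmod z < R"
    proof cases
      case 1 then show ?thesis using j(2)[OF z] r by simp
    next
      case 2 then show ?thesis using i(2)[OF z] r by simp
    next
      case 3 then show ?thesis using zero_inside[OF f z zeros[OF z] k3(1,2)] k by simp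
    qed
  qed
  show ?thesis using bd[OF i(1)] bd[OF j(1)] iff by (intro that[of i j]) blast+
qed

section \<open>Finite combinations of exponentials\<close>

locale zero_combination =
  fixes \<phi> :: "real \<Rightarrow> complex" and F :: "complex set" and c :: "complex \<Rightarrow> complex"
  assumes phi: "L2 \<phi>" and fin: "finite F"
    and zero: "\<And>\<mu>. \<mu> \<in> F \<Longrightarrow> Dfun \<phi> \<mu> = 0" and upper: "\<And>\<mu>. \<mu> \<in> F \<Longrightarrow> 0 < Im \<mu>"
begin

definition xi :: complex where "xi = (\<Sum>\<mu>\<in>F. c \<mu>)"

definition xf :: "real \<Rightarrow> complex" where
  "xf = (\<lambda>t. \<Sum>\<mu>\<in>F. c \<mu> * exp (\<i> * \<mu> * complex_of_real t))"

text \<open>Residue i c at each mu, so that Cauchy's formula picks out the coefficients; the factor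
  i is the one produced by integrating the exponentials in \<open>X_eq\<close>.\<close>

definition P :: "complex \<Rightarrow> complex" where
  "P z = (\<Sum>\<mu>\<in>F. c \<mu> * (\<i> / (z - \<mu>)))"

definition X :: "complex \<Rightarrow> complex" where
  "X z = etrans xf (- z)"

text \<open>The contribution of \<phi> to D (P - X). Each numerator vanishes at z = mu, so the
  singularities are removable.\<close>

definition K :: "complex \<Rightarrow> complex" where
  "K z = (\<Sum>\<mu>\<in>F. c \<mu> * (\<i> * (etrans \<phi> \<mu> - exp (\<i> * (z - \<mu>)) * etrans \<phi> z) / (z - \<mu>)))"

lemma xf_continuous: "continuous_on A xf"
  unfolding xf_def by (intro continuous_intros)

lemma xf_L2: "L2 xf"
  by (rule L2_continuous[OF xf_continuous])

lemma X_eq: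
  assumes "z \<notin> F"
  shows "X z = (\<Sum>\<mu>\<in>F. c \<mu> * (\<i> * (1 - exp (\<i> * (z - \<mu>))) / (z - \<mu>)))"
proof -
  have "X z = (LINT t:{-1..0}|lborel. (\<Sum>\<mu>\<in>F. c \<mu> * exp (\<i> * (\<mu> - z) * complex_of_real t)))"
    unfolding X_def etrans_def
    by (rule arg_cong[where f = "set_lebesgue_integral lborel {-1..0}"])
       (auto simp: xf_def sum_distrib_left algebra_simps exp_add[symmetric] mult_exp_exp intro!: ext sum.cong)
  also have "\<dots> = (\<Sum>\<mu>\<in>F. (LINT t:{-1..0}|lborel. c \<mu> * exp (\<i> * (\<mu> - z) * complex_of_real t)))"
    unfolding set_lebesgue_integral_def scaleR_sum_right
    by (rule Bochner_Integration.integral_sum)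
       (intro L2_integrable[unfolded set_integrable_def] L2_continuous continuous_intros)
  also have "\<dots> = (\<Sum>\<mu>\<in>F. c \<mu> * (\<i> * (1 - exp (\<i> * (z - \<mu>))) / (z - \<mu>)))"
  proof (rule sum.cong[OF refl])
    fix \<mu> assume "\<mu> \<in> F"
    then have ne: "\<mu> - z \<noteq> 0" using assms by auto
    have "(LINT t:{-1..0}|lborel. c \<mu> * exp (\<i> * (\<mu> - z) * complex_of_real t)) =
       c \<mu> * ((1 - exp (- (\<i> * (\<mu> - z)))) / (\<i> * (\<mu> - z)))"
      using LINT_exp[of "\<i> * (\<mu> - z)"] ne by simp
    also have "- (\<i> * (\<mu> - z)) = \<i> * (z - \<mu>)" by (simp add: algebra_simps)
    also have "(1 - exp (\<i> * (z - \<mu>))) / (\<i> * (\<mu> - z)) = \<i> * (1 - exp (\<i> * (z - \<mu>))) / (z - \<mu>)"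
    proof -
      define w where "w = z - \<mu>"
      have w: "w \<noteq> 0" "\<mu> - z = - w" using ne by (auto simp: w_def)
      have "a / (\<i> * (- w)) = \<i> * a / w" for a
        using w by (simp add: field_simps)
      then show ?thesis unfolding w(2) w_def[symmetric] .
    qed
    finally show "(LINT t:{-1..0}|lborel. c \<mu> * exp (\<i> * (\<mu> - z) * complex_of_real t)) =
      c \<mu> * (\<i> * (1 - exp (\<i> * (z - \<mu>))) / (z - \<mu>))" .
  qed
  finally show ?thesis .
qed

text \<open>For one exponential, P - X is i E/(z - mu) with E = exp(i (z - mu)). Since E exp(-i z) =
  exp(-i mu), the zero equation at mu trades this exponential for i mu minus the transform, and
  nothing of size exp(Im z) is left.\<close>

lemma D_P_identity:
  assumes "z \<notin> F"
  shows "Dfun \<phi> z * (P z - X z) = xi + \<i> * z * X z - K z"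
proof -
  have "Dfun \<phi> z * (\<i> / (z - \<mu>) - \<i> * (1 - exp (\<i> * (z - \<mu>))) / (z - \<mu>)) =
      1 + \<i> * z * (\<i> * (1 - exp (\<i> * (z - \<mu>))) / (z - \<mu>))
        - \<i> * (etrans \<phi> \<mu> - exp (\<i> * (z - \<mu>)) * etrans \<phi> z) / (z - \<mu>)" if "\<mu> \<in> F" for \<mu>
  proof -
    define w where "w = z - \<mu>"
    define E where "E = exp (\<i> * w)"
    have ne: "w \<noteq> 0" using assms that by (auto simp: w_def)
    have z: "z = \<mu> + w" by (simp add: w_def)
    have Ez: "E * exp (- \<i> * z) = exp (- \<i> * \<mu>)"
      by (simp add: E_def w_def algebra_simps flip: exp_add)
    have h: "etrans \<phi> \<mu> = \<i> * \<mu> - exp (- \<i> * \<mu>)"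
      using Dfun_zeroD[OF zero[OF that]] by (simp only: add_diff_cancel_left')
    have "w * (1 + \<i> * z * (\<i> * (1 - E) / w) - \<i> * (etrans \<phi> \<mu> - E * etrans \<phi> z) / w)
        = w - z * (1 - E) - \<i> * (etrans \<phi> \<mu> - E * etrans \<phi> z)"
      using ne by (simp add: field_simps)
    also have "\<dots> = \<i> * (E * Dfun \<phi> z)"
      unfolding h Ez[symmetric] Dfun_etrans by (simp add: z algebra_simps)
    also have "\<dots> = w * (Dfun \<phi> z * (\<i> / w - \<i> * (1 - E) / w))"
      using ne by (simp add: field_simps)
    finally show ?thesis unfolding w_def[symmetric] E_def[symmetric] using ne by simp
  qed
  then have "(\<Sum>\<mu>\<in>F. c \<mu> * (Dfun \<phi> z * (\<i> / (z - \<mu>) - \<i> * (1 - exp (\<i> * (z - \<mu>))) / (z - \<mu>)))) =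
     (\<Sum>\<mu>\<in>F. c \<mu> * (1 + \<i> * z * (\<i> * (1 - exp (\<i> * (z - \<mu>))) / (z - \<mu>))
        - \<i> * (etrans \<phi> \<mu> - exp (\<i> * (z - \<mu>)) * etrans \<phi> z) / (z - \<mu>)))"
    by (intro sum.cong) auto
  moreover have "(\<Sum>\<mu>\<in>F. c \<mu> * (Dfun \<phi> z * (\<i> / (z - \<mu>) - \<i> * (1 - exp (\<i> * (z - \<mu>))) / (z - \<mu>))))
      = Dfun \<phi> z * (P z - X z)"
    unfolding P_def X_eq[OF assms] sum_subtractf[symmetric] sum_distrib_left
    by (intro sum.cong) (auto simp: algebra_simps)
  moreover have "(\<Sum>\<mu>\<in>F. c \<mu> * (1 + \<i> * z * (\<i> * (1 - exp (\<i> * (z - \<mu>))) / (z - \<mu>))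
        - \<i> * (etrans \<phi> \<mu> - exp (\<i> * (z - \<mu>)) * etrans \<phi> z) / (z - \<mu>))) = xi + \<i> * z * X z - K z"
    unfolding xi_def X_eq[OF assms] K_def sum_distrib_left sum.distrib[symmetric] sum_subtractf[symmetric]
    by (intro sum.cong) (auto simp: distrib_left right_diff_distrib mult.left_commute[of "c _"])
  ultimately show ?thesis by simp
qed

text \<open>\<open>kernel z t\<close> is the integral of \<open>xf s exp (\<i> z (t - s))\<close> over \<open>s\<close> from \<open>-1\<close> to \<open>t\<close>, and \<open>K\<close> is its
  integral against \<open>\<phi>\<close>; this is what makes \<open>K\<close> bounded in the upper half-plane.\<close>
definition kernel :: "complex \<Rightarrow> real \<Rightarrow> complex" where
  "kernel z t = (\<Sum>\<mu>\<in>F. c \<mu> * (\<i> * (exp (\<i> * \<mu> * t) - exp (\<i> * (z - \<mu>)) * exp (\<i> * t * z)) / (z - \<mu>)))"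

lemma kernel_continuous: "z \<notin> F \<Longrightarrow> continuous_on A (kernel z)"
  unfolding kernel_def by (intro continuous_intros) auto

text \<open>For s <= t and Im z >= 0 the factor exp(i z (t - s)) has modulus at most 1. The kernel
  is thus bounded by the L1 norm of \<open>xf\<close>, hence by its L2 norm on an interval of length
  1.\<close>

lemma kernel_bound:
  assumes z: "z \<notin> F" "0 \<le> Im z" and t: "t \<in> {-1..0}"
  shows "(cmod (kernel z t))^2 \<le> L2sq xf"
proof -
  \<comment> \<open>A primitive in s of the integrand; its value at -1 supplies the terms with exp(i
    (z - mu)).\<close>
  define A where "A = (\<lambda>s::real. \<Sum>\<mu>\<in>F. c \<mu> * (exp (\<i> * z * t) * exp (\<i> * (\<mu> - z) * s) / (\<i> * (\<mu> - z))))"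
  have "((\<lambda>s. xf s * exp (\<i> * z * (t - s))) has_integral (A t - A (-1))) {-1..t}"
  proof (rule fundamental_theorem_of_calculus)
    show "-1 \<le> t" using t by simp
    fix s assume "s \<in> {-1..t}"
    have "(A has_vector_derivative (\<Sum>\<mu>\<in>F. c \<mu> * (exp (\<i> * z * t) * exp (\<i> * (\<mu> - z) * s)))) (at s within {-1..t})"
      unfolding A_def
    proof (rule has_vector_derivative_sum)
      fix \<mu> assume "\<mu> \<in> F"
      then have ne: "\<mu> - z \<noteq> 0" using z by auto
      have "((\<lambda>s. c \<mu> * (exp (\<i> * z * t) * exp (\<i> * (\<mu> - z) * s) / (\<i> * (\<mu> - z)))) has_field_derivative
         c \<mu> * (exp (\<i> * z * t) * exp (\<i> * (\<mu> - z) * s))) (at (complex_of_real s))"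
        using ne by (auto intro!: derivative_eq_intros)
      then show "((\<lambda>s. c \<mu> * (exp (\<i> * z * t) * exp (\<i> * (\<mu> - z) * complex_of_real s) / (\<i> * (\<mu> - z)))) has_vector_derivative
         c \<mu> * (exp (\<i> * z * t) * exp (\<i> * (\<mu> - z) * s))) (at s within {-1..t})"
        by (rule has_vector_derivative_real_field)
    qed
    also have "(\<Sum>\<mu>\<in>F. c \<mu> * (exp (\<i> * z * t) * exp (\<i> * (\<mu> - z) * s))) = xf s * exp (\<i> * z * (t - s))"
      unfolding xf_def sum_distrib_right
      by (intro sum.cong) (auto simp: algebra_simps simp flip: exp_add)
    finally show "(A has_vector_derivative xf s * exp (\<i> * z * (t - s))) (at s within {-1..t})" .
  qed
  moreover have "A t - A (-1) = kernel z t"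
    unfolding A_def kernel_def sum_subtractf[symmetric]
  proof (rule sum.cong[OF refl])
    fix \<mu> assume "\<mu> \<in> F"
    define w where "w = z - \<mu>"
    have ne: "w \<noteq> 0" "\<mu> - z = - w" using z \<open>\<mu> \<in> F\<close> by (auto simp: w_def)
    have "exp (\<i> * z * t) * exp (\<i> * (\<mu> - z) * t) = exp (\<i> * \<mu> * t)"
      by (simp add: algebra_simps flip: exp_add)
    moreover have "exp (\<i> * z * t) * exp (\<i> * (\<mu> - z) * complex_of_real (-1)) = exp (\<i> * (z - \<mu>)) * exp (\<i> * t * z)"
      by (simp add: algebra_simps flip: exp_add)
    moreover have "a / (\<i> * (- w)) = \<i> * a / w" for a
      using ne by (simp add: field_simps)
    ultimately show "c \<mu> * (exp (\<i> * z * t) * exp (\<i> * (\<mu> - z) * t) / (\<i> * (\<mu> - z))) -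
         c \<mu> * (exp (\<i> * z * t) * exp (\<i> * (\<mu> - z) * complex_of_real (-1)) / (\<i> * (\<mu> - z))) =
         c \<mu> * (\<i> * (exp (\<i> * \<mu> * t) - exp (\<i> * (z - \<mu>)) * exp (\<i> * t * z)) / (z - \<mu>))"
      unfolding w_def[symmetric] ne(2) by (simp only: right_diff_distrib diff_divide_distrib)
  qed
  ultimately have k: "((\<lambda>s. xf s * exp (\<i> * z * (t - s))) has_integral kernel z t) {-1..t}" by simp
  have "cmod (kernel z t) \<le> integral {-1..t} (\<lambda>s. cmod (xf s))"
    unfolding integral_unique[OF k, symmetric]
  proof (rule integral_norm_bound_integral)
    show "(\<lambda>s. cmod (xf s)) integrable_on {-1..t}"
      by (intro integrable_continuous_real continuous_intros xf_continuous)
    fix s assume s: "s \<in> {-1..t}"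
    then have "cmod (exp (\<i> * z * (t - s))) \<le> 1" using z by simp
    then show "cmod (xf s * exp (\<i> * z * (t - s))) \<le> cmod (xf s)"
      unfolding norm_mult by (intro mult_right_le_one_le) auto
  qed (use k in auto)
  also have "\<dots> \<le> integral {-1..0} (\<lambda>s. cmod (xf s))"
    using t by (intro integral_subset_le integrable_continuous_real continuous_intros xf_continuous) auto
  also have "\<dots> = (LINT s:{-1..0}|lborel. cmod (xf s) * cmod 1)"
    by (subst set_borel_integral_eq_integral(2))
       (auto intro!: borel_integrable_atLeastAtMost' continuous_intros xf_continuous)
  finally have "cmod (kernel z t) \<le> (LINT s:{-1..0}|lborel. cmod (xf s) * cmod 1)" .
  then have "(cmod (kernel z t))^2 \<le> (LINT s:{-1..0}|lborel. cmod (xf s) * cmod 1)^2"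
    by (intro power_mono) auto
  also have "\<dots> \<le> L2sq xf * L2sq (\<lambda>t. 1)"
    by (rule L2_Cauchy_Schwarz_abs[OF xf_L2 L2_one])
  also have "L2sq (\<lambda>t. 1) = 1"
    by (simp add: L2sq_def set_lebesgue_integral_def)
  finally show ?thesis by simp
qed

lemma K_bound:
  assumes z: "z \<notin> F" "0 \<le> Im z"
  shows "(cmod (K z))^2 \<le> L2sq \<phi> * L2sq xf"
proof -
  define a where "a \<mu> = c \<mu> * (\<i> / (z - \<mu>))" for \<mu>
  have i1: "set_integrable lborel {-1..0} (\<lambda>t. a \<mu> * (exp (\<i> * complex_of_real t * \<mu>) * \<phi> t))"
    and i2: "set_integrable lborel {-1..0} (\<lambda>t. a \<mu> * exp (\<i> * (z - \<mu>)) * (exp (\<i> * complex_of_real t * z) * \<phi> t))" for \<mu>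
    by (intro set_integrable_mult_right etrans_integrable L2_integrable phi)+
  have "K z = (\<Sum>\<mu>\<in>F. a \<mu> * etrans \<phi> \<mu> - a \<mu> * exp (\<i> * (z - \<mu>)) * etrans \<phi> z)"
    unfolding K_def a_def by (intro sum.cong) (auto simp: algebra_simps diff_divide_distrib)
  also have "\<dots> = (\<Sum>\<mu>\<in>F. LINT t:{-1..0}|lborel. a \<mu> * (exp (\<i> * complex_of_real t * \<mu>) * \<phi> t)
       - a \<mu> * exp (\<i> * (z - \<mu>)) * (exp (\<i> * complex_of_real t * z) * \<phi> t))"
    unfolding set_integral_diff(2)[OF i1 i2] by (simp add: etrans_def)
  also have "\<dots> = (LINT t:{-1..0}|lborel. \<Sum>\<mu>\<in>F. a \<mu> * (exp (\<i> * complex_of_real t * \<mu>) * \<phi> t)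
       - a \<mu> * exp (\<i> * (z - \<mu>)) * (exp (\<i> * complex_of_real t * z) * \<phi> t))"
    unfolding set_lebesgue_integral_def scaleR_sum_right
    by (rule Bochner_Integration.integral_sum[symmetric])
       (rule set_integral_diff(1)[OF i1 i2, unfolded set_integrable_def])
  also have "\<dots> = (LINT t:{-1..0}|lborel. kernel z t * \<phi> t)"
  proof -
    have "(\<Sum>\<mu>\<in>F. a \<mu> * (exp (\<i> * complex_of_real t * \<mu>) * \<phi> t)
       - a \<mu> * exp (\<i> * (z - \<mu>)) * (exp (\<i> * complex_of_real t * z) * \<phi> t)) = kernel z t * \<phi> t" for t
      unfolding kernel_def sum_distrib_right a_def
      by (intro sum.cong) (auto simp: diff_divide_distrib algebra_simps)
    then show ?thesis by simp
  qed
  finally have "(cmod (K z))^2 \<le> L2sq (kernel z) * L2sq \<phi>"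
    using L2_Cauchy_Schwarz[OF L2_continuous[OF kernel_continuous[OF z(1)]] phi] by simp
  also have "L2sq (kernel z) \<le> (LINT t:{-1..(0::real)}|lborel. L2sq xf)"
    unfolding L2sq_def[of "kernel z"]
  proof (rule set_integral_mono)
    show "set_integrable lborel {-1..0} (\<lambda>t. (cmod (kernel z t))^2)"
      by (intro L2_D(2) L2_continuous kernel_continuous z)
  qed (auto intro!: kernel_bound z simp: set_integrable_def)
  also have "\<dots> = L2sq xf" by (simp add: set_lebesgue_integral_def)
  finally show ?thesis using L2sq_nonneg[of \<phi>] by (simp add: mult_right_mono mult.commute)
qed

end

section \<open>The corrected integrand and its size on the contour\<close>

lemma cmod_one_minus_ii_ge:
  assumes "0 \<le> Im z"
  shows "1 \<le> cmod (1 - \<i> * z)" "1 + cmod z \<le> 2 * cmod (1 - \<i> * z)"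
proof -
  have "Re (1 - \<i> * z) \<le> cmod (1 - \<i> * z)" by (rule complex_Re_le_cmod)
  then show "1 \<le> cmod (1 - \<i> * z)" using assms by simp
  have "(1 + cmod z)^2 \<le> 2 * (1 + (cmod z)^2)"
    using sum_squares_bound[of 1 "cmod z"] by (simp add: power2_sum)
  also have "\<dots> \<le> 4 * (cmod (1 - \<i> * z))^2"
    using assms unfolding cmod_power2 by (simp add: power2_sum)
  also have "\<dots> = (2 * cmod (1 - \<i> * z))^2" by (simp add: power_mult_distrib)
  finally show "1 + cmod z \<le> 2 * cmod (1 - \<i> * z)"
    by (rule power2_le_imp_le) simp
qed

lemma mult_le_sum_squares: "a * b \<le> a^2 + b^2" for a b :: real
  using sum_squares_bound[of a b] zero_le_power2[of a] zero_le_power2[of b] by linarith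

lemma le_sqrtI: "0 \<le> a \<Longrightarrow> a^2 \<le> b \<Longrightarrow> a \<le> sqrt b"
  by (simp add: real_le_rsqrt)

context zero_combination
begin

text \<open>The pairing of \<open>evec z\<close> with the vector (cnj e, cnj g); taking the
  conjugates as parameters keeps the formula free of them.\<close>

definition V :: "complex \<Rightarrow> (real \<Rightarrow> complex) \<Rightarrow> complex \<Rightarrow> complex" where
  "V e g z = e + etrans g z"

text \<open>The resolvent-like function \<open>V P\<close> corrected by functions holomorphic in the upper half-plane,
  which do not contribute to the contour integral: the first correction makes it small above the
  curve of zeros, the second improves the decay on the real line.\<close>
definition Phi :: "complex \<Rightarrow> (real \<Rightarrow> complex) \<Rightarrow> complex \<Rightarrow> complex" where
  "Phi e g z = V e g z * P z - X z * etrans g z - e * (xi - K z) / (1 - \<i> * z)"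

text \<open>A sum, not a product, of the squared norms of the combination and of the test vector:
  estimates of the type a b <= a^2 + b^2 then suffice, and rescaling the test vector recovers the
  product in \<open>operator_bound\<close>.\<close>

definition N :: "complex \<Rightarrow> (real \<Rightarrow> complex) \<Rightarrow> real" where
  "N e g = (cmod xi)^2 + L2sq xf + (cmod e)^2 + L2sq g"

lemma N_bounds:
  "0 \<le> N e g" "cmod xi \<le> sqrt (N e g)" "L2sq xf \<le> N e g" "cmod e \<le> sqrt (N e g)" "L2sq g \<le> N e g"
  unfolding N_def using L2sq_nonneg[of xf] L2sq_nonneg[of g] by (auto intro!: le_sqrtI)

lemma K_le:
  assumes "z \<notin> F" "0 \<le> Im z"
  shows "cmod (K z) \<le> sqrt (L2sq \<phi>) * sqrt (N e g)"
proof -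
  have "(cmod (K z))^2 \<le> L2sq \<phi> * L2sq xf" by (rule K_bound[OF assms])
  also have "\<dots> \<le> L2sq \<phi> * N e g" by (intro mult_left_mono N_bounds L2sq_nonneg)
  finally show ?thesis by (simp add: real_sqrt_mult[symmetric] le_sqrtI)
qed

lemma xi_K_le:
  assumes "z \<notin> F" "0 \<le> Im z"
  shows "cmod (xi - K z) \<le> (1 + sqrt (L2sq \<phi>)) * sqrt (N e g)"
  using norm_triangle_ineq4[of xi "K z"] K_le[OF assms, of e g] N_bounds(2)[of e g]
  by (simp add: algebra_simps)

text \<open>Solve \<open>D_P_identity\<close> for P. The first correction cancels the growing part
  of V X, of which only e X survives.\<close>

lemma Phi_eq:
  assumes "Dfun \<phi> z \<noteq> 0"
  shows "Phi e g z = V e g z * (xi - K z + \<i> * z * X z) / Dfun \<phi> z + e * X z - e * (xi - K z) / (1 - \<i> * z)"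
proof -
  have "z \<notin> F" using zero assms by auto
  have "P z = (xi + \<i> * z * X z - K z) / Dfun \<phi> z + X z"
    using D_P_identity[OF \<open>z \<notin> F\<close>] assms by (simp add: field_simps)
  then have "V e g z * P z = V e g z * (xi - K z + \<i> * z * X z) / Dfun \<phi> z + (e + etrans g z) * X z"
    by (simp add: V_def algebra_simps)
  then show ?thesis unfolding Phi_def by (simp add: algebra_simps)
qed

text \<open>X and V exp(-Im z) each carry a factor (1 + Im z)^(-1/2), and exp(Im z)/|D| is at most
  4. The worst term V i z X / D is therefore of order |z|/(1 + Im z).\<close>

lemma Phi_bound_far:
  assumes g: "L2 g" and z: "0 < Im z" and D: "cmod z + exp (Im z) \<le> 4 * cmod (Dfun \<phi> z)"
  shows "cmod (Phi e g z) \<le> (24 + 13 * sqrt (L2sq \<phi>)) * N e g * (1 + cmod z / (1 + Im z))"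
proof -
  define A where "A = sqrt (N e g)"
  define al where "al = sqrt (L2sq \<phi>)"
  define s where "s = sqrt (1 + Im z)"
  define r where "r = sqrt 2"
  have A0: "0 \<le> A" "A * A = N e g" using N_bounds(1)[of e g] by (auto simp: A_def)
  have al0: "0 \<le> al" using L2sq_nonneg[of \<phi>] by (simp add: al_def)
  have s: "1 \<le> s" "s * s = 1 + Im z" using z by (auto simp: s_def)
  have r: "0 \<le> r" "r * r = 2" "r \<le> 2" by (auto simp: r_def real_le_lsqrt)
  have ez: "1 + Im z \<le> exp (Im z)" by (rule exp_ge_add_one_self)
  have "s * 1 \<le> s * s" using s by (intro mult_left_mono) auto
  then have se: "s \<le> exp (Im z)" using s ez by linarith
  have Dp: "0 < cmod (Dfun \<phi> z)" using D ez z norm_ge_zero[of z] by linarith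
  then have D0: "Dfun \<phi> z \<noteq> 0" by auto
  then have zF: "z \<notin> F" using zero by auto
  have rA: "(r * A / s)^2 = 2 / (1 + Im z) * N e g"
  proof -
    have "(r * A / s)^2 = (r * r) * (A * A) / (s * s)" by (simp add: power2_eq_square)
    then show ?thesis unfolding r(2) s(2) A0(2) by simp
  qed
  have Xb: "cmod (X z) \<le> r * A / s"
  proof -
    have "(cmod (X z))^2 \<le> 2 / (1 + Im z) * L2sq xf"
      unfolding X_def by (rule cmod_etrans_minus_squared_le[OF xf_L2 z])
    also have "\<dots> \<le> 2 / (1 + Im z) * N e g" using z by (intro mult_left_mono N_bounds) auto
    also have "\<dots> = (r * A / s)^2" by (rule rA[symmetric])
    finally show ?thesis by (rule power2_le_imp_le) (use r A0 s in auto)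
  qed
  have gb: "cmod (etrans g z) \<le> exp (Im z) * (r * A / s)"
  proof -
    have "(cmod (etrans g z))^2 \<le> exp (2 * Im z) * (2 / (1 + Im z)) * L2sq g"
      by (rule cmod_etrans_squared_le[OF g z])
    also have "\<dots> \<le> exp (2 * Im z) * (2 / (1 + Im z)) * N e g" using z by (intro mult_left_mono N_bounds) auto
    also have "\<dots> = (exp (Im z) * (r * A / s))^2"
      unfolding power_mult_distrib[of "exp (Im z)"] rA exp_double by (simp only: mult.assoc)
    finally show ?thesis by (rule power2_le_imp_le) (use r A0 s in auto)
  qed
  have Vb: "cmod (V e g z) \<le> 3 * A * exp (Im z) / s"
  proof -
    have "A * 1 \<le> A * (exp (Im z) / s)"
      using A0 se s by (intro mult_left_mono) (auto simp: le_divide_eq)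
    moreover have "r * (exp (Im z) * A / s) \<le> 2 * (exp (Im z) * A / s)"
      using r A0 s by (intro mult_right_mono) auto
    moreover have "exp (Im z) * (r * A / s) = r * (exp (Im z) * A / s)"
      "A * (exp (Im z) / s) = exp (Im z) * A / s" "3 * A * exp (Im z) / s = 3 * (exp (Im z) * A / s)"
      by (simp_all add: mult_ac)
    ultimately show ?thesis
      using norm_triangle_ineq[of e "etrans g z"] gb N_bounds(4)[of e g]
      unfolding V_def A_def[symmetric] by linarith
  qed
  have Qb: "cmod (xi - K z + \<i> * z * X z) \<le> A * (1 + al + 2 * (cmod z / s))"
  proof -
    have "cmod (\<i> * z * X z) \<le> cmod z * (r * A / s)"
      using mult_left_mono[OF Xb, of "cmod z"] by (simp add: norm_mult)
    also have "\<dots> = r * (cmod z * A / s)" by simp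
    also have "\<dots> \<le> 2 * (cmod z * A / s)" using r A0 s by (intro mult_right_mono) auto
    finally have "cmod (\<i> * z * X z) \<le> 2 * (cmod z * A / s)" .
    moreover have "cmod (xi - K z) \<le> (1 + al) * A"
      using xi_K_le[OF zF, of e g] z by (simp add: A_def al_def)
    ultimately show ?thesis
      using norm_triangle_ineq[of "xi - K z" "\<i> * z * X z"] by (simp add: algebra_simps)
  qed
  have "cmod (V e g z * (xi - K z + \<i> * z * X z) / Dfun \<phi> z)
      \<le> (3 * A * exp (Im z) / s) * (A * (1 + al + 2 * (cmod z / s))) / cmod (Dfun \<phi> z)"
    unfolding norm_divide norm_mult using Vb Qb s A0 by (intro divide_right_mono mult_mono) auto
  also have "\<dots> = (3 * N e g * ((1 + al) / s + 2 * (cmod z / (s * s)))) * (exp (Im z) / cmod (Dfun \<phi> z))"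
  proof -
    have "(1 + al) / s + 2 * (cmod z / (s * s)) = (1 + al + 2 * (cmod z / s)) / s"
      by (simp add: add_divide_distrib)
    then show ?thesis unfolding A0(2)[symmetric] by (simp add: mult_ac)
  qed
  also have "\<dots> \<le> (3 * N e g * ((1 + al) + 2 * (cmod z / (1 + Im z)))) * 4"
  proof (intro mult_mono)
    have "(1 + al) / s \<le> 1 + al"
      using s al0 mult_left_mono[of 1 s "1 + al"] by (simp add: divide_le_eq)
    then show "(1 + al) / s + 2 * (cmod z / (s * s)) \<le> (1 + al) + 2 * (cmod z / (1 + Im z))"
      by (simp add: s(2))
    have "exp (Im z) \<le> 4 * cmod (Dfun \<phi> z)" using D norm_ge_zero[of z] by linarith
    then show "exp (Im z) / cmod (Dfun \<phi> z) \<le> 4" using Dp by (simp add: divide_le_eq)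
  qed (use N_bounds(1)[of e g] al0 s z in auto)
  finally have 1: "cmod (V e g z * (xi - K z + \<i> * z * X z) / Dfun \<phi> z)
      \<le> N e g * (12 + 12 * al + 24 * (cmod z / (1 + Im z)))"
    by (simp add: algebra_simps)
  have "cmod (e * X z) \<le> A * (r * A / s)"
    unfolding norm_mult using N_bounds(4)[of e g] Xb A0 by (intro mult_mono) (auto simp: A_def)
  also have "\<dots> = N e g * (r / s)" using A0 by simp
  also have "\<dots> \<le> N e g * 2"
  proof (intro mult_left_mono N_bounds)
    have "r / s \<le> r / 1" using s r by (intro divide_left_mono) auto
    then show "r / s \<le> 2" using r by simp
  qed
  finally have 2: "cmod (e * X z) \<le> N e g * 2" .
  have "cmod (e * (xi - K z) / (1 - \<i> * z)) = cmod e * cmod (xi - K z) / cmod (1 - \<i> * z)"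
    by (simp add: norm_mult norm_divide)
  also have "\<dots> \<le> (A * ((1 + al) * A)) / 1"
    using N_bounds(4)[of e g] xi_K_le[OF zF, of e g] z A0 cmod_one_minus_ii_ge(1)[of z] al0
    by (intro frac_le mult_mono) (auto simp: A_def al_def)
  also have "\<dots> = N e g * (1 + al)" using A0 by (simp add: mult_ac)
  finally have 3: "cmod (e * (xi - K z) / (1 - \<i> * z)) \<le> N e g * (1 + al)" .
  have "cmod (Phi e g z) \<le> N e g * (12 + 12 * al + 24 * (cmod z / (1 + Im z))) + N e g * 2 + N e g * (1 + al)"
    unfolding Phi_eq[OF D0] using 1 2 3
    by (intro order_trans[OF norm_triangle_ineq4] add_mono order_trans[OF norm_triangle_ineq])
  also have "\<dots> = N e g * (15 + 13 * al + 24 * (cmod z / (1 + Im z)))" by (simp add: algebra_simps)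
  also have "\<dots> \<le> N e g * ((24 + 13 * al) * (1 + cmod z / (1 + Im z)))"
  proof (intro mult_left_mono N_bounds)
    have *: "15 + 13 * al + 24 * w \<le> (24 + 13 * al) * (1 + w)" if "0 \<le> al * w" for w
      using that by (simp add: distrib_left distrib_right)
    have "0 \<le> al * (cmod z / (1 + Im z))" using al0 z by simp
    then show "15 + 13 * al + 24 * (cmod z / (1 + Im z)) \<le> (24 + 13 * al) * (1 + cmod z / (1 + Im z))"
      by (rule *)
  qed
  finally show ?thesis by (simp add: al_def mult_ac)
qed

end

context zero_combination
begin

text \<open>Regrouped so that i z + D appears, which is bounded in the strip because the linear
  terms cancel. The term with e X gains 1/|z| and the one with e (xi - K) gains 1/|z|^2; every term
  is then a product of two among X, the transform of g and \<open>A / q\<close>, and each of these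
  has an integrable square along the line.\<close>

lemma Phi_bound_near:
  assumes g: "L2 g" and z: "0 < Im z" "Im z \<le> 1" and d: "0 < d" "d * (1 + cmod z) \<le> cmod (Dfun \<phi> z)"
  defines "B \<equiv> exp 1 * (1 + sqrt (2 * L2sq \<phi>))"
  shows "cmod (Phi e g z) \<le> ((2 + sqrt (L2sq \<phi>)) + B + 2 * (1 + sqrt (L2sq \<phi>)) * (1 + B)) / d *
      ((cmod (X z))^2 + (cmod (etrans g z))^2 + N e g / (1 + (Re z)^2))"
proof -
  define A where "A = sqrt (N e g)"
  define al where "al = sqrt (L2sq \<phi>)"
  define q where "q = 1 + cmod z"
  define x where "x = cmod (X z)"
  define y where "y = cmod (etrans g z)"
  define D where "D = Dfun \<phi> z"
  have A0: "0 \<le> A" "A^2 = N e g" using N_bounds(1)[of e g] by (auto simp: A_def)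
  have al0: "0 \<le> al" using L2sq_nonneg[of \<phi>] by (simp add: al_def)
  have q: "1 \<le> q" by (simp add: q_def)
  have B0: "0 \<le> B" using L2sq_nonneg[of \<phi>] by (simp add: B_def)
  have xy: "0 \<le> x" "0 \<le> y" by (auto simp: x_def y_def)
  have Dq: "d * q \<le> cmod D" using d by (simp add: D_def q_def)
  have dq: "0 < d * q" using d q by simp
  then have D0: "D \<noteq> 0" using Dq by auto
  then have zF: "z \<notin> F" using zero by (auto simp: D_def)
  have l0: "1 - \<i> * z \<noteq> 0" using cmod_one_minus_ii_ge(1)[of z] z by auto
  have lq: "q \<le> 2 * cmod (1 - \<i> * z)" using cmod_one_minus_ii_ge(2)[of z] z by (simp add: q_def)
  have eA: "cmod e \<le> A" using N_bounds(4)[of e g] by (simp add: A_def)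
  have kA: "cmod (xi - K z) \<le> (1 + al) * A" using xi_K_le[OF zF, of e g] z by (simp add: A_def al_def)
  have DB: "cmod (\<i> * z + D) \<le> B"
  proof -
    have "\<i> * z + D = exp (- \<i> * z) + etrans \<phi> z" unfolding D_def Dfun_etrans by simp
    then have "cmod (\<i> * z + D) \<le> exp (Im z) + exp (Im z) * sqrt (2 * L2sq \<phi>)"
      using norm_triangle_ineq[of "exp (- \<i> * z)" "etrans \<phi> z"] cmod_etrans_le[OF phi z(1)]
      by (simp add: D_def)
    also have "\<dots> = exp (Im z) * (1 + sqrt (2 * L2sq \<phi>))" by (simp add: algebra_simps)
    also have "\<dots> \<le> B" unfolding B_def using z L2sq_nonneg[of \<phi>] by (intro mult_right_mono) (auto intro: add_nonneg_nonneg)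
    finally show ?thesis .
  qed
  have eq: "Phi e g z = etrans g z * (\<i> * z * X z) / D + etrans g z * (xi - K z) / D + e * X z * (\<i> * z + D) / D
      + e * (xi - K z) * (1 - (\<i> * z + D)) / (D * (1 - \<i> * z))"
  proof -
    have 1: "e * (xi - K z) * (1 - (\<i> * z + D)) / (D * (1 - \<i> * z)) = e * (xi - K z) / D - e * (xi - K z) / (1 - \<i> * z)"
      using D0 l0 by (simp add: field_simps)
    have 2: "e * X z * (\<i> * z + D) / D = e * (\<i> * z * X z) / D + e * X z"
      using D0 by (simp add: field_simps)
    have 3: "(e + etrans g z) * (xi - K z + \<i> * z * X z) / D = e * (xi - K z) / D + e * (\<i> * z * X z) / D
       + etrans g z * (xi - K z) / D + etrans g z * (\<i> * z * X z) / D"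
      by (simp only: distrib_left distrib_right add_divide_distrib add_ac)
    show ?thesis
      unfolding Phi_eq[OF D0[unfolded D_def]] D_def[symmetric] V_def 1 2 3 by simp
  qed
  have "cmod (Phi e g z) \<le> y * (cmod z * x) / cmod D + y * cmod (xi - K z) / cmod D + cmod e * x * cmod (\<i> * z + D) / cmod D
      + cmod e * cmod (xi - K z) * cmod (1 - (\<i> * z + D)) / (cmod D * cmod (1 - \<i> * z))"
    unfolding eq x_def y_def
    by (intro order_trans[OF norm_triangle_ineq] add_mono) (auto simp: norm_mult norm_divide)
  also have "\<dots> \<le> y * (q * x) / (d * q) + y * ((1 + al) * A) / (d * q) + A * x * B / (d * q)
      + A * ((1 + al) * A) * (1 + B) / (d * q * (q / 2))"
  proof (intro add_mono frac_le mult_mono)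
    show "cmod (1 - (\<i> * z + D)) \<le> 1 + B"
      using norm_triangle_ineq4[of 1 "\<i> * z + D"] DB by simp
    show "0 < d * q * (q / 2)" using d q by (intro mult_pos_pos) auto
  qed (use xy eA kA DB Dq dq lq q al0 A0 B0 d in \<open>auto simp: q_def\<close>)
  also have "\<dots> = (y * x + (1 + al) * (y * (A / q)) + B * ((A / q) * x) + 2 * (1 + al) * (1 + B) * (A / q)^2) / d"
  proof -
    have "y * (q * x) / (d * q) = y * x / d" using q by simp
    moreover have "y * ((1 + al) * A) / (d * q) = (1 + al) * (y * (A / q)) / d" by (simp add: mult_ac)
    moreover have "A * x * B / (d * q) = B * ((A / q) * x) / d" by (simp add: mult_ac)
    moreover have "A * ((1 + al) * A) * (1 + B) / (d * q * (q / 2)) = 2 * (1 + al) * (1 + B) * (A / q)^2 / d"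
      by (simp add: power2_eq_square mult_ac)
    ultimately show ?thesis by (simp only: add_divide_distrib)
  qed
  also have "\<dots> \<le> ((y^2 + x^2) + (1 + al) * (y^2 + (A/q)^2) + B * ((A/q)^2 + x^2) + 2 * (1 + al) * (1 + B) * (A/q)^2) / d"
    using al0 B0 d by (intro divide_right_mono add_mono mult_left_mono mult_le_sum_squares) auto
  also have "\<dots> \<le> ((2 + al) + B + 2 * (1 + al) * (1 + B)) * (x^2 + y^2 + (A/q)^2) / d"
  proof (intro divide_right_mono)
    have *: "y2 + x2 + (1 + al) * (y2 + a2) + B * (a2 + x2) + 2 * (1 + al) * (1 + B) * a2
      \<le> ((2 + al) + B + 2 * (1 + al) * (1 + B)) * (x2 + y2 + a2)"
      if "0 \<le> x2" "0 \<le> y2" "0 \<le> a2" for x2 y2 a2 :: real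
    proof -
      define c where "c = 2 * (1 + al) * (1 + B)"
      have "0 \<le> c" using al0 B0 by (simp add: c_def)
      then have "0 \<le> c * x2" "0 \<le> c * y2" "0 \<le> al * x2" "0 \<le> B * y2" using that al0 B0 by auto
      then show ?thesis unfolding c_def[symmetric] using that by (simp add: algebra_simps)
    qed
    show "y^2 + x^2 + (1 + al) * (y^2 + (A/q)^2) + B * ((A/q)^2 + x^2) + 2 * (1 + al) * (1 + B) * (A/q)^2
       \<le> ((2 + al) + B + 2 * (1 + al) * (1 + B)) * (x^2 + y^2 + (A/q)^2)"
      by (rule *) auto
  qed (use d in auto)
  also have "\<dots> \<le> ((2 + al) + B + 2 * (1 + al) * (1 + B)) * (x^2 + y^2 + N e g / (1 + (Re z)^2)) / d"
  proof (intro divide_right_mono mult_left_mono add_mono order_refl)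
    have "1 + (Re z)^2 \<le> q^2"
      using abs_Re_le_cmod[of z] power_mono[of "\<bar>Re z\<bar>" "cmod z" 2] by (simp add: q_def power2_sum)
    then have "N e g / q^2 \<le> N e g / (1 + (Re z)^2)"
      using N_bounds(1)[of e g] q by (intro frac_le) (auto intro!: add_pos_nonneg)
    then show "(A/q)^2 \<le> N e g / (1 + (Re z)^2)" using A0 by (simp add: power_divide)
  qed (use d al0 B0 in auto)
  finally have "cmod (Phi e g z) \<le> ((2 + al) + B + 2 * (1 + al) * (1 + B)) * (x^2 + y^2 + N e g / (1 + (Re z)^2)) / d" .
  then show ?thesis unfolding x_def y_def al_def by (simp only: times_divide_eq_left)
qed

end

context zero_combination
begin

text \<open>Only V P has genuine poles; the corrections are holomorphic in the upper half-plane. The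
  residue factor i turns 2 pi i into -2 pi.\<close>

lemma Phi_contour_integral:
  assumes g: "L2 g" and W: "W holomorphic_on {z. 0 < Im z}"
    and box: "0 < Im p" "Im p < Im q" "Re p < Re q" and avoid: "path_image (rectpath p q) \<inter> F = {}"
  shows "((\<lambda>z. W z * Phi e g z) has_contour_integral
     - (2 * pi) * (\<Sum>\<mu> | \<mu> \<in> F \<and> \<mu> \<in> box p q. W \<mu> * c \<mu> * V e g \<mu>)) (rectpath p q)"
proof -
  define H where "H = {z. 0 < Im z}"
  define \<gamma> where "\<gamma> = rectpath p q"
  have HV: "V e g holomorphic_on H" "etrans g holomorphic_on H" "etrans \<phi> holomorphic_on H"
    unfolding V_def[abs_def] by (intro holomorphic_intros etrans_holomorphic L2_integrable g phi)+
  have HX: "X holomorphic_on H"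
    unfolding X_def[abs_def]
    by (rule holomorphic_on_compose[of uminus H "etrans xf", unfolded o_def])
       (intro holomorphic_intros etrans_holomorphic L2_integrable xf_L2)+
  have WH: "W holomorphic_on H" using W by (simp add: H_def)
  have conv: "convex H" unfolding H_def by (rule convex_halfspace_Im_gt)
  have opH: "open H" unfolding H_def by (rule open_halfspace_Im_gt)
  have ne0: "1 - \<i> * z \<noteq> 0" if "z \<in> H" for z
    using cmod_one_minus_ii_ge(1)[of z] that by (auto simp: H_def)
  have pathH: "path_image \<gamma> \<subseteq> H"
  proof -
    have "path_image \<gamma> \<subseteq> cbox p q" unfolding \<gamma>_def using box by (intro path_image_rectpath_subset_cbox) auto
    also have "\<dots> \<subseteq> H" using box by (auto simp: H_def in_cbox_complex_iff)
    finally show ?thesis .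
  qed
  have cauchy: "((\<lambda>z. f z / (z - \<mu>)) has_contour_integral (if \<mu> \<in> box p q then 2 * pi * \<i> * f \<mu> else 0)) \<gamma>"
    if f: "f holomorphic_on H" and \<mu>: "\<mu> \<in> F" for f \<mu>
  proof -
    have nin: "\<mu> \<notin> path_image \<gamma>" using avoid \<mu> by (auto simp: \<gamma>_def)
    have "((\<lambda>z. f z / (z - \<mu>)) has_contour_integral (2 * pi * \<i> * winding_number \<gamma> \<mu> * f \<mu>)) \<gamma>"
    proof (rule Cauchy_integral_formula_convex_simple[OF conv f])
      show "\<mu> \<in> interior H" using upper[OF \<mu>] interior_open[OF opH] by (simp add: H_def)
      show "path_image \<gamma> \<subseteq> H - {\<mu>}" using nin pathH by blast
    qed (simp_all add: \<gamma>_def)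
    moreover have "winding_number \<gamma> \<mu> = (if \<mu> \<in> box p q then 1 else 0)"
    proof (cases "\<mu> \<in> box p q")
      case True
      then show ?thesis unfolding \<gamma>_def by (simp add: winding_number_rectpath)
    next
      case False
      then have "\<mu> \<notin> cbox p q"
        using nin path_image_rectpath_cbox_minus_box[of p q] box by (auto simp: \<gamma>_def)
      then show ?thesis using False box unfolding \<gamma>_def by (simp add: winding_number_rectpath_outside)
    qed
    ultimately show ?thesis by (cases "\<mu> \<in> box p q") simp_all
  qed
  define f1 where "f1 \<mu> z = W z * V e g z * (c \<mu> * \<i>)" for \<mu> z
  \<comment> \<open>The correction containing K is also written as a sum of quotients by z - mu. As
    \<open>f2\<close> vanishes at mu, Cauchy's formula yields 0 and takes care of the removable
    singularity.\<close>
  define f2 where "f2 \<mu> z = W z * e * (c \<mu> * \<i>) * (etrans \<phi> \<mu> - exp (\<i> * (z - \<mu>)) * etrans \<phi> z) / (1 - \<i> * z)" for \<mu> z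
  have f1: "f1 \<mu> holomorphic_on H" for \<mu>
    unfolding f1_def[abs_def] by (intro holomorphic_intros WH HV)
  have f2: "f2 \<mu> holomorphic_on H" for \<mu>
    unfolding f2_def[abs_def] by (intro holomorphic_intros WH HV ne0)
  have f2\<mu>: "f2 \<mu> \<mu> = 0" for \<mu> by (simp add: f2_def)
  have "((\<lambda>z. (\<Sum>\<mu>\<in>F. f1 \<mu> z / (z - \<mu>))) has_contour_integral
       (\<Sum>\<mu>\<in>F. if \<mu> \<in> box p q then 2 * pi * \<i> * f1 \<mu> \<mu> else 0)) \<gamma>"
    by (intro has_contour_integral_sum fin cauchy f1)
  moreover have "((\<lambda>z. (\<Sum>\<mu>\<in>F. f2 \<mu> z / (z - \<mu>))) has_contour_integral
       (\<Sum>\<mu>\<in>F. if \<mu> \<in> box p q then 2 * pi * \<i> * f2 \<mu> \<mu> else 0)) \<gamma>"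
    by (intro has_contour_integral_sum fin cauchy f2)
  moreover have "((\<lambda>z. W z * (X z * etrans g z) + W z * e * xi / (1 - \<i> * z)) has_contour_integral 0) \<gamma>"
    using pathH by (intro Cauchy_theorem_convex_simple[OF _ conv] holomorphic_intros WH HV HX ne0)
       (auto simp: \<gamma>_def)
  ultimately have tot: "((\<lambda>z. (\<Sum>\<mu>\<in>F. f1 \<mu> z / (z - \<mu>)) + (\<Sum>\<mu>\<in>F. f2 \<mu> z / (z - \<mu>))
        - (W z * (X z * etrans g z) + W z * e * xi / (1 - \<i> * z))) has_contour_integral
       (\<Sum>\<mu>\<in>F. if \<mu> \<in> box p q then 2 * pi * \<i> * f1 \<mu> \<mu> else 0)
       + (\<Sum>\<mu>\<in>F. if \<mu> \<in> box p q then 2 * pi * \<i> * f2 \<mu> \<mu> else 0) - 0) \<gamma>"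
    by (rule has_contour_integral_diff[OF has_contour_integral_add])
  have eq: "(\<Sum>\<mu>\<in>F. f1 \<mu> z / (z - \<mu>)) + (\<Sum>\<mu>\<in>F. f2 \<mu> z / (z - \<mu>))
        - (W z * (X z * etrans g z) + W z * e * xi / (1 - \<i> * z)) = W z * Phi e g z" if "z \<in> path_image \<gamma>" for z
  proof -
    have "(\<Sum>\<mu>\<in>F. f1 \<mu> z / (z - \<mu>)) = W z * (V e g z * P z)"
      unfolding P_def f1_def sum_distrib_left by (intro sum.cong) auto
    moreover have "(\<Sum>\<mu>\<in>F. f2 \<mu> z / (z - \<mu>)) = W z * e * K z / (1 - \<i> * z)"
      unfolding K_def f2_def sum_distrib_left sum_divide_distrib by (intro sum.cong) (auto simp: mult_ac)
    ultimately show ?thesis unfolding Phi_def by (simp add: algebra_simps diff_divide_distrib)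
  qed
  have val: "(\<Sum>\<mu>\<in>F. if \<mu> \<in> box p q then 2 * pi * \<i> * f1 \<mu> \<mu> else 0)
       + (\<Sum>\<mu>\<in>F. if \<mu> \<in> box p q then 2 * pi * \<i> * f2 \<mu> \<mu> else 0) - 0 =
      - (2 * pi) * (\<Sum>\<mu> | \<mu> \<in> F \<and> \<mu> \<in> box p q. W \<mu> * c \<mu> * V e g \<mu>)"
  proof -
    have "(\<Sum>\<mu>\<in>F. if \<mu> \<in> box p q then 2 * pi * \<i> * f2 \<mu> \<mu> else 0) = 0"
      by (intro sum.neutral) (simp add: f2\<mu>)
    moreover have "(\<Sum>\<mu>\<in>F. if \<mu> \<in> box p q then 2 * pi * \<i> * f1 \<mu> \<mu> else 0)
       = (\<Sum>\<mu> | \<mu> \<in> F \<and> \<mu> \<in> box p q. 2 * pi * \<i> * f1 \<mu> \<mu>)"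
      by (rule sum.inter_filter[symmetric, OF fin])
    moreover have "\<dots> = - (2 * pi) * (\<Sum>\<mu> | \<mu> \<in> F \<and> \<mu> \<in> box p q. W \<mu> * c \<mu> * V e g \<mu>)"
      unfolding sum_distrib_left by (intro sum.cong) (auto simp: f1_def algebra_simps)
    ultimately show ?thesis by simp
  qed
  show ?thesis
    unfolding \<gamma>_def[symmetric] by (rule has_contour_integral_eq[OF tot[unfolded val] eq])
qed

end

section \<open>The contour estimate\<close>

lemma has_contour_integral_linepath_same_Im_iff:
  assumes "a < b"
  shows "(f has_contour_integral I) (linepath (Complex a y) (Complex b y)) \<longleftrightarrow>
    ((\<lambda>x. f (Complex x y)) has_integral I) {a..b}"
proof -
  have ca: "Complex x y = complex_of_real x + \<i> * y" for x by (simp add: complex_eq_iff)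
  have "(f has_contour_integral I) (linepath (Complex a y) (Complex b y)) \<longleftrightarrow>
     ((\<lambda>z. f (z + \<i> * y)) has_contour_integral I) (linepath (complex_of_real a) (complex_of_real b))"
    unfolding has_contour_integral_linepath ca by (simp add: linepath_def scaleR_conv_of_real algebra_simps)
  also have "\<dots> \<longleftrightarrow> ((\<lambda>x. f (Complex x y)) has_integral I) {a..b}"
    using assms has_contour_integral_linepath_Reals_iff[of "complex_of_real a" "complex_of_real b" "\<lambda>z. f (z + \<i> * y)" I]
    by (simp add: ca)
  finally show ?thesis .
qed

lemma norm_integral_le_const:
  fixes f :: "real \<Rightarrow> complex"
  assumes "f integrable_on {a..b}" "a \<le> b" "\<And>x. x \<in> {a..b} \<Longrightarrow> cmod (f x) \<le> B"
  shows "cmod (integral {a..b} f) \<le> B * (b - a)"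
proof -
  have "0 \<le> B" using assms(2) assms(3)[of a] norm_ge_zero[of "f a"] by (meson atLeastAtMost_iff order_refl order_trans)
  then have "cmod (integral {a..b} f) \<le> B * measure lborel {a..b}"
    by (rule has_integral_bound_real[where S = "{}", OF _ _ integrable_integral[OF assms(1)]]) (use assms(3) in auto)
  then show ?thesis using assms(2) by simp
qed

text \<open>The bound on \<open>f\<close> is of order \<open>R\<close> below height \<open>sqrt R\<close> and of order \<open>sqrt R\<close> above it.\<close>
lemma vertical_side_bound:
  assumes f: "(f has_contour_integral I) (linepath (Complex b \<epsilon>) (Complex b R))"
    and e: "0 < \<epsilon>" "\<epsilon> \<le> 1" and R: "4 \<le> R" and b: "\<bar>b\<bar> \<le> 2 * R" and M: "0 \<le> M"
    and bd: "\<And>z. Re z = b \<Longrightarrow> \<epsilon> \<le> Im z \<Longrightarrow> Im z \<le> R \<Longrightarrow> cmod (f z) \<le> M * (1 + cmod z / (1 + Im z))"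
  shows "cmod I \<le> 8 * M * (R * sqrt R)"
proof -
  \<comment> \<open>Both pieces contribute R sqrt R. Integrating 1/(1 + y) would give R log R, but
    the multiplier can absorb R sqrt R.\<close>
  define s where "s = sqrt R"
  have s: "2 \<le> s" "s * s = R" using R by (auto simp: s_def real_le_rsqrt)
  have sR: "s \<le> R" using s mult_left_mono[of 1 s s] by simp
  define h where "h = (\<lambda>y. f (Complex b y))"
  have hi: "(h has_integral (- \<i> * I)) {\<epsilon>..R}"
    using f e R unfolding h_def by (subst (asm) has_contour_integral_linepath_same_Re_iff) auto
  then have int: "h integrable_on {\<epsilon>..R}" by blast
  have zb: "cmod (Complex b y) \<le> 3 * R" if "0 \<le> y" "y \<le> R" for y
    using cmod_le[of "Complex b y"] that b by simp
  have hb: "cmod (h y) \<le> M * (1 + 3 * R / (1 + y))" if "\<epsilon> \<le> y" "y \<le> R" for y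
  proof -
    have "cmod (h y) \<le> M * (1 + cmod (Complex b y) / (1 + y))"
      using bd[of "Complex b y"] that by (simp add: h_def)
    also have "\<dots> \<le> M * (1 + 3 * R / (1 + y))"
      using that e by (intro mult_left_mono add_left_mono divide_right_mono zb M) auto
    finally show ?thesis .
  qed
  have 1: "cmod (integral {\<epsilon>..s} h) \<le> M * (4 * R) * (s - \<epsilon>)"
  proof (rule norm_integral_le_const)
    show "h integrable_on {\<epsilon>..s}" by (rule integrable_on_subinterval[OF int]) (use sR in auto)
    show "\<epsilon> \<le> s" using e s by simp
    fix y assume y: "y \<in> {\<epsilon>..s}"
    have "cmod (h y) \<le> M * (1 + 3 * R / (1 + y))" using y sR by (intro hb) auto
    also have "\<dots> \<le> M * (4 * R)"
    proof (intro mult_left_mono M)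
      have "3 * R / (1 + y) \<le> 3 * R / 1" using y e R by (intro frac_le) auto
      then show "1 + 3 * R / (1 + y) \<le> 4 * R" using R by simp
    qed
    finally show "cmod (h y) \<le> M * (4 * R)" .
  qed
  have 2: "cmod (integral {s..R} h) \<le> M * (4 * s) * (R - s)"
  proof (rule norm_integral_le_const)
    show "h integrable_on {s..R}" by (rule integrable_on_subinterval[OF int]) (use s e in auto)
    fix y assume y: "y \<in> {s..R}"
    have "cmod (h y) \<le> M * (1 + 3 * R / (1 + y))" using y s e by (intro hb) auto
    also have "\<dots> \<le> M * (4 * s)"
    proof (intro mult_left_mono M)
      have "3 * R / (1 + y) \<le> 3 * R / s" using y s R by (intro frac_le) auto
      also have "3 * R / s = 3 * s" using s by (simp add: field_simps)
      finally show "1 + 3 * R / (1 + y) \<le> 4 * s" using s by simp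
    qed
    finally show "cmod (h y) \<le> M * (4 * s)" .
  qed (rule sR)
  have "- \<i> * I = integral {\<epsilon>..s} h + integral {s..R} h"
    using Henstock_Kurzweil_Integration.integral_combine[of \<epsilon> s R h] e s sR int integral_unique[OF hi] by simp
  then have "cmod (- \<i> * I) = cmod (integral {\<epsilon>..s} h + integral {s..R} h)" by (rule arg_cong)
  then have "cmod I = cmod (integral {\<epsilon>..s} h + integral {s..R} h)" by (simp add: norm_mult)
  also have "\<dots> \<le> M * (4 * R) * (s - \<epsilon>) + M * (4 * s) * (R - s)"
    using 1 2 norm_triangle_ineq[of "integral {\<epsilon>..s} h" "integral {s..R} h"] by linarith
  also have "\<dots> \<le> M * (4 * R) * s + M * (4 * s) * R"
    using M s e R by (intro add_mono mult_left_mono) auto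
  finally show ?thesis by (simp add: s_def mult_ac)
qed

lemma integral_inverse_one_plus_square_le:
  assumes "a \<le> b"
  shows "(\<lambda>x::real. 1 / (1 + x^2)) integrable_on {a..b}" "integral {a..b} (\<lambda>x::real. 1 / (1 + x^2)) \<le> pi"
proof -
  have "((\<lambda>x::real. 1 / (1 + x^2)) has_integral (arctan b - arctan a)) {a..b}"
    using assms
    by (intro fundamental_theorem_of_calculus)
       (auto intro!: derivative_eq_intros simp: has_real_derivative_iff_has_vector_derivative[symmetric] divide_inverse)
  then show "(\<lambda>x::real. 1 / (1 + x^2)) integrable_on {a..b}" "integral {a..b} (\<lambda>x::real. 1 / (1 + x^2)) \<le> pi"
    using arctan_lbound[of a] arctan_ubound[of b] by (auto simp: integral_unique has_integral_integrable)
qed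

lemma etrans_line_continuous:
  assumes "L2 f"
  shows "continuous_on A (\<lambda>x. etrans f (Complex x y))" "continuous_on A (\<lambda>x. etrans f (- Complex x y))"
proof -
  have ch: "continuous_on UNIV (etrans f)"
    by (intro holomorphic_on_imp_continuous_on etrans_holomorphic L2_integrable assms)
  have C: "continuous_on A (\<lambda>x. Complex x y)" unfolding Complex_eq by (intro continuous_intros)
  show "continuous_on A (\<lambda>x. etrans f (Complex x y))"
    by (rule continuous_on_compose2[OF ch C]) simp
  show "continuous_on A (\<lambda>x. etrans f (- Complex x y))"
    by (rule continuous_on_compose2[OF ch continuous_on_minus[OF C]]) simp
qed

context zero_combination
begin

text \<open>The three squares are integrated by the two line estimates and by the arctangent, none
  of which depends on the length of the side.\<close>

lemma bottom_bound:
  assumes g: "L2 g" and Q: "(Q has_contour_integral I) (linepath (Complex a y) (Complex b y))"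
    and ab: "a < b" "\<bar>a\<bar> \<le> 2 * pi * real n" "\<bar>b\<bar> \<le> 2 * pi * real n" and y: "0 \<le> y" "y \<le> 1" and C: "0 \<le> C"
    and bd: "\<And>z. Im z = y \<Longrightarrow> cmod (Q z) \<le> C * ((cmod (X z))^2 + (cmod (etrans g z))^2 + N e g / (1 + (Re z)^2))"
  shows "cmod I \<le> C * (2 * pi + 2 * pi * exp 2 + pi) * N e g"
proof -
  define h1 where "h1 = (\<lambda>x. (cmod (etrans xf (- Complex x y)))^2)"
  define h2 where "h2 = (\<lambda>x. (cmod (etrans g (Complex x y)))^2)"
  define h3 where "h3 = (\<lambda>x::real. 1 / (1 + x^2))"
  have i1: "h1 integrable_on {a..b}"
    unfolding h1_def by (intro integrable_continuous_real continuous_on_power continuous_on_norm etrans_line_continuous xf_L2)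
  have i2: "h2 integrable_on {a..b}"
    unfolding h2_def by (intro integrable_continuous_real continuous_on_power continuous_on_norm etrans_line_continuous g)
  have i3: "h3 integrable_on {a..b}" "integral {a..b} h3 \<le> pi"
    unfolding h3_def using integral_inverse_one_plus_square_le ab by auto
  have hI: "((\<lambda>x. Q (Complex x y)) has_integral I) {a..b}"
    using Q has_contour_integral_linepath_same_Im_iff[OF ab(1)] by blast
  have i123: "(\<lambda>x. C * (h1 x + h2 x + N e g * h3 x)) integrable_on {a..b}"
    by (intro integrable_on_mult_right integrable_add i1 i2 i3)
  have "cmod I \<le> integral {a..b} (\<lambda>x. C * (h1 x + h2 x + N e g * h3 x))"
    unfolding integral_unique[OF hI, symmetric]
  proof (rule integral_norm_bound_integral[OF _ i123])
    show "(\<lambda>x. Q (Complex x y)) integrable_on {a..b}" using hI by blast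
    show "cmod (Q (Complex x y)) \<le> C * (h1 x + h2 x + N e g * h3 x)" for x
      using bd[of "Complex x y"] by (simp add: h1_def h2_def h3_def X_def)
  qed
  also have "\<dots> = C * (integral {a..b} h1 + integral {a..b} h2 + N e g * integral {a..b} h3)"
    using i1 i2 i3 by (simp add: Henstock_Kurzweil_Integration.integral_add integrable_add integrable_on_mult_right)
  also have "\<dots> \<le> C * (2 * pi * N e g + 2 * pi * (exp 2 * N e g) + N e g * pi)"
  proof (intro mult_left_mono add_mono C)
    have "integral {a..b} h1 \<le> 2 * pi * L2sq xf"
      unfolding h1_def by (rule integral_etrans_minus_line_le[OF xf_L2 ab(2,3) y(1)])
    also have "\<dots> \<le> 2 * pi * N e g" by (intro mult_left_mono N_bounds) auto
    finally show "integral {a..b} h1 \<le> 2 * pi * N e g" .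
    have "integral {a..b} h2 \<le> 2 * pi * (exp (2 * y) * L2sq g)"
      unfolding h2_def by (rule integral_etrans_line_le[OF g ab(2,3) y(1)])
    also have "\<dots> \<le> 2 * pi * (exp 2 * N e g)" using y by (intro mult_left_mono mult_mono N_bounds L2sq_nonneg) auto
    finally show "integral {a..b} h2 \<le> 2 * pi * (exp 2 * N e g)" .
  qed (use i3 N_bounds(1)[of e g] in auto)
  also have "\<dots> = C * (2 * pi + 2 * pi * exp 2 + pi) * N e g" by (simp add: algebra_simps)
  finally show ?thesis .
qed

text \<open>\<open>\<omega>\<close> bounds the multiplier on the three sides of the rectangle away from the real axis.\<close>
lemma weighted_sum_le:
  assumes g: "L2 g" and zeros: "\<And>z. Dfun \<phi> z = 0 \<Longrightarrow> \<epsilon> < Im z"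
    and e: "0 < \<epsilon>" "\<epsilon> \<le> 1" and d: "0 < d" "\<And>z. Im z = \<epsilon> \<Longrightarrow> d * (1 + cmod z) \<le> cmod (Dfun \<phi> z)"
    and R: "6 * low_zero_bound \<phi> + 11 \<le> R" "height \<phi> \<le> R"
    and W: "W holomorphic_on {z. 0 < Im z}" "\<And>z. 0 < Im z \<Longrightarrow> cmod (W z) \<le> 1"
      "\<And>z. 0 < Im z \<Longrightarrow> R / 3 \<le> cmod z \<Longrightarrow> cmod (W z) \<le> \<omega>"
    and om: "0 \<le> \<omega>" "\<omega> * (R * sqrt R) \<le> 1"
  defines "B \<equiv> exp 1 * (1 + sqrt (2 * L2sq \<phi>))"
  defines "C2 \<equiv> ((2 + sqrt (L2sq \<phi>)) + B + 2 * (1 + sqrt (L2sq \<phi>)) * (1 + B)) / d"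
  defines "C1 \<equiv> 24 + 13 * sqrt (L2sq \<phi>)"
  shows "cmod (\<Sum>\<mu> | \<mu> \<in> F \<and> cmod \<mu> < R. W \<mu> * c \<mu> * V e' g \<mu>)
     \<le> (C2 * (2 * pi + 2 * pi * exp 2 + pi) + 32 * C1) * N e' g"
proof -
  have lb: "0 < low_zero_bound \<phi>" by (rule low_zero_bound_pos)
  have R11: "11 \<le> R" using R lb by linarith
  have "pi / 2 \<le> R" "low_zero_bound \<phi> + 11 \<le> R" using pi_less_4 R11 R lb by linarith+
  moreover have zeros0: "0 < Im z" if "Dfun \<phi> z = 0" for z using zeros[OF that] e by simp
  ultimately obtain i j where ij: "R / 3 \<le> cell i" "cell i \<le> 2 * R" "R / 3 \<le> cell j" "cell j \<le> 2 * R"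
    and iff: "\<And>z. Dfun \<phi> z = 0 \<Longrightarrow> cmod z < R \<longleftrightarrow> - cell i < Re z \<and> Re z < cell j \<and> Im z < R"
    using rectangle_of_zeros[OF phi] by metis
  define p where "p = Complex (- cell i) \<epsilon>"
  define q where "q = Complex (cell j) R"
  define Q where "Q = (\<lambda>z. W z * Phi e' g z)"
  define M where "M = \<omega> * (C1 * N e' g)"
  have C1: "0 \<le> C1" using L2sq_nonneg[of \<phi>] by (simp add: C1_def)
  have N0: "0 \<le> N e' g" by (rule N_bounds)
  have M0: "0 \<le> M" using om C1 N0 by (simp add: M_def)
  have B0: "0 \<le> B" using L2sq_nonneg[of \<phi>] by (simp add: B_def)
  have C2: "0 \<le> C2" using L2sq_nonneg[of \<phi>] B0 d by (simp add: C2_def)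
  have cij: "0 < cell i" "0 < cell j" by (rule cell_strict_pos)+
  have side_D: "cmod z + exp (Im z) \<le> 4 * cmod (Dfun \<phi> z)" if "\<bar>Re z\<bar> = cell i \<or> \<bar>Re z\<bar> = cell j" "0 < Im z" for z
  proof -
    \<comment> \<open>This is where the factor 6 in the hypothesis on R is spent: both vertical
      sides lie at distance at least R/3.\<close>
    have le: "2 * sqrt (2 * L2sq \<phi>) * exp (height \<phi>) \<le> R / 3"
    proof -
      have "6 * (exp (height \<phi>) + exp (height \<phi>) * sqrt (2 * L2sq \<phi>)) + 11 \<le> R"
        using R(1) unfolding low_zero_bound_def by (simp only: distrib_left mult_1_right)
      moreover have "6 * t \<le> R" if "6 * (E + t) + 11 \<le> R" "0 < E" for t E using that by simp
      ultimately have "6 * (exp (height \<phi>) * sqrt (2 * L2sq \<phi>)) \<le> R" using exp_gt_zero by blast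
      then show ?thesis by (simp add: mult_ac)
    qed
    from that(1) show ?thesis
    proof
      assume "\<bar>Re z\<bar> = cell i"
      then show ?thesis using le ij that(2) by (intro cmod_Dfun_ge_side[OF phi]) auto
    next
      assume "\<bar>Re z\<bar> = cell j"
      then show ?thesis using le ij that(2) by (intro cmod_Dfun_ge_side[OF phi]) auto
    qed
  qed
  have top_z: "cmod z \<le> 3 * R" if "Im z = R" "- cell i \<le> Re z" "Re z \<le> cell j" for z
    using cmod_le[of z] that ij R11 by linarith
  have top_D: "cmod z + exp (Im z) \<le> 4 * cmod (Dfun \<phi> z)" if "Im z = R" "- cell i \<le> Re z" "Re z \<le> cell j" for z
    using top_z[OF that] that R by (intro cmod_Dfun_ge_top[OF phi]) auto
  have far: "cmod (Q z) \<le> M * (1 + cmod z / (1 + Im z))"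
    if "0 < Im z" "R / 3 \<le> cmod z" "cmod z + exp (Im z) \<le> 4 * cmod (Dfun \<phi> z)" for z
  proof -
    have "cmod (Q z) \<le> \<omega> * (C1 * N e' g * (1 + cmod z / (1 + Im z)))"
      unfolding Q_def norm_mult C1_def using W(3)[of z] that Phi_bound_far[OF g that(1,3), of e'] om
      by (intro mult_mono) auto
    then show ?thesis by (simp add: M_def mult_ac)
  qed
  have path_im: "path_image (rectpath p q) = {z. Re z \<in> {- cell i, cell j} \<and> Im z \<in> {\<epsilon>..R}} \<union>
           {z. Im z \<in> {\<epsilon>, R} \<and> Re z \<in> {- cell i..cell j}}"
    using path_image_rectpath[of p q] cij e R11 by (simp add: p_def q_def)
  have nz: "Dfun \<phi> z \<noteq> 0" if "cmod z + exp (Im z) \<le> 4 * cmod (Dfun \<phi> z)" for z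
  proof -
    have "0 < cmod z + exp (Im z)" by (simp add: add_nonneg_pos)
    then show ?thesis using that by auto
  qed
  have avoid: "path_image (rectpath p q) \<inter> F = {}"
  proof -
    have "Dfun \<phi> z \<noteq> 0" if zp: "z \<in> path_image (rectpath p q)" for z
    proof -
      consider "Im z = \<epsilon>" | "\<bar>Re z\<bar> = cell i \<or> \<bar>Re z\<bar> = cell j" "0 < Im z"
        | "Im z = R" "- cell i \<le> Re z" "Re z \<le> cell j"
        using zp cij e unfolding path_im by auto
      then show ?thesis
      proof cases
        case 1 then show ?thesis using zeros[of z] by auto
      next
        case 2 then show ?thesis by (intro nz side_D)
      next
        case 3 then show ?thesis by (intro nz top_D)
      qed
    qed
    then show ?thesis using zero by blast
  qed
  have box_iff: "\<mu> \<in> box p q \<longleftrightarrow> cmod \<mu> < R" if "\<mu> \<in> F" for \<mu>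
    using iff[OF zero[OF that]] zeros[OF zero[OF that]] by (auto simp: in_box_complex_iff p_def q_def)
  then have set_eq: "{\<mu>. \<mu> \<in> F \<and> \<mu> \<in> box p q} = {\<mu>. \<mu> \<in> F \<and> cmod \<mu> < R}" by blast
  define T where "T = (\<Sum>\<mu> | \<mu> \<in> F \<and> cmod \<mu> < R. W \<mu> * c \<mu> * V e' g \<mu>)"
  have tot: "(Q has_contour_integral - (2 * pi) * T) (rectpath p q)"
    using Phi_contour_integral[OF g W(1) _ _ _ avoid, of e'] e R11 cij
    unfolding set_eq Q_def T_def by (simp add: p_def q_def)
  define a2 where "a2 = Complex (cell j) \<epsilon>"
  define a4 where "a4 = Complex (- cell i) R"
  have rp: "rectpath p q = linepath p a2 +++ linepath a2 q +++ linepath q a4 +++ linepath a4 p"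
    by (simp add: rectpath_def Let_def a2_def a4_def p_def q_def)
  have Qi: "Q contour_integrable_on linepath p a2" "Q contour_integrable_on linepath a2 q"
    "Q contour_integrable_on linepath q a4" "Q contour_integrable_on linepath a4 p"
    using has_contour_integral_integrable[OF tot] unfolding rp by simp_all
  have Ti: "- (2 * pi) * T = contour_integral (linepath p a2) Q + (contour_integral (linepath a2 q) Q +
     (contour_integral (linepath q a4) Q + contour_integral (linepath a4 p) Q))"
    using contour_integral_unique[OF tot] Qi unfolding rp by simp
  have b1: "cmod (contour_integral (linepath p a2) Q) \<le> C2 * (2 * pi + 2 * pi * exp 2 + pi) * N e' g"
  proof (rule bottom_bound[OF g _ _ _ _ _ _ C2])
    show "(Q has_contour_integral contour_integral (linepath p a2) Q) (linepath (Complex (- cell i) \<epsilon>) (Complex (cell j) \<epsilon>))"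
      using has_contour_integral_integral[OF Qi(1)] by (simp add: p_def a2_def)
    have "2 * pi * real (Suc k) \<le> 2 * pi * real (Suc (max i j))" if "k \<le> max i j" for k
      using that by (intro mult_left_mono) auto
    then show "\<bar>- cell i\<bar> \<le> 2 * pi * real (Suc (max i j))" "\<bar>cell j\<bar> \<le> 2 * pi * real (Suc (max i j))"
      using cell_le[of i] cell_le[of j] cij by (simp_all only: abs_minus_cancel abs_of_pos) (meson max.cobounded1 max.cobounded2 order_trans)+
    fix z assume z: "Im z = \<epsilon>"
    have "cmod (Q z) \<le> 1 * cmod (Phi e' g z)"
      unfolding Q_def norm_mult using W(2)[of z] z e by (intro mult_right_mono) auto
    then show "cmod (Q z) \<le> C2 * ((cmod (X z))^2 + (cmod (etrans g z))^2 + N e' g / (1 + (Re z)^2))"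
      using Phi_bound_near[OF g _ _ d(1) d(2)[OF z], of e'] z e unfolding C2_def B_def by simp
  qed (use cij e in auto)
  \<comment> \<open>The smallness of the multiplier absorbs the far sides, which contribute 8, 8 and
    16 times this quantity.\<close>
  have rR: "M * (R * sqrt R) \<le> C1 * N e' g"
    using mult_right_mono[OF om(2), of "C1 * N e' g"] C1 N0 by (simp add: M_def mult_ac)
  have re: "cmod z \<ge> R / 3" if "\<bar>Re z\<bar> = cell i \<or> \<bar>Re z\<bar> = cell j" for z
    using that abs_Re_le_cmod[of z] ij by linarith
  have b2: "cmod (contour_integral (linepath a2 q) Q) \<le> 8 * M * (R * sqrt R)"
  proof (rule vertical_side_bound[OF _ e _ _ M0])
    show "(Q has_contour_integral contour_integral (linepath a2 q) Q) (linepath (Complex (cell j) \<epsilon>) (Complex (cell j) R))"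
      using has_contour_integral_integral[OF Qi(2)] by (simp add: q_def a2_def)
    fix z assume "Re z = cell j" "\<epsilon> \<le> Im z"
    then show "cmod (Q z) \<le> M * (1 + cmod z / (1 + Im z))"
      using cij e by (intro far re side_D) auto
  qed (use ij cij R11 in auto)
  have b4: "cmod (- contour_integral (linepath a4 p) Q) \<le> 8 * M * (R * sqrt R)"
  proof (rule vertical_side_bound[OF _ e _ _ M0])
    have "(Q has_contour_integral (- contour_integral (linepath a4 p) Q)) (reversepath (linepath a4 p))"
      by (intro has_contour_integral_reversepath has_contour_integral_integral Qi) simp
    then show "(Q has_contour_integral - contour_integral (linepath a4 p) Q) (linepath (Complex (- cell i) \<epsilon>) (Complex (- cell i) R))"
      by (simp add: p_def a4_def)
    fix z assume "Re z = - cell i" "\<epsilon> \<le> Im z"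
    then show "cmod (Q z) \<le> M * (1 + cmod z / (1 + Im z))"
      using cij e by (intro far re side_D) auto
  qed (use ij cij R11 in auto)
  have b3: "cmod (contour_integral (linepath q a4) Q) \<le> (M * 4) * cmod (a4 - q)"
  proof (rule contour_integral_bound_linepath[OF Qi(3)])
    fix z assume "z \<in> closed_segment q a4"
    then have z: "Im z = R" "- cell i \<le> Re z" "Re z \<le> cell j"
      using cij by (auto simp: q_def a4_def closed_segment_same_Im closed_segment_eq_real_ivl)
    have "cmod (Q z) \<le> M * (1 + cmod z / (1 + Im z))"
      using z R11 abs_Im_le_cmod[of z] by (intro far top_D) auto
    also have "\<dots> \<le> M * 4"
    proof (intro mult_left_mono M0)
      have "cmod z / (1 + Im z) \<le> 3" using top_z[OF z] z R11 by (simp add: divide_le_eq)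
      then show "1 + cmod z / (1 + Im z) \<le> 4" by simp
    qed
    finally show "cmod (Q z) \<le> M * 4" .
  qed (use M0 in simp)
  also have "\<dots> \<le> (M * 4) * (4 * (R * sqrt R))"
  proof (intro mult_left_mono)
    have "a4 - q = complex_of_real (- (cell i + cell j))" by (simp add: a4_def q_def complex_eq_iff)
    then have "cmod (a4 - q) = \<bar>- (cell i + cell j)\<bar>" by (simp only: norm_of_real)
    then have "cmod (a4 - q) = cell i + cell j" using cij by simp
    also have "\<dots> \<le> 4 * (R * 1)" using ij by simp
    also have "\<dots> \<le> 4 * (R * sqrt R)" using R11 by (intro mult_left_mono) auto
    finally show "cmod (a4 - q) \<le> 4 * (R * sqrt R)" .
  qed (use M0 in simp)
  finally have b3: "cmod (contour_integral (linepath q a4) Q) \<le> 16 * (M * (R * sqrt R))" by (simp add: mult_ac)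
  have "2 * pi * cmod T = cmod (- (2 * pi) * T)" by (simp add: norm_mult)
  also have "\<dots> \<le> cmod (contour_integral (linepath p a2) Q) + (cmod (contour_integral (linepath a2 q) Q) +
     (cmod (contour_integral (linepath q a4) Q) + cmod (contour_integral (linepath a4 p) Q)))"
    unfolding Ti by (intro order_trans[OF norm_triangle_ineq] add_left_mono order_refl)
  also have "\<dots> \<le> C2 * (2 * pi + 2 * pi * exp 2 + pi) * N e' g + 32 * (M * (R * sqrt R))"
    using b1 b2 b3 b4 by simp
  also have "\<dots> \<le> (C2 * (2 * pi + 2 * pi * exp 2 + pi) + 32 * C1) * N e' g"
    using rR by (simp add: distrib_right)
  finally have "2 * pi * cmod T \<le> (C2 * (2 * pi + 2 * pi * exp 2 + pi) + 32 * C1) * N e' g" .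
  moreover have "1 * cmod T \<le> 2 * pi * cmod T" using pi_gt3 by (intro mult_right_mono) auto
  ultimately show ?thesis unfolding T_def by linarith
qed

end

section \<open>Strong convergence\<close>

lemma Im_quotient_pos:
  assumes "0 < Im z" "0 < n"
  shows "0 < Im ((z - of_nat n) / (z + of_nat n))"
proof -
  have "Im z * (Re z + real n) - (Re z - real n) * Im z = 2 * real n * Im z" by (simp add: algebra_simps)
  moreover have "0 < 2 * real n * Im z" using assms by simp
  moreover have "0 < (Re z + real n)^2 + (Im z)^2" using assms by (simp add: add_nonneg_pos)
  ultimately show ?thesis by (simp add: Im_divide)
qed

text \<open>In the upper half-plane the imaginary part of the logarithm is the angle under which
  [-n,n] is seen from z.\<close>

lemma cmod_Wn: "cmod (Wn l n z) = exp (- (l * pi) + l * Im (Ln ((z - of_nat n) / (z + of_nat n))))"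
  unfolding Wn_def by simp

lemma cmod_Wn_le_1:
  assumes "0 < Im z" "0 < n" "0 \<le> l"
  shows "cmod (Wn l n z) \<le> 1"
proof -
  have "(z - of_nat n) / (z + of_nat n) \<noteq> 0" using Im_quotient_pos[OF assms(1,2)] by force
  then have "Im (Ln ((z - of_nat n) / (z + of_nat n))) \<le> pi" by (rule Im_Ln_le_pi)
  then have "l * Im (Ln ((z - of_nat n) / (z + of_nat n))) \<le> l * pi" using assms(3) by (rule mult_left_mono)
  then show ?thesis unfolding cmod_Wn by simp
qed

text \<open>The quotient is 1 + v with |v| <= 2/15, so the angle is at most 4/15, which is below
  pi/4.\<close>

lemma cmod_Wn_far:
  assumes z: "0 < Im z" and n: "0 < n" "16 * real n \<le> cmod z" and l: "0 \<le> l"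
  shows "cmod (Wn l n z) \<le> exp (- (3 / 4 * pi * l))"
proof -
  define v where "v = - (2 * of_nat n) / (z + of_nat n)"
  have zn: "15 * real n \<le> cmod (z + of_nat n)"
    using norm_triangle_ineq4[of "z + of_nat n" "of_nat n"] n by simp
  then have zn0: "0 < cmod (z + of_nat n)" using n by linarith
  then have "(z - of_nat n) / (z + of_nat n) = 1 + v"
    by (auto simp: v_def field_simps)
  moreover have v: "cmod v \<le> 2 / 15"
    using zn zn0 by (simp add: v_def norm_divide norm_mult divide_le_eq)
  moreover have "cmod (Ln (1 + v)) \<le> 2 * cmod v" using v by (intro norm_Ln_le) simp
  moreover have "Im (Ln (1 + v)) \<le> 1 / 4 * pi" if "cmod (Ln (1 + v)) \<le> 2 * cmod v" "cmod v \<le> 2 / 15"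
    using that abs_Im_le_cmod[of "Ln (1 + v)"] pi_gt3 by linarith
  ultimately have "Im (Ln ((z - of_nat n) / (z + of_nat n))) \<le> 1 / 4 * pi" by simp
  then have "l * Im (Ln ((z - of_nat n) / (z + of_nat n))) \<le> l * (1 / 4 * pi)" using l by (rule mult_left_mono)
  then show ?thesis unfolding cmod_Wn by (simp add: algebra_simps)
qed

lemma Wn_holomorphic:
  assumes "0 < n"
  shows "Wn l n holomorphic_on {z. 0 < Im z}"
proof -
  have "(z - of_nat n) / (z + of_nat n) \<notin> \<real>\<^sub>\<le>\<^sub>0" if "0 < Im z" for z
    using Im_quotient_pos[OF that assms] by (auto simp: complex_nonpos_Reals_iff)
  moreover have "z + of_nat n \<noteq> 0" if "0 < Im z" for z
    using that by (auto simp: complex_eq_iff)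
  ultimately show ?thesis unfolding Wn_def[abs_def] by (intro holomorphic_intros) auto
qed

text \<open>The quotient is -(1 + v) with v of order |z|/n. The argument pi of the minus sign
  cancels the factor exp(-l pi), leaving exp(-i l Ln(1 + v)).\<close>

lemma Wn_tendsto_1:
  assumes z: "0 < Im z" and l: "\<And>n. 0 < l n" "filterlim l at_top sequentially" "(\<lambda>n. (l n)^2 / real n) \<longlonglongrightarrow> 0"
  shows "(\<lambda>n. Wn (l n) n z) \<longlonglongrightarrow> 1"
proof -
  define v where "v n = - (2 * z) / (z + of_nat n)" for n
  define L where "L n = complex_of_real (l n) * Ln (1 + v n)" for n
  have big: "\<forall>\<^sub>F n in sequentially. 10 * cmod z + 1 \<le> real n"
    using filterlim_real_sequentially by (simp add: filterlim_at_top)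
  have vb: "cmod (v n) \<le> 4 * cmod z / real n \<and> cmod (v n) < 1/2" if "10 * cmod z + 1 \<le> real n" for n
  proof -
    have n0: "0 < real n" using that norm_ge_zero[of z] by linarith
    have "real n / 2 \<le> cmod (z + of_nat n)"
      using norm_triangle_ineq4[of "z + of_nat n" z] that n0 norm_ge_zero[of z] by simp
    then have "cmod (v n) \<le> 2 * cmod z / (real n / 2)"
      using n0 by (simp only: v_def norm_divide norm_minus_cancel norm_mult norm_numeral) (intro frac_le; simp)
    also have "2 * cmod z / (real n / 2) = 4 * cmod z / real n" by simp
    finally have 1: "cmod (v n) \<le> 4 * cmod z / real n" .
    moreover have "4 * cmod z / real n < 1/2" using that n0 norm_ge_zero[of z] by (simp add: divide_less_eq)
    ultimately show ?thesis by simp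
  qed
  have "L \<longlonglongrightarrow> 0"
  proof (rule Lim_null_comparison)
    show "\<forall>\<^sub>F n in sequentially. cmod (L n) \<le> 8 * cmod z * ((l n)^2 / real n)"
      using big filterlim_at_top[THEN iffD1, OF l(2), rule_format, of 1]
    proof eventually_elim
      case (elim n)
      have "cmod (L n) = l n * cmod (Ln (1 + v n))" using l(1)[of n] by (simp add: L_def norm_mult)
      also have "\<dots> \<le> l n * (2 * (4 * cmod z / real n))"
        using vb[OF elim(1)] norm_Ln_le[of "v n"] l(1)[of n] by (intro mult_left_mono) auto
      also have "\<dots> = l n * (8 * cmod z / real n)" by simp
      \<comment> \<open>Eventually l >= 1, so l may be replaced by its square, in accordance with
        the rate assumed for l.\<close>
      also have "\<dots> \<le> (l n)^2 * (8 * cmod z / real n)"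
        using elim(2) l(1)[of n] by (intro mult_right_mono) (auto simp: power2_eq_square)
      finally show ?case by (simp add: mult_ac)
    qed
    show "(\<lambda>n. 8 * cmod z * ((l n)^2 / real n)) \<longlonglongrightarrow> 0"
      using tendsto_mult_right_zero[OF l(3)] by simp
  qed
  then have "(\<lambda>n. exp (- \<i> * L n)) \<longlonglongrightarrow> exp (- \<i> * 0)" by (intro tendsto_intros)
  moreover have "\<forall>\<^sub>F n in sequentially. exp (- \<i> * L n) = Wn (l n) n z"
    using eventually_gt_at_top[of 0]
  proof eventually_elim
    case (elim n)
    define w where "w = (z - of_nat n) / (z + of_nat n)"
    have w: "0 < Im w" unfolding w_def by (rule Im_quotient_pos[OF z elim])
    have "z + of_nat n \<noteq> 0" using z by (auto simp: complex_eq_iff)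
    then have wv: "1 + v n = - w" by (simp add: v_def w_def field_simps)
    have "w \<noteq> 0" using w by auto
    then have Ln_eq: "Ln (1 + v n) = Ln w - \<i> * pi" unfolding wv using w by (simp add: Ln_minus)
    have "- \<i> * L n = - complex_of_real (l n * pi) - \<i> * complex_of_real (l n) * Ln w"
      unfolding L_def Ln_eq by (simp add: algebra_simps)
    then show ?case by (simp add: Wn_def w_def)
  qed
  ultimately show ?thesis by (simp add: filterlim_cong)
qed

section \<open>Squared distances and pairings in M\<close>

definition Msq :: "Mvec \<Rightarrow> Mvec \<Rightarrow> real" where
  "Msq u v = (cmod (fst u - fst v))^2 + L2sq (\<lambda>t. snd u t - snd v t)"

lemma Mdist_eq: "Mdist u v = sqrt (Msq u v)"
  by (simp add: Mdist_def Msq_def L2sq_def)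

lemma Msq_nonneg: "0 \<le> Msq u v"
  by (simp add: Msq_def L2sq_nonneg)

lemma Msq_commute: "Msq u v = Msq v u"
  by (simp add: Msq_def L2sq_def norm_minus_commute)

text \<open>Squares keep roots out of the estimates; the price is a factor 2 for each use.\<close>

lemma Msq_triangle:
  assumes "inM u" "inM v" "inM w"
  shows "Msq u w \<le> 2 * Msq u v + 2 * Msq v w"
proof -
  have "(cmod (fst u - fst w))^2 \<le> 2 * (cmod (fst u - fst v))^2 + 2 * (cmod (fst v - fst w))^2"
    using cmod_add_squared_le[of "fst u - fst v" "fst v - fst w"] by simp
  moreover have "L2sq (\<lambda>t. snd u t - snd w t) \<le> 2 * L2sq (\<lambda>t. snd u t - snd v t) + 2 * L2sq (\<lambda>t. snd v t - snd w t)"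
    using L2sq_add_le[OF L2_diff L2_diff, of "snd u" "snd v" "snd v" "snd w"] assms by (simp add: inM_def)
  ultimately show ?thesis by (simp add: Msq_def)
qed

lemma inM_Mcomb: "inM (Mcomb F c evec)"
  unfolding inM_def Mcomb_def evec_def by (auto intro!: L2_continuous continuous_intros)

text \<open>On [-1,0] the exponentials are bounded by exp r. This crude estimate serves a fixed
  finite set of zeros; its constant is not uniform.\<close>

lemma Mcomb_dist_le:
  assumes im: "\<And>\<mu>. \<mu> \<in> G \<Longrightarrow> \<bar>Im \<mu>\<bar> \<le> r"
  shows "Msq (Mcomb G a evec) (Mcomb G b evec) \<le> (\<Sum>\<mu>\<in>G. cmod (a \<mu> - b \<mu>))^2 * (1 + (exp r)^2)"
proof -
  define S where "S = (\<Sum>\<mu>\<in>G. cmod (a \<mu> - b \<mu>))"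
  have "cmod (\<Sum>\<mu>\<in>G. (a \<mu> - b \<mu>)) \<le> S" unfolding S_def by (rule norm_sum)
  then have 1: "(cmod (\<Sum>\<mu>\<in>G. (a \<mu> - b \<mu>)))^2 \<le> S^2" by (intro power_mono) auto
  define h where "h t = (\<Sum>\<mu>\<in>G. (a \<mu> - b \<mu>) * exp (\<i> * \<mu> * complex_of_real t))" for t
  have hc: "continuous_on {-1..0} h" unfolding h_def by (intro continuous_intros)
  have hb: "cmod (h t) \<le> S * exp r" if t: "t \<in> {-1..0}" for t
  proof -
    have "cmod (h t) \<le> (\<Sum>\<mu>\<in>G. cmod (a \<mu> - b \<mu>) * exp r)"
      unfolding h_def
    proof (rule sum_norm_le)
      fix \<mu> assume "\<mu> \<in> G"
      have "\<bar>t * Im \<mu>\<bar> \<le> \<bar>Im \<mu>\<bar>" using abs_mult_le_of_unit_interval[OF t, of "\<bar>Im \<mu>\<bar>"] by (simp add: abs_mult)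
      then have "- (Im \<mu> * t) \<le> r" using im[OF \<open>\<mu> \<in> G\<close>] by (simp add: mult.commute)
      then show "cmod ((a \<mu> - b \<mu>) * exp (\<i> * \<mu> * complex_of_real t)) \<le> cmod (a \<mu> - b \<mu>) * exp r"
        unfolding norm_mult by (intro mult_left_mono) auto
    qed
    then show ?thesis by (simp add: S_def sum_distrib_right)
  qed
  have "L2sq (\<lambda>t. h t * 1) \<le> (S * exp r)^2 * L2sq (\<lambda>t. 1)"
    by (rule L2sq_mono_mult[OF L2_one hc hb])
  also have "L2sq (\<lambda>t. 1) = 1" by (simp add: L2sq_def set_lebesgue_integral_def)
  finally have 2: "L2sq h \<le> S^2 * (exp r)^2" by (simp add: power_mult_distrib)
  have "Msq (Mcomb G a evec) (Mcomb G b evec) = (cmod (\<Sum>\<mu>\<in>G. (a \<mu> - b \<mu>)))^2 + L2sq h"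
    unfolding Msq_def Mcomb_def evec_def h_def by (simp add: sum_subtractf left_diff_distrib)
  also have "\<dots> \<le> S^2 + S^2 * (exp r)^2" using 1 2 by simp
  finally show ?thesis by (simp add: S_def algebra_simps)
qed

lemma Minner_diff:
  assumes "inM u" "inM v" "inM x"
  shows "Minner u x - Minner v x = (fst u - fst v) * cnj (fst x) + (LINT t:{-1..0}|lborel. (snd u t - snd v t) * cnj (snd x t))"
proof -
  have "set_integrable lborel {-1..0} (\<lambda>t. snd u t * cnj (snd x t))"
    "set_integrable lborel {-1..0} (\<lambda>t. snd v t * cnj (snd x t))"
    using assms by (auto intro!: L2_mult_integrable L2_cnj simp: inM_def)
  then show ?thesis by (simp add: Minner_def left_diff_distrib)
qed

lemma Minner_diff_le:
  assumes "inM u" "inM v" "inM x"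
  shows "cmod (Minner u x - Minner v x) \<le> sqrt (Msq u v) * (cmod (fst x) + sqrt (L2sq (snd x)))"
proof -
  let ?d = "\<lambda>t. snd u t - snd v t"
  have L: "L2 ?d" "L2 (\<lambda>t. cnj (snd x t))" using assms by (auto intro!: L2_diff L2_cnj simp: inM_def)
  have nux: "L2sq (\<lambda>t. cnj (snd x t)) = L2sq (snd x)" by (simp add: L2sq_def)
  have "(cmod (LINT t:{-1..0}|lborel. ?d t * cnj (snd x t)))^2 \<le> L2sq ?d * L2sq (snd x)"
    using L2_Cauchy_Schwarz[OF L] by (simp add: nux)
  also have "\<dots> \<le> Msq u v * L2sq (snd x)"
    by (intro mult_right_mono L2sq_nonneg) (simp add: Msq_def)
  finally have "cmod (LINT t:{-1..0}|lborel. ?d t * cnj (snd x t)) \<le> sqrt (Msq u v) * sqrt (L2sq (snd x))"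
    by (simp add: real_sqrt_mult[symmetric] le_sqrtI)
  moreover have "cmod (fst u - fst v) \<le> sqrt (Msq u v)"
    by (intro le_sqrtI) (auto simp: Msq_def L2sq_nonneg)
  then have "cmod ((fst u - fst v) * cnj (fst x)) \<le> sqrt (Msq u v) * cmod (fst x)"
    by (simp add: norm_mult mult_right_mono)
  ultimately show ?thesis
    unfolding Minner_diff[OF assms] using norm_triangle_ineq[of "(fst u - fst v) * cnj (fst x)"
        "LINT t:{-1..0}|lborel. ?d t * cnj (snd x t)"] by (simp add: distrib_left)
qed

lemma Minner_Mcomb:
  assumes "finite F" "inM x"
  shows "Minner (Mcomb F c evec) x = (\<Sum>\<mu>\<in>F. c \<mu> * Minner (evec \<mu>) x)"
proof -
  have "set_integrable lborel {-1..0} (\<lambda>t. c \<mu> * (snd (evec \<mu>) t * cnj (snd x t)))" for \<mu>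
    using assms
    by (intro set_integrable_mult_right L2_mult_integrable L2_cnj)
       (auto simp: inM_def evec_def intro!: L2_continuous continuous_intros)
  then have "(LINT t:{-1..0}|lborel. (\<Sum>\<mu>\<in>F. c \<mu> * (snd (evec \<mu>) t * cnj (snd x t)))) =
     (\<Sum>\<mu>\<in>F. LINT t:{-1..0}|lborel. c \<mu> * (snd (evec \<mu>) t * cnj (snd x t)))"
    unfolding set_lebesgue_integral_def set_integrable_def scaleR_sum_right
    by (intro Bochner_Integration.integral_sum)
  then show ?thesis
    unfolding Minner_def Mcomb_def
    by (simp add: sum_distrib_right distrib_left sum.distrib mult.assoc)
qed

text \<open>If D is constant it is not 0, because the point 0 lies outside the upper half-plane;
  otherwise a compact disc holds finitely many zeros.\<close>

lemma Dfun_finite_zeros: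
  assumes f: "L2 \<phi>" and zeros: "\<And>z. Dfun \<phi> z = 0 \<Longrightarrow> 0 < Im z"
  shows "finite {z. Dfun \<phi> z = 0 \<and> cmod z < r}"
proof (cases "Dfun \<phi> constant_on UNIV")
  case True
  then obtain k where k: "\<And>z. Dfun \<phi> z = k" by (auto simp: constant_on_def)
  have "k \<noteq> 0" using zeros[of 0] k[of 0] by auto
  then show ?thesis using k by simp
next
  case False
  have "finite {z \<in> cball 0 r. Dfun \<phi> z = 0}"
    by (rule holomorphic_compact_finite_zeros[OF Dfun_holomorphic[OF f] open_UNIV connected_UNIV _ _ False]) auto
  then show ?thesis by (rule rev_finite_subset) auto
qed

definition Mnsq :: "Mvec \<Rightarrow> real" where
  "Mnsq u = (cmod (fst u))^2 + L2sq (snd u)"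

lemma Minner_self: "Minner u u = complex_of_real (Mnsq u)"
proof -
  have "(LINT t:{-1..0}|lborel. snd u t * cnj (snd u t)) = (LINT t:{-1..0}|lborel. complex_of_real ((cmod (snd u t))^2))"
    by (simp only: complex_norm_square)
  also have "\<dots> = complex_of_real (L2sq (snd u))"
    unfolding L2sq_def by (rule set_integral_complex_of_real)
  finally show ?thesis by (simp add: Minner_def Mnsq_def complex_norm_square del: of_real_power)
qed

lemma Msq_Mcomb: "Msq (Mcomb F a evec) (Mcomb F b evec) = Mnsq (Mcomb F (\<lambda>\<mu>. a \<mu> - b \<mu>) evec)"
  by (simp add: Msq_def Mnsq_def Mcomb_def evec_def sum_subtractf left_diff_distrib)

text \<open>The form is tested on \<open>t\<close> times the image vector; the choice \<open>t = 1 / (2 C)\<close> turns the bound by a sum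
  of squares into an operator bound.\<close>
lemma (in zero_combination) operator_bound:
  assumes C: "0 < C"
    and bd: "\<And>e' g. L2 g \<Longrightarrow> cmod (\<Sum>\<mu> | \<mu> \<in> F \<and> cmod \<mu> < R. W \<mu> * c \<mu> * V e' g \<mu>) \<le> C * N e' g"
  shows "Mnsq (Mcomb {\<mu>. \<mu> \<in> F \<and> cmod \<mu> < R} (\<lambda>\<mu>. W \<mu> * c \<mu>) evec) \<le> 4 * C^2 * Mnsq (Mcomb F c evec)"
proof -
  define G where "G = {\<mu>. \<mu> \<in> F \<and> cmod \<mu> < R}"
  define q where "q = Mcomb G (\<lambda>\<mu>. W \<mu> * c \<mu>) evec"
  define p where "p = Mcomb F c evec"
  define t where "t = 1 / (2 * C)"
  have fG: "finite G" using fin by (simp add: G_def)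
  have qM: "inM q" unfolding q_def by (rule inM_Mcomb)
  \<comment> \<open>The conjugate of t q, so that V is t times the pairing with q and the sum
    becomes t times the squared norm of q.\<close>
  define e' where "e' = complex_of_real t * cnj (fst q)"
  define g where "g = (\<lambda>s. complex_of_real t * cnj (snd q s))"
  have g: "L2 g" unfolding g_def using qM by (intro L2_cmult L2_cnj) (simp add: inM_def)
  have Vq: "V e' g \<mu> = complex_of_real t * Minner (evec \<mu>) q" for \<mu>
  proof -
    have "etrans g \<mu> = (LINT s:{-1..0}|lborel. complex_of_real t * (exp (\<i> * \<mu> * complex_of_real s) * cnj (snd q s)))"
      unfolding etrans_def g_def
      by (rule arg_cong[where f = "set_lebesgue_integral lborel {-1..0}"]) (auto simp: mult_ac)
    then show ?thesis by (simp add: V_def e'_def Minner_def evec_def distrib_left)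
  qed
  have "(\<Sum>\<mu>\<in>G. W \<mu> * c \<mu> * V e' g \<mu>) = complex_of_real t * (\<Sum>\<mu>\<in>G. W \<mu> * c \<mu> * Minner (evec \<mu>) q)"
    unfolding Vq sum_distrib_left by (intro sum.cong) auto
  also have "(\<Sum>\<mu>\<in>G. W \<mu> * c \<mu> * Minner (evec \<mu>) q) = Minner q q"
    using Minner_Mcomb[OF fG qM, of "\<lambda>\<mu>. W \<mu> * c \<mu>"] by (simp add: q_def)
  finally have "cmod (\<Sum>\<mu>\<in>G. W \<mu> * c \<mu> * V e' g \<mu>) = cmod (complex_of_real (t * Mnsq q))"
    by (simp add: Minner_self)
  then have "cmod (\<Sum>\<mu>\<in>G. W \<mu> * c \<mu> * V e' g \<mu>) = \<bar>t * Mnsq q\<bar>" by (simp only: norm_of_real)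
  then have "t * Mnsq q \<le> C * N e' g" using bd[OF g, of e'] by (simp add: G_def)
  also have "N e' g = Mnsq p + t^2 * Mnsq q"
  proof -
    have "L2sq g = t^2 * L2sq (snd q)"
      by (simp add: L2sq_def g_def norm_mult power_mult_distrib)
    moreover have "xf = snd p" "xi = fst p" by (simp_all add: xf_def xi_def p_def Mcomb_def evec_def)
    ultimately show ?thesis
      by (simp add: N_def Mnsq_def e'_def norm_mult power_mult_distrib algebra_simps)
  qed
  finally have "t * Mnsq q \<le> C * Mnsq p + (C * t^2) * Mnsq q" by (simp add: algebra_simps)
  \<comment> \<open>Half of the left side thus absorbs the term in q.\<close>
  moreover have "C * t^2 = t / 2" using C by (simp add: t_def power2_eq_square)
  ultimately have "t / 2 * Mnsq q \<le> C * Mnsq p" by simp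
  then have "Mnsq q \<le> 4 * C^2 * Mnsq p" using C by (simp add: t_def divide_le_eq power2_eq_square mult_ac)
  then show ?thesis by (simp add: q_def p_def G_def)
qed

text \<open>The constant is built from \<phi> and the lower bound of D near the axis. Quantifying F
  and c inside the eventuality lets the approximating combination be chosen after n.\<close>

lemma uniform_operator_bound:
  assumes phi: "L2 \<phi>" and zeros: "\<And>z. Dfun \<phi> z = 0 \<Longrightarrow> 0 < Im z"
    and l_pos: "\<And>n. 0 < l n" and R_pos: "\<And>n. 0 < R n"
    and R_inf: "filterlim R at_top sequentially"
    and nR: "(\<lambda>n. real n / R n) \<longlonglongrightarrow> 0"
    and expR: "(\<lambda>n. exp (- pi * l n / 2) * R n) \<longlonglongrightarrow> 0"
  obtains C where "0 \<le> C" "\<forall>\<^sub>F n in sequentially. \<forall>F c. finite F \<longrightarrow> (\<forall>\<mu>\<in>F. Dfun \<phi> \<mu> = 0) \<longrightarrow>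
      Mnsq (Mcomb {\<mu>. \<mu> \<in> F \<and> cmod \<mu> < R n} (\<lambda>\<mu>. Wn (l n) n \<mu> * c \<mu>) evec) \<le> C * Mnsq (Mcomb F c evec)"
proof -
  obtain \<epsilon> d where ed: "0 < \<epsilon>" "\<epsilon> \<le> 1" "0 < d" "\<And>z. Dfun \<phi> z = 0 \<Longrightarrow> \<epsilon> < Im z"
    "\<And>z. Im z = \<epsilon> \<Longrightarrow> d * (1 + cmod z) \<le> cmod (Dfun \<phi> z)"
    using cmod_Dfun_ge_bottom[OF phi zeros] by metis
  define B where "B = exp 1 * (1 + sqrt (2 * L2sq \<phi>))"
  define C where "C = ((2 + sqrt (L2sq \<phi>)) + B + 2 * (1 + sqrt (L2sq \<phi>)) * (1 + B)) / d * (2 * pi + 2 * pi * exp 2 + pi)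
     + 32 * (24 + 13 * sqrt (L2sq \<phi>))"
  have "0 \<le> B" using L2sq_nonneg[of \<phi>] by (simp add: B_def)
  have "0 \<le> sqrt (L2sq \<phi>)" using L2sq_nonneg[of \<phi>] by simp
  then have pos: "0 < 32 * (24 + 13 * sqrt (L2sq \<phi>))" by (intro mult_pos_pos add_pos_nonneg) auto
  then have C0: "0 < C"
    unfolding C_def using \<open>0 \<le> B\<close> \<open>0 \<le> sqrt (L2sq \<phi>)\<close> ed(3)
    by (intro add_nonneg_pos[OF _ pos]) auto
  have ev1: "\<forall>\<^sub>F n in sequentially. 6 * low_zero_bound \<phi> + 11 \<le> R n \<and> height \<phi> \<le> R n"
    using R_inf by (simp add: filterlim_at_top eventually_conj_iff)
  have ev2: "\<forall>\<^sub>F n in sequentially. real n / R n < 1 / 48"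
    by (rule order_tendstoD(2)[OF nR]) simp
  have ev3: "\<forall>\<^sub>F n in sequentially. exp (- pi * l n / 2) * R n < 1"
    by (rule order_tendstoD(2)[OF expR]) simp
  have "\<forall>\<^sub>F n in sequentially. \<forall>F c. finite F \<longrightarrow> (\<forall>\<mu>\<in>F. Dfun \<phi> \<mu> = 0) \<longrightarrow>
      Mnsq (Mcomb {\<mu>. \<mu> \<in> F \<and> cmod \<mu> < R n} (\<lambda>\<mu>. Wn (l n) n \<mu> * c \<mu>) evec) \<le> 4 * C^2 * Mnsq (Mcomb F c evec)"
    using ev1 ev2 ev3 eventually_gt_at_top[of 0]
  proof eventually_elim
    case (elim n)
    show ?case
    proof (intro allI impI)
      fix F c assume F: "finite F" "\<forall>\<mu>\<in>F. Dfun \<phi> \<mu> = 0"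
      interpret zero_combination \<phi> F c
        by standard (use phi F zeros in auto)
      define \<omega> where "\<omega> = exp (- (3 / 4 * pi * l n))"
      \<comment> \<open>The power 3/2 of x is the product of \<omega> and R sqrt R, and x <= 1 for
        large n.\<close>
      define x where "x = exp (- pi * l n / 2) * R n"
      have x: "0 \<le> x" "x \<le> 1" using elim(3) R_pos[of n] by (auto simp: x_def)
      \<comment> \<open>48 = 3 * 16: the far sides have modulus at least R/3, and
        \<open>cmod_Wn_far\<close> asks for 16 n.\<close>
      have n48: "48 * real n \<le> R n" using elim(2) R_pos[of n] by (simp add: divide_less_eq)
      have "exp (- pi * l n / 4) * exp (- pi * l n / 4) = exp (- pi * l n / 2)" by (simp flip: exp_add)
      then have "sqrt (exp (- pi * l n / 2)) = exp (- pi * l n / 4)" by (intro real_sqrt_unique) (auto simp: power2_eq_square)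
      then have "x * sqrt x = (exp (- pi * l n / 2) * exp (- pi * l n / 4)) * (R n * sqrt (R n))"
        by (simp add: x_def real_sqrt_mult)
      also have "exp (- pi * l n / 2) * exp (- pi * l n / 4) = \<omega>"
        unfolding \<omega>_def by (simp add: algebra_simps flip: exp_add)
      finally have om: "\<omega> * (R n * sqrt (R n)) = x * sqrt x" by simp
      have om1: "x * sqrt x \<le> 1 * 1" using x by (intro mult_mono) auto
      show "Mnsq (Mcomb {\<mu>. \<mu> \<in> F \<and> cmod \<mu> < R n} (\<lambda>\<mu>. Wn (l n) n \<mu> * c \<mu>) evec) \<le> 4 * C^2 * Mnsq (Mcomb F c evec)"
      proof (rule operator_bound[OF C0])
        fix e' g assume g: "L2 g"
        show "cmod (\<Sum>\<mu> | \<mu> \<in> F \<and> cmod \<mu> < R n. Wn (l n) n \<mu> * c \<mu> * V e' g \<mu>) \<le> C * N e' g"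
          unfolding C_def B_def
        proof (rule weighted_sum_le[OF g, where \<omega> = \<omega> and \<epsilon> = \<epsilon> and d = d])
          show "Wn (l n) n holomorphic_on {z. 0 < Im z}" by (rule Wn_holomorphic[OF elim(4)])
          show "cmod (Wn (l n) n z) \<le> 1" if "0 < Im z" for z
            using cmod_Wn_le_1[OF that elim(4)] l_pos[of n] by simp
          show "cmod (Wn (l n) n z) \<le> \<omega>" if "0 < Im z" "R n / 3 \<le> cmod z" for z
            unfolding \<omega>_def using that n48 l_pos[of n] elim(4) by (intro cmod_Wn_far) auto
          show "\<omega> * (R n * sqrt (R n)) \<le> 1" using om om1 by simp
        qed (use ed elim(1) in \<open>auto simp: \<omega>_def\<close>)
      qed
    qed
  qed
  then show ?thesis by (intro that[of "4 * C^2"]) auto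
qed

theorem theorem2:
  fixes \<phi> :: "real \<Rightarrow> complex"
    and Lam :: "complex set"
    and xs :: "complex \<Rightarrow> Mvec"
    and l R :: "nat \<Rightarrow> real"
  assumes phi: "L2 \<phi>"
    and Lam_def: "Lam = {z. Dfun \<phi> z = 0}"
    and zeros_upper: "\<forall>z\<in>Lam. Im z > 0"
    and zeros_simple: "\<forall>z\<in>Lam. deriv (Dfun \<phi>) z \<noteq> 0"
    and complete: "Mcomplete evec Lam"
    and minimal: "Mminimal evec Lam"
    and xs_in: "\<forall>lam\<in>Lam. inM (xs lam)"
    and biorth: "\<forall>lam\<in>Lam. \<forall>mu\<in>Lam. Minner (evec mu) (xs lam) = (if lam = mu then 1 else 0)"
    and l_pos: "\<forall>n. l n > 0" and R_pos: "\<forall>n. R n > 0"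
    and l_inf: "filterlim l at_top sequentially"
    and R_inf: "filterlim R at_top sequentially"
    and l2n: "(\<lambda>n. (l n)^2 / real n) \<longlonglongrightarrow> 0"
    and nR: "(\<lambda>n. real n / R n) \<longlonglongrightarrow> 0"
    and expR: "(\<lambda>n. exp (- pi * l n / 2) * R n) \<longlonglongrightarrow> 0"
  shows "\<forall>u. inM u \<longrightarrow> (\<lambda>n. Mdist (Sop Lam xs (l n) (R n) n u) u) \<longlonglongrightarrow> 0"
proof (intro allI impI)
  fix u :: Mvec assume u: "inM u"
  have zeros: "0 < Im z" if "Dfun \<phi> z = 0" for z using zeros_upper Lam_def that by auto
  define S where "S n u = Sop Lam xs (l n) (R n) n u" for n u
  define Fn where "Fn n = {\<nu>\<in>Lam. cmod \<nu> < R n}" for n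
  have fFn: "finite (Fn n)" for n
    using Dfun_finite_zeros[OF phi zeros, of "R n"] by (simp add: Fn_def Lam_def)
  have S_eq: "S n u = Mcomb (Fn n) (\<lambda>\<nu>. wn (l n) (R n) n \<nu> * Minner u (xs \<nu>)) evec" for n u
    by (simp add: S_def Sop_def Fn_def)
  have S_inM: "inM (S n u)" for n u unfolding S_eq by (rule inM_Mcomb)

  have S_comb: "S n (Mcomb F c evec) = Mcomb {\<mu>. \<mu> \<in> F \<and> cmod \<mu> < R n} (\<lambda>\<mu>. Wn (l n) n \<mu> * c \<mu>) evec"
    if F: "finite F" "F \<subseteq> Lam" for n F c
  proof -
    have coef: "Minner (Mcomb F c evec) (xs \<nu>) = (if \<nu> \<in> F then c \<nu> else 0)" if "\<nu> \<in> Lam" for \<nu>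
    proof -
      have "Minner (Mcomb F c evec) (xs \<nu>) = (\<Sum>\<mu>\<in>F. c \<mu> * Minner (evec \<mu>) (xs \<nu>))"
        using xs_in that by (intro Minner_Mcomb F) auto
      also have "\<dots> = (\<Sum>\<mu>\<in>F. if \<nu> = \<mu> then c \<mu> else 0)"
        using biorth that F by (intro sum.cong) auto
      also have "\<dots> = (if \<nu> \<in> F then c \<nu> else 0)" using F by simp
      finally show ?thesis .
    qed
    have sub: "{\<mu>. \<mu> \<in> F \<and> cmod \<mu> < R n} \<subseteq> Fn n" using F by (auto simp: Fn_def)
    \<comment> \<open>A general weight h covers both components of \<open>Mcomb\<close> at
      once.\<close>
    have "(\<Sum>\<nu>\<in>Fn n. wn (l n) (R n) n \<nu> * Minner (Mcomb F c evec) (xs \<nu>) * h \<nu>)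
        = (\<Sum>\<mu> | \<mu> \<in> F \<and> cmod \<mu> < R n. Wn (l n) n \<mu> * c \<mu> * h \<mu>)" for h :: "complex \<Rightarrow> complex"
      by (rule sum.mono_neutral_cong_right[OF fFn sub]) (auto simp: coef Fn_def wn_def F(2)[THEN subsetD])
    then show ?thesis unfolding S_eq by (simp add: Mcomb_def)
  qed

  obtain C where C: "0 \<le> C" "\<forall>\<^sub>F n in sequentially. \<forall>F c. finite F \<longrightarrow> (\<forall>\<mu>\<in>F. Dfun \<phi> \<mu> = 0) \<longrightarrow>
      Mnsq (Mcomb {\<mu>. \<mu> \<in> F \<and> cmod \<mu> < R n} (\<lambda>\<mu>. Wn (l n) n \<mu> * c \<mu>) evec) \<le> C * Mnsq (Mcomb F c evec)"
    using uniform_operator_bound[OF phi zeros, of l R] l_pos R_pos R_inf nR expR by blast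

  \<comment> \<open>Here k depends on n. It only serves to pass from u to a combination chosen for
    that n.\<close>
  have S_cont: "\<exists>k\<ge>0. \<forall>v. inM v \<longrightarrow> Msq (S n u) (S n v) \<le> k * Msq u v" for n
  proof -
    define m where "m \<nu> = cmod (wn (l n) (R n) n \<nu>) * (cmod (fst (xs \<nu>)) + sqrt (L2sq (snd (xs \<nu>))))" for \<nu>
    define k where "k = (\<Sum>\<nu>\<in>Fn n. m \<nu>)^2 * (1 + (exp (R n))^2)"
    have "Msq (S n u) (S n v) \<le> k * Msq u v" if v: "inM v" for v
    proof -
      let ?D = "\<Sum>\<nu>\<in>Fn n. cmod (wn (l n) (R n) n \<nu> * Minner u (xs \<nu>) - wn (l n) (R n) n \<nu> * Minner v (xs \<nu>))"
      have "?D \<le> (\<Sum>\<nu>\<in>Fn n. sqrt (Msq u v) * m \<nu>)"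
      proof (rule sum_mono)
        fix \<nu> assume "\<nu> \<in> Fn n"
        then have "inM (xs \<nu>)" using xs_in by (auto simp: Fn_def)
        then have "cmod (wn (l n) (R n) n \<nu>) * cmod (Minner u (xs \<nu>) - Minner v (xs \<nu>))
           \<le> cmod (wn (l n) (R n) n \<nu>) * (sqrt (Msq u v) * (cmod (fst (xs \<nu>)) + sqrt (L2sq (snd (xs \<nu>)))))"
          by (intro mult_left_mono Minner_diff_le u v) auto
        then show "cmod (wn (l n) (R n) n \<nu> * Minner u (xs \<nu>) - wn (l n) (R n) n \<nu> * Minner v (xs \<nu>)) \<le> sqrt (Msq u v) * m \<nu>"
          unfolding right_diff_distrib[symmetric] norm_mult by (simp add: m_def mult_ac)
      qed
      then have "?D \<le> sqrt (Msq u v) * (\<Sum>\<nu>\<in>Fn n. m \<nu>)" by (simp add: sum_distrib_left)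
      then have "?D^2 \<le> (sqrt (Msq u v) * (\<Sum>\<nu>\<in>Fn n. m \<nu>))^2"
        by (intro power_mono sum_nonneg) auto
      then have D2: "?D^2 \<le> Msq u v * (\<Sum>\<nu>\<in>Fn n. m \<nu>)^2"
        by (simp add: power_mult_distrib Msq_nonneg)
      have "Msq (S n u) (S n v) \<le> ?D^2 * (1 + (exp (R n))^2)"
        unfolding S_eq
      proof (rule Mcomb_dist_le)
        show "\<bar>Im \<mu>\<bar> \<le> R n" if "\<mu> \<in> Fn n" for \<mu>
          using that abs_Im_le_cmod[of \<mu>] by (simp add: Fn_def)
      qed
      also have "\<dots> \<le> (Msq u v * (\<Sum>\<nu>\<in>Fn n. m \<nu>)^2) * (1 + (exp (R n))^2)"
        by (intro mult_right_mono D2) auto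
      finally show ?thesis by (simp add: k_def mult_ac)
    qed
    moreover have "0 \<le> k" by (simp add: k_def)
    ultimately show ?thesis by blast
  qed

  have approx: "\<exists>F c. finite F \<and> F \<subseteq> Lam \<and> Msq u (Mcomb F c evec) < \<delta>" if "0 < \<delta>" for \<delta>
  proof -
    have "0 < sqrt \<delta>" using that by simp
    then obtain F c where "finite F" "F \<subseteq> Lam" "Mdist u (Mcomb F c evec) < sqrt \<delta>"
      using complete u unfolding Mcomplete_def by meson
    then show ?thesis unfolding Mdist_eq by auto
  qed

  have comb_conv: "(\<lambda>n. Msq (S n (Mcomb F c evec)) (Mcomb F c evec)) \<longlonglongrightarrow> 0" if F: "finite F" "F \<subseteq> Lam" for F c
  proof (rule tendsto_sandwich[OF _ _ tendsto_const])
    define r where "r = (\<Sum>\<mu>\<in>F. cmod \<mu>)"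
    have r: "cmod \<mu> \<le> r" if "\<mu> \<in> F" for \<mu>
      unfolding r_def using F that by (intro member_le_sum) auto
    let ?b = "\<lambda>n. (\<Sum>\<mu>\<in>F. cmod (Wn (l n) n \<mu> * c \<mu> - c \<mu>))^2 * (1 + (exp r)^2)"
    show "\<forall>\<^sub>F n in sequentially. 0 \<le> Msq (S n (Mcomb F c evec)) (Mcomb F c evec)"
      by (simp add: Msq_nonneg)
    have "\<forall>\<^sub>F n in sequentially. r < R n"
      using R_inf by (simp add: filterlim_at_top_dense)
    then show "\<forall>\<^sub>F n in sequentially. Msq (S n (Mcomb F c evec)) (Mcomb F c evec) \<le> ?b n"
    proof eventually_elim
      case (elim n)
      then have "{\<mu>. \<mu> \<in> F \<and> cmod \<mu> < R n} = F" using r by force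
      then show ?case unfolding S_comb[OF F]
        by (simp, intro Mcomb_dist_le order_trans[OF abs_Im_le_cmod r])
    qed
    have W1: "(\<lambda>n. Wn (l n) n \<mu>) \<longlonglongrightarrow> 1" if "\<mu> \<in> F" for \<mu>
      using zeros_upper F that l_pos l_inf l2n by (intro Wn_tendsto_1) auto
    have "?b \<longlonglongrightarrow> (\<Sum>\<mu>\<in>F. cmod (1 * c \<mu> - c \<mu>))^2 * (1 + (exp r)^2)"
      by (intro tendsto_intros W1)
    then show "?b \<longlonglongrightarrow> 0" by simp
  qed

  have "(\<lambda>n. Msq (S n u) u) \<longlonglongrightarrow> 0"
  proof (rule order_tendstoI)
    fix a :: real assume "a < 0"
    then show "\<forall>\<^sub>F n in sequentially. a < Msq (S n u) u"
      by (intro always_eventually allI less_le_trans[OF _ Msq_nonneg])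
  next
    fix a :: real assume a: "0 < a"
    \<comment> \<open>Three weak triangle inequalities give 2 + 4 C * 4 + 4 * 4 = 18 + 16 C times
      \<delta>; the extra 2 makes the final inequality strict.\<close>
    define \<delta> where "\<delta> = a / (2 * (18 + 16 * C))"
    have k0: "0 < 18 + 16 * C" using C(1) by simp
    moreover have "k * (a / (2 * k)) = a / 2" if "0 < k" for k using that by simp
    ultimately have "(18 + 16 * C) * \<delta> = a / 2" unfolding \<delta>_def by blast
    then have d: "0 < \<delta>" "(18 + 16 * C) * \<delta> < a" using a k0 by (simp_all add: \<delta>_def)
    obtain F c where F: "finite F" "F \<subseteq> Lam" "Msq u (Mcomb F c evec) < \<delta>" using approx[OF d(1)] by blast
    define p where "p = Mcomb F c evec"
    have pM: "inM p" unfolding p_def by (rule inM_Mcomb)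
    have "\<forall>\<^sub>F n in sequentially. Msq (S n p) p < \<delta>"
      unfolding p_def by (rule order_tendstoD(2)[OF comb_conv[OF F(1,2)] d(1)])
    then show "\<forall>\<^sub>F n in sequentially. Msq (S n u) u < a"
      using C(2)
    proof eventually_elim
      case (elim n)
      obtain k where k: "0 \<le> k" "\<And>v. inM v \<Longrightarrow> Msq (S n u) (S n v) \<le> k * Msq u v" using S_cont by blast
      \<comment> \<open>The combination q is chosen after n, so close to u that k cannot spoil it.
        Between q and the fixed p the bound is uniform in n.\<close>
      define \<eta> where "\<eta> = min \<delta> (\<delta> / (k + 1))"
      have "0 < \<eta>" using d(1) k(1) by (simp add: \<eta>_def)
      then obtain F' c' where F': "finite F'" "F' \<subseteq> Lam" "Msq u (Mcomb F' c' evec) < \<eta>" using approx by blast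
      define q where "q = Mcomb F' c' evec"
      have qM: "inM q" unfolding q_def by (rule inM_Mcomb)
      have uq: "Msq u q < \<delta>" using F'(3) by (simp add: q_def \<eta>_def)
      have Suq: "Msq (S n u) (S n q) \<le> \<delta>"
      proof -
        have "Msq (S n u) (S n q) \<le> k * Msq u q" by (rule k(2)[OF qM])
        also have "\<dots> \<le> (k + 1) * (\<delta> / (k + 1))"
          using k(1) F'(3) Msq_nonneg[of u q] by (intro mult_mono) (auto simp: q_def \<eta>_def)
        also have "\<dots> = \<delta>" using k(1) by simp
        finally show ?thesis .
      qed
      have Sqp: "Msq (S n q) (S n p) \<le> C * Msq q p"
      proof -
        \<comment> \<open>A common index set makes q - p one combination, to which the uniform bound
          applies.\<close>
        define G where "G = F \<union> F'"
        define cp where "cp \<mu> = (if \<mu> \<in> F then c \<mu> else 0)" for \<mu>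
        define cq where "cq \<mu> = (if \<mu> \<in> F' then c' \<mu> else 0)" for \<mu>
        have G: "finite G" "G \<subseteq> Lam" using F F' by (auto simp: G_def)
        have ext: "Mcomb A b evec = Mcomb G (\<lambda>\<mu>. if \<mu> \<in> A then b \<mu> else 0) evec" if "A \<subseteq> G" for A b
        proof -
          have "(\<Sum>\<mu>\<in>A. b \<mu> * h \<mu>) = (\<Sum>\<mu>\<in>G. (if \<mu> \<in> A then b \<mu> else 0) * h \<mu>)" for h :: "complex \<Rightarrow> complex"
            by (rule sum.mono_neutral_cong_left[OF G(1) that]) auto
          then show ?thesis by (simp add: Mcomb_def)
        qed
        have pq: "p = Mcomb G cp evec" "q = Mcomb G cq evec"
          unfolding p_def q_def cp_def cq_def by (rule ext; simp add: G_def)+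
        have "Msq (S n q) (S n p) = Mnsq (Mcomb {\<mu>. \<mu> \<in> G \<and> cmod \<mu> < R n} (\<lambda>\<mu>. Wn (l n) n \<mu> * (cq \<mu> - cp \<mu>)) evec)"
          unfolding pq S_comb[OF G] Msq_Mcomb by (simp add: right_diff_distrib)
        also have "\<dots> \<le> C * Mnsq (Mcomb G (\<lambda>\<mu>. cq \<mu> - cp \<mu>) evec)"
          using elim(2) G by (auto simp: Lam_def)
        finally show ?thesis by (simp add: pq Msq_Mcomb)
      qed
      have qp: "Msq q p \<le> 4 * \<delta>"
        using Msq_triangle[OF qM u pM] uq F(3) Msq_commute[of q u] by (simp add: p_def)
      have "C * Msq q p \<le> C * (4 * \<delta>)" by (rule mult_left_mono[OF qp C(1)])
      moreover have "Msq p u < \<delta>" using F(3) by (simp add: p_def Msq_commute)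
      ultimately have "Msq (S n u) u \<le> (18 + 16 * C) * \<delta>"
        using Msq_triangle[OF S_inM[of n u] S_inM[of n q] u] Msq_triangle[OF S_inM[of n q] S_inM[of n p] u]
          Msq_triangle[OF S_inM[of n p] pM u] Suq Sqp elim(1)
        by (simp add: distrib_right)
      then show ?case using d(2) by linarith
    qed
  qed
  then have "(\<lambda>n. sqrt (Msq (S n u) u)) \<longlonglongrightarrow> sqrt 0" by (rule tendsto_real_sqrt)
  then show "(\<lambda>n. Mdist (Sop Lam xs (l n) (R n) n u) u) \<longlonglongrightarrow> 0"
    by (simp add: Mdist_eq S_def)
qed

end
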